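(* Let $K$ be a global field, let $R\subset K$ be its ring of integers (number field case) or the ring of elements of $K$ regular away from a fixed nonempty finite set of places (function field case), and take $S=R$. For a nonzero prime ideal $\mathfrak p$ of $R$ put $q_{\mathfrak p}=\#(R/\mathfrak p)$, which is finite, and for an integer $q\ge 2$ put $w_q(n)=\sum_{j\ge 1}\lfloor n/q^j\rfloor$. Then for every integer $n\ge 0$ the $n$th Bhargava factorial ideal of $R$ is $$[n]!_{R,R}=\prod_{\mathfrak p}\mathfrak p^{\,w_{q_{\mathfrak p}}(n)},$$ the product running over all nonzero prime ideals $\mathfrak p$ of $R$. The local recurrence cocycle $a_{R,\mathfrak p}(n)=\nu_{R,\mathfrak p}(n)-\nu_{R,\mathfrak p}(n-1)$ is given, for every $n\ge 1$ and every $\mathfrak p$, by $$a_{R,\mathfrak p}(n)=\sum_{j\ge 1}\mathbf 1_{q_{\mathfrak p}^j\mid n}.$$ Consequently, every nonzero prime ideal $\mathfrak p$ is represented by a cyclotomic tower of orbit lengths $q_{\mathfrak p},q_{\mathfrak p}^2,q_{\mathfrak p}^3,\ldots$; that is, $a_{R,\mathfrak p}(n)$ is the number of $j\ge 1$ such that $n$ steps around a cycle of length $q_{\mathfrak p}^j$ return to the starting point.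
   Context: Such a ring $R$ is a Dedekind domain: with $\Sigma_\infty$ the set of Archimedean places (number field case) or the fixed nonempty finite set of places designated as infinity (function field case), $R=\{x\in K: v_{\mathfrak p}(x)\ge 0\text{ for every finite place }\mathfrak p\notin\Sigma_\infty\}$. Bhargava factorial ideals: let $S\subseteq R$ be infinite and $\mathfrak p$ a nonzero prime ideal of $R$. A $\mathfrak p$-ordering of $S$ is a sequence $(a_n)_{n\ge 0}$ in $S$ chosen greedily so that, for every $n$, $a_n$ minimizes $v_{\mathfrak p}\bigl(\prod_{j=0}^{n-1}(x-a_j)\bigr)$ over $x\in S$. The minimal value $\nu_{S,\mathfrak p}(n)=v_{\mathfrak p}\bigl(\prod_{j=0}^{n-1}(a_n-a_j)\bigr)$ is independent of the chosen $\mathfrak p$-ordering (Bhargava). The $n$th Bhargava factorial ideal is $[n]!_{S,R}=\prod_{\mathfrak p}\mathfrak p^{\nu_{S,\mathfrak p}(n)}$; for each $n$ only finitely many exponents are nonzero. $\mathbf 1_{P}$ is $1$ if $P$ holds and $0$ otherwise. *)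

theory Defs
  imports Complex_Main "HOL-Library.Extended_Nat" "HOL-Algebra.Algebra"
    "HOL-Algebra.Finite_Extensions" "HOL-Algebra.Ideal_Product"
begin

section \<open>Global fields and their rings\<close>

text \<open>\<open>generate_field K {}\<close> is the prime field of \<open>K\<close>, i.e. the rationals in characteristic 0.\<close>

definition number_field :: "('a, 'b) ring_scheme \<Rightarrow> bool" where
  "number_field K \<longleftrightarrow>
     field K \<and>
     (\<forall>m::nat. m > 0 \<longrightarrow> [m] \<cdot>\<^bsub>K\<^esub> \<one>\<^bsub>K\<^esub> \<noteq> \<zero>\<^bsub>K\<^esub>) \<and>
     ring.finite_dimension K (generate_field K {}) (carrier K)"

text \<open>Finite extensions of \<open>F(t)\<close>, with \<open>F\<close> a finite field and \<open>t\<close> transcendental over \<open>F\<close>.\<close>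

definition global_function_field :: "('a, 'b) ring_scheme \<Rightarrow> bool" where
  "global_function_field K \<longleftrightarrow>
     field K \<and>
     (\<exists>F t. subfield F K \<and> finite F \<and> t \<in> carrier K \<and> ring.transcendental K F t \<and>
            ring.finite_dimension K (generate_field K (insert t F)) (carrier K))"

definition prime_subring :: "('a, 'b) ring_scheme \<Rightarrow> 'a set" where
  "prime_subring K = range (\<lambda>m::int. [m] \<cdot>\<^bsub>K\<^esub> \<one>\<^bsub>K\<^esub>)"

definition ring_of_integers :: "('a, 'b) ring_scheme \<Rightarrow> ('a, 'b) ring_scheme" where
  "ring_of_integers K = K \<lparr> carrier :=
     {x \<in> carrier K. \<exists>f \<in> carrier (univ_poly K (prime_subring K)).
        f \<noteq> [] \<and> lead_coeff f = \<one>\<^bsub>K\<^esub> \<and> ring.eval K f x = \<zero>\<^bsub>K\<^esub>} \<rparr>"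

text \<open>
  The places of a global function field are all non-Archimedean; each is represented by its
  discrete valuation normalized to have value group the full group of integers.  Triviality on
  the constants is automatic, since nonzero constants are roots of unity.  A valuation is only
  defined on nonzero elements (its value at 0 being infinite); extensionality makes distinct
  functions represent distinct places, which matters when places are to be excluded.
\<close>

definition places :: "('a, 'b) ring_scheme \<Rightarrow> ('a \<Rightarrow> int) set" where
  "places K = {v \<in> extensional (carrier K - {\<zero>\<^bsub>K\<^esub>}).
     v ` (carrier K - {\<zero>\<^bsub>K\<^esub>}) = UNIV \<and>
     (\<forall>x \<in> carrier K - {\<zero>\<^bsub>K\<^esub>}. \<forall>y \<in> carrier K - {\<zero>\<^bsub>K\<^esub>}.
        v (x \<otimes>\<^bsub>K\<^esub> y) = v x + v y \<and>
        (x \<oplus>\<^bsub>K\<^esub> y \<noteq> \<zero>\<^bsub>K\<^esub> \<longrightarrow> min (v x) (v y) \<le> v (x \<oplus>\<^bsub>K\<^esub> y)))}"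

definition ring_regular_away :: "('a, 'b) ring_scheme \<Rightarrow> ('a \<Rightarrow> int) set \<Rightarrow> ('a, 'b) ring_scheme" where
  "ring_regular_away K \<Sigma> = K \<lparr> carrier :=
     {x \<in> carrier K. x = \<zero>\<^bsub>K\<^esub> \<or> (\<forall>v \<in> places K - \<Sigma>. 0 \<le> v x)} \<rparr>"

section \<open>Primes and ideal products\<close>

definition nonzero_primes :: "('a, 'b) ring_scheme \<Rightarrow> 'a set set" where
  "nonzero_primes R = {P. primeideal P R \<and> P \<noteq> {\<zero>\<^bsub>R\<^esub>}}"

definition residue_card :: "('a, 'b) ring_scheme \<Rightarrow> 'a set \<Rightarrow> nat" where
  "residue_card R P = card (carrier (R Quot P))"

text \<open>
  The product of the \<open>P ^ e P\<close> over all nonzero primes, in the multiplicative monoid of ideals.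
  Restricting to the support of \<open>e\<close> only omits factors equal to the unit ideal; the value is
  meaningful when the support is finite.
\<close>

definition prime_ideal_product :: "('a, 'b) ring_scheme \<Rightarrow> ('a set \<Rightarrow> nat) \<Rightarrow> 'a set" where
  "prime_ideal_product R e =
     (\<Otimes>\<^bsub>ideals_set R\<^esub> P \<in> {P \<in> nonzero_primes R. e P \<noteq> 0}. P [^]\<^bsub>ideals_set R\<^esub> e P)"

text \<open>The \<open>P\<close>-adic valuation on \<open>R\<close>, with value \<open>\<infinity>\<close> at 0.\<close>

definition ideal_val :: "('a, 'b) ring_scheme \<Rightarrow> 'a set \<Rightarrow> 'a \<Rightarrow> enat" where
  "ideal_val R P x = Sup {enat k | k. x \<in> P [^]\<^bsub>ideals_set R\<^esub> k}"

section \<open>Bhargava factorials\<close>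

definition diff_prod :: "('a, 'b) ring_scheme \<Rightarrow> (nat \<Rightarrow> 'a) \<Rightarrow> nat \<Rightarrow> 'a \<Rightarrow> 'a" where
  "diff_prod R a n x = (\<Otimes>\<^bsub>R\<^esub> j \<in> {..<n}. x \<ominus>\<^bsub>R\<^esub> a j)"

definition p_ordering :: "('a, 'b) ring_scheme \<Rightarrow> 'a set \<Rightarrow> 'a set \<Rightarrow> (nat \<Rightarrow> 'a) \<Rightarrow> bool" where
  "p_ordering R S P a \<longleftrightarrow>
     (\<forall>n. a n \<in> S \<and>
        (\<forall>x \<in> S. ideal_val R P (diff_prod R a n (a n)) \<le> ideal_val R P (diff_prod R a n x)))"

text \<open>
  The definite description refers to existence of a \<open>P\<close>-ordering and to Bhargava's theorem that
  the minimal value, which is finite for infinite \<open>S\<close>, does not depend on the ordering.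
\<close>

definition bhargava_exp :: "('a, 'b) ring_scheme \<Rightarrow> 'a set \<Rightarrow> 'a set \<Rightarrow> nat \<Rightarrow> nat" where
  "bhargava_exp R S P n =
     (THE m. \<exists>a. p_ordering R S P a \<and> ideal_val R P (diff_prod R a n (a n)) = enat m)"

definition bhargava_factorial :: "('a, 'b) ring_scheme \<Rightarrow> 'a set \<Rightarrow> nat \<Rightarrow> 'a set" where
  "bhargava_factorial R S n = prime_ideal_product R (\<lambda>P. bhargava_exp R S P n)"

text \<open>Only meaningful for \<open>n \<ge> 1\<close>.\<close>

definition recurrence_cocycle :: "('a, 'b) ring_scheme \<Rightarrow> 'a set \<Rightarrow> 'a set \<Rightarrow> nat \<Rightarrow> int" where
  "recurrence_cocycle R S P n = int (bhargava_exp R S P n) - int (bhargava_exp R S P (n - 1))"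

text \<open>
  The series of \<open>n div q ^ j\<close> over \<open>j \<ge> 1\<close>, reindexed from 0; for \<open>q \<ge> 2\<close> only finitely many
  terms are nonzero.
\<close>

definition legendre_sum :: "nat \<Rightarrow> nat \<Rightarrow> nat" where
  "legendre_sum q n = suminf (\<lambda>j. n div q ^ Suc j)"

section \<open>Cycles\<close>

text \<open>The cycle of length \<open>L\<close> has vertices \<open>0, \<dots>, L - 1\<close>, and \<open>L - 1\<close> steps to \<open>0\<close>.\<close>

definition cycle_step :: "nat \<Rightarrow> nat \<Rightarrow> nat" where
  "cycle_step L i = Suc i mod L"

definition returns_to_start :: "nat \<Rightarrow> nat \<Rightarrow> bool" where
  "returns_to_start L n \<longleftrightarrow> (\<forall>i < L. (cycle_step L ^^ n) i = i)"

end

theory Submission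
  imports Defs
begin

text \<open>
  If \<open>q = #(R/P)\<close> then every class modulo \<open>P\<^sup>k\<close> splits into \<open>q\<close> classes modulo \<open>P\<^sup>k\<^sup>+\<^sup>1\<close>, and the
  valuation of the product of the differences \<open>x - a\<^sub>j\<close>, \<open>j < n\<close>, is the sum over \<open>k \<ge> 1\<close> of the
  number of \<open>j\<close> with \<open>a\<^sub>j\<close> congruent to \<open>x\<close> modulo \<open>P\<^sup>k\<close>. By induction a greedy sequence stays
  equidistributed on all levels at once, so that the minimum is the sum of the \<open>n div q\<^sup>k\<close>.

  The local structure at \<open>P\<close> only needs that \<open>R/xR\<close> is finite for \<open>x \<noteq> 0\<close> and that \<open>R\<close> is completely
  integrally closed. Finiteness holds for every subring of a global field: sums of \<open>r\<^sub>i x\<^sup>i\<close>,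
  \<open>i < k\<close>, with digits \<open>r\<^sub>i\<close> that are incongruent modulo \<open>x\<close> are pairwise distinct, but their heights
  grow linearly with \<open>k\<close>, which bounds the number of digits. Integral closedness is read off the
  valuations for function fields; for number fields it follows from the finiteness of \<open>R/cR\<close>, since
  \<open>w\<^sup>n c \<in> R\<close> for all \<open>n\<close> yields a monic equation \<open>w\<^sup>j = w\<^sup>i + r\<close> over \<open>R\<close>.
\<close>

subsection \<open>Greedy sequences in a regular tree\<close>

text \<open>Minimality is used against a single competitor: a point whose classes contain the fewest
  earlier terms on all relevant levels at once. The induction follows an arbitrary greedy sequence,
  so independence of the minimum from the chosen ordering comes out as a result. On the algebraic
  side the obstacle is that P has no known generator or inverse. Localization is replaced by a pair:
  \<open>\<pi>\<close> in P and \<open>u\<close> outside P with uP contained in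
  \<open>\<pi>\<close>R, so that x lies in the k-th power of P exactly when the k-th power of
  \<open>\<pi>\<close> divides u^k x. Complete integral closedness produces this pair, since it
  prevents P from being stable under multiplication by a fraction b/a outside R. Both kinds of
  global field enter the finiteness argument through the same data: finite coefficient sets B n of
  exponentially bounded size, on which a product adds indices and a sum costs one more index. They
  are the integers of absolute value at most 2^n, or polynomial values of degree at most n over the
  finite field. The denominators of the digits contribute only a constant factor, which exponential
  growth in the number of places absorbs.\<close>

text \<open>Beyond level \<open>n\<close> already \<open>2 ^ k > n\<close>. The cutoff
  \<open>L\<close> is left free so that the sums for \<open>n - 1\<close> and \<open>n\<close> can
  later be taken over the same range.\<close>

lemma legendre_sum_eq:
  assumes "2 \<le> q" "n \<le> L"
  shows "legendre_sum q n = (\<Sum>k=1..L. n div q ^ k)"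
proof -
  have "n div q ^ Suc j = 0" if "j \<notin> {..<L}" for j
  proof -
    have "n < 2 ^ n" by (rule less_exp)
    also have "\<dots> \<le> 2 ^ Suc j" using that assms by (intro power_increasing) auto
    also have "\<dots> \<le> q ^ Suc j" using assms by (intro power_mono) auto
    finally show ?thesis by simp
  qed
  then have "legendre_sum q n = (\<Sum>j<L. n div q ^ Suc j)"
    unfolding legendre_sum_def by (intro suminf_finite) auto
  also have "\<dots> = (\<Sum>k=1..L. n div q ^ k)"
    by (rule sum.reindex_bij_witness[of _ "\<lambda>k. k - 1" Suc]) auto
  finally show ?thesis .
qed

lemma div_ceiling_Suc: "0 < m \<Longrightarrow> (Suc n + m - 1) div m = n div m + (1::nat)"
  by simp

text \<open>The model is congruence modulo the powers of P. Children of a class are encoded by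
  representatives \<open>T\<close>, so that no sets of classes have to be handled. Distinct points
  are allowed to agree on every level.\<close>

locale q_ary_tree =
  fixes S :: "'a set" and E :: "nat \<Rightarrow> 'a \<Rightarrow> 'a \<Rightarrow> bool" and q :: nat
  assumes q_ge_2: "2 \<le> q"
    and E_0: "\<lbrakk>x \<in> S; y \<in> S\<rbrakk> \<Longrightarrow> E 0 x y"
    and E_refl: "x \<in> S \<Longrightarrow> E k x x"
    and E_sym: "\<lbrakk>x \<in> S; y \<in> S; E k x y\<rbrakk> \<Longrightarrow> E k y x"
    and E_trans: "\<lbrakk>x \<in> S; y \<in> S; z \<in> S; E k x y; E k y z\<rbrakk> \<Longrightarrow> E k x z"
    and E_Suc: "\<lbrakk>x \<in> S; y \<in> S; E (Suc k) x y\<rbrakk> \<Longrightarrow> E k x y"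
    and E_split: "x \<in> S \<Longrightarrow> \<exists>T\<subseteq>S. finite T \<and> card T = q \<and> (\<forall>t\<in>T. E k x t) \<and>
                   (\<forall>y\<in>S. E k x y \<longrightarrow> (\<exists>!t. t \<in> T \<and> E (Suc k) y t))"
begin

text \<open>Depth of the last common class; for the congruences modulo powers of P this is the
  valuation of the difference, infinite on the diagonal.\<close>

definition sep :: "'a \<Rightarrow> 'a \<Rightarrow> enat" where
  "sep x y = Sup {enat k | k. E k x y}"

definition cnt :: "(nat \<Rightarrow> 'a) \<Rightarrow> nat \<Rightarrow> nat \<Rightarrow> 'a \<Rightarrow> nat" where
  "cnt b n k x = card {j. j < n \<and> E k x (b j)}"

lemma E_le: "\<lbrakk>x \<in> S; y \<in> S; E k x y; i \<le> k\<rbrakk> \<Longrightarrow> E i x y"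
  by (induction k) (auto simp: le_Suc_eq dest: E_Suc)

lemma sum_levels_E:
  assumes "x \<in> S" "y \<in> S" "E k x y"
  shows "(\<Sum>i=1..k. of_bool (E i x y)) = k"
proof -
  have "(\<Sum>i=1..k. of_bool (E i x y)) = (\<Sum>i=1..k. 1::nat)"
    using E_le[OF assms] by (intro sum.cong) auto
  then show ?thesis by simp
qed

text \<open>By nesting, the common levels up to \<open>L\<close> form an initial segment, so their
  number is itself a common level. Agreement may continue past \<open>L\<close>; separation at level
  \<open>Suc L\<close> turns the bound into the equality \<open>sep_eq\<close>.\<close>

lemma sep_ge:
  assumes "x \<in> S" "y \<in> S"
  shows "enat (\<Sum>i=1..L. of_bool (E i x y)) \<le> sep x y"
proof -
  have "\<exists>m. E m x y \<and> (\<Sum>i=1..L. of_bool (E i x y)) = m"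
  proof (induction L)
    case 0
    then show ?case using E_0 assms by auto
  next
    case (Suc L)
    then show ?case
      using sum_levels_E[OF assms, of "Suc L"] by (cases "E (Suc L) x y") auto
  qed
  then show ?thesis unfolding sep_def by (auto intro!: Sup_upper)
qed

lemma sep_eq:
  assumes "x \<in> S" "y \<in> S" "\<not> E (Suc L) x y"
  shows "sep x y = enat (\<Sum>i=1..L. of_bool (E i x y))"
proof (rule antisym[OF _ sep_ge[OF assms(1,2)]])
  have "k \<le> (\<Sum>i=1..L. of_bool (E i x y))" if "E k x y" for k
  proof -
    have "k \<le> L" using E_le[OF assms(1,2) that] assms(3) by (meson not_less_eq_eq)
    then have "(\<Sum>i=1..k. of_bool (E i x y)) \<le> (\<Sum>i=1..L. of_bool (E i x y) :: nat)"
      by (intro sum_mono2) auto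
    then show ?thesis using sum_levels_E[OF assms(1,2) that] by simp
  qed
  then show "sep x y \<le> enat (\<Sum>i=1..L. of_bool (E i x y))"
    unfolding sep_def by (auto intro!: Sup_least)
qed

lemma cnt_as_sum: "cnt b n k x = (\<Sum>j<n. of_bool (E k x (b j)))"
proof -
  have "{j. j < n \<and> E k x (b j)} = {..<n} \<inter> {j. E k x (b j)}" by auto
  then show ?thesis by (simp add: cnt_def)
qed

lemma sum_cnt: "(\<Sum>k=1..L. cnt b n k x) = (\<Sum>j<n. \<Sum>k=1..L. of_bool (E k x (b j)))"
  unfolding cnt_as_sum by (rule sum.swap)

lemma enat_sum: "finite A \<Longrightarrow> (\<Sum>j\<in>A. enat (f j)) = enat (\<Sum>j\<in>A. f j)"
  by (induction A rule: finite_induct) (auto simp: zero_enat_def)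

text \<open>Legendre's double count: a depth is a number of common levels, so a sum of depths over
  \<open>j\<close> is a sum of class sizes over the levels. Truncation at \<open>L\<close> costs the
  equality.\<close>

lemma sum_sep_ge:
  assumes "x \<in> S" "\<And>j. b j \<in> S"
  shows "enat (\<Sum>k=1..L. cnt b n k x) \<le> (\<Sum>j<n. sep x (b j))"
  unfolding sum_cnt enat_sum[symmetric, OF finite_lessThan]
  by (intro sum_mono sep_ge assms)

lemma sum_sep_eq:
  assumes "x \<in> S" "\<And>j. b j \<in> S" "cnt b n (Suc L) x = 0"
  shows "(\<Sum>j<n. sep x (b j)) = enat (\<Sum>k=1..L. cnt b n k x)"
proof -
  have "\<not> E (Suc L) x (b j)" if "j < n" for j
    using assms(3) that unfolding cnt_def by (auto simp: card_eq_0_iff)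
  then show ?thesis
    unfolding sum_cnt enat_sum[symmetric, OF finite_lessThan]
    by (intro sum.cong sep_eq assms) auto
qed

lemma cnt_cong:
  assumes "x \<in> S" "y \<in> S" "\<And>j. b j \<in> S" "E k x y"
  shows "cnt b n k x = cnt b n k y"
proof -
  have "E k x (b j) \<longleftrightarrow> E k y (b j)" for j
    using E_trans E_sym assms by meson
  then show ?thesis by (simp add: cnt_def)
qed

lemma cnt_0: "\<lbrakk>x \<in> S; \<And>j. b j \<in> S\<rbrakk> \<Longrightarrow> cnt b n 0 x = n"
  by (simp add: cnt_def E_0)

text \<open>Class sizes are additive over the children. The child \<open>t\<close> containing
  \<open>x\<close> itself is singled out because the count at \<open>x\<close> on the next level is
  later read off from it.\<close>

lemma cnt_split:
  assumes "x \<in> S" and b: "\<And>j. b j \<in> S"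
  obtains T t where "T \<subseteq> S" "finite T" "card T = q" "\<forall>s\<in>T. E k x s" "t \<in> T" "E (Suc k) x t"
    "cnt b n k x = (\<Sum>s\<in>T. cnt b n (Suc k) s)"
proof -
  obtain T where T: "T \<subseteq> S" "finite T" "card T = q" "\<And>t. t \<in> T \<Longrightarrow> E k x t"
    "\<And>y. y \<in> S \<Longrightarrow> E k x y \<Longrightarrow> \<exists>!t. t \<in> T \<and> E (Suc k) y t"
    using E_split[OF assms(1)] by metis
  have inS: "t \<in> S" if "t \<in> T" for t using that T(1) by blast
  have "{j. j < n \<and> E k x (b j)} = (\<Union>t\<in>T. {j. j < n \<and> E (Suc k) t (b j)})" (is "?l = ?r")
  proof
    show "?l \<subseteq> ?r" using T(5)[OF b] E_sym[OF b] inS by fastforce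
    show "?r \<subseteq> ?l"
      using E_trans[OF \<open>x \<in> S\<close> inS b T(4) E_Suc[OF inS b]] by fastforce
  qed
  moreover have "card ?r = (\<Sum>t\<in>T. cnt b n (Suc k) t)"
    unfolding cnt_def
  proof (rule card_UN_disjoint)
    show "\<forall>i\<in>T. \<forall>j\<in>T. i \<noteq> j \<longrightarrow>
            {l. l < n \<and> E (Suc k) i (b l)} \<inter> {l. l < n \<and> E (Suc k) j (b l)} = {}"
    proof (intro ballI impI equals0I)
      fix s t l assume st: "s \<in> T" "t \<in> T" "s \<noteq> t"
        and "l \<in> {l. l < n \<and> E (Suc k) s (b l)} \<inter> {l. l < n \<and> E (Suc k) t (b l)}"
      then have l: "E (Suc k) s (b l)" "E (Suc k) t (b l)" by auto
      have "E k x (b l)"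
        using E_trans[OF \<open>x \<in> S\<close> inS b T(4) E_Suc[OF inS b l(1)]] st by blast
      with T(5)[OF b this] l st E_sym[OF inS b] show False by metis
    qed
  qed (use T in auto)
  ultimately have "cnt b n k x = (\<Sum>t\<in>T. cnt b n (Suc k) t)" by (simp add: cnt_def)
  moreover obtain t where "t \<in> T" "E (Suc k) x t"
    using T(5)[OF assms(1) E_refl[OF assms(1)]] by blast
  ultimately show ?thesis using that T(1-4) by blast
qed

text \<open>Equidistribution up to rounding: the two bounds are the floor and the ceiling of
  \<open>n / q ^ k\<close>. The floors govern the minimum; the ceilings are carried along because
  they force the new floor when \<open>q ^ k\<close> divides \<open>Suc n\<close>.\<close>

definition balanced :: "(nat \<Rightarrow> 'a) \<Rightarrow> nat \<Rightarrow> bool" where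
  "balanced b n \<longleftrightarrow> (\<forall>k. \<forall>x\<in>S. n div q ^ k \<le> cnt b n k x \<and> cnt b n k x \<le> (n + q ^ k - 1) div q ^ k)"

text \<open>Descent by averaging: among the \<open>q\<close> children of a class of size
  \<open>n div q ^ k\<close>, one has size at most \<open>n div q ^ Suc k\<close>, and balance
  excludes less. Passing to that child leaves the counts on earlier levels unchanged, so one point
  attains all floors simultaneously.\<close>

lemma balanced_thin_branch:
  assumes b: "\<And>j. b j \<in> S" and bal: "balanced b n"
  shows "\<exists>x\<in>S. \<forall>i\<le>k. cnt b n i x = n div q ^ i"
proof (induction k)
  case 0
  then show ?case using b cnt_0 by auto
next
  case (Suc k)
  then obtain x where x: "x \<in> S" "\<And>i. i \<le> k \<Longrightarrow> cnt b n i x = n div q ^ i" by blast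
  obtain T t where T: "T \<subseteq> S" "finite T" "card T = q" "\<forall>t\<in>T. E k x t" "t \<in> T" "E (Suc k) x t"
    "cnt b n k x = (\<Sum>t\<in>T. cnt b n (Suc k) t)"
    by (rule cnt_split[where x=x and b=b and k=k and n=n, OF x(1) b])
  have "\<exists>t\<in>T. cnt b n (Suc k) t \<le> n div q ^ Suc k"
  proof (rule ccontr)
    assume "\<not> ?thesis"
    then have "(\<Sum>t\<in>T. Suc (n div q ^ Suc k)) \<le> (\<Sum>t\<in>T. cnt b n (Suc k) t)"
      by (intro sum_mono) auto
    then have "q * Suc (n div q ^ Suc k) \<le> n div q ^ k"
      using T(3,7) x(2)[of k] by simp
    moreover have "n div q ^ Suc k = n div q ^ k div q"
      by (simp only: power_Suc2 div_mult2_eq)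
    ultimately have "q * Suc (n div q ^ k div q) \<le> n div q ^ k" by simp
    then show False using dividend_less_times_div[of q "n div q ^ k"] q_ge_2 by simp
  qed
  then obtain t where t: "t \<in> T" "cnt b n (Suc k) t \<le> n div q ^ Suc k" by blast
  have tS: "t \<in> S" using t T by blast
  have "cnt b n i t = n div q ^ i" if "i \<le> Suc k" for i
  proof (cases "i = Suc k")
    case True
    then show ?thesis using t bal tS unfolding balanced_def by (metis antisym)
  next
    case False
    then have "E i x t" using E_le[OF x(1) tS bspec[OF T(4) t(1)]] that by simp
    then have "cnt b n i x = cnt b n i t" by (intro cnt_cong x(1) tS b)
    then show ?thesis using x(2) False that by simp
  qed
  then show ?case using tS by blast
qed

text \<open>There are \<open>q ^ k\<close> classes of size at most \<open>m\<close> for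
  \<open>m * q ^ k\<close> terms, so all are full. The argument never counts classes: the bound is
  pushed up to the root, where it is an equality, and equality is pushed back down, being equality
  in a sum of bounded summands.\<close>

lemma cnt_const_if_bounded:
  assumes b: "\<And>j. b j \<in> S" and "N = m * q ^ k" and le: "\<And>x. x \<in> S \<Longrightarrow> cnt b N k x \<le> m"
    and "x \<in> S"
  shows "cnt b N k x = m"
proof -
  have up: "\<forall>x\<in>S. cnt b N (k - i) x \<le> m * q ^ i" if "i \<le> k" for i
    using that
  proof (induction i)
    case 0
    then show ?case using le by simp
  next
    case (Suc i)
    show ?case
    proof
      fix x assume "x \<in> S"
      obtain T t where T: "T \<subseteq> S" "finite T" "card T = q" "\<forall>t\<in>T. E (k - Suc i) x t" "t \<in> T"
        "E (Suc (k - Suc i)) x t" "cnt b N (k - Suc i) x = (\<Sum>t\<in>T. cnt b N (Suc (k - Suc i)) t)"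
        by (rule cnt_split[where x=x and b=b and k="k - Suc i" and n=N, OF \<open>x \<in> S\<close> b])
      have "(\<Sum>t\<in>T. cnt b N (Suc (k - Suc i)) t) \<le> (\<Sum>t\<in>T. m * q ^ i)"
        using Suc T(1) by (intro sum_mono) (auto simp: Suc_diff_Suc)
      then show "cnt b N (k - Suc i) x \<le> m * q ^ Suc i" using T by (simp add: mult_ac)
    qed
  qed
  have "\<forall>x\<in>S. cnt b N i x = m * q ^ (k - i)" if "i \<le> k" for i
    using that
  proof (induction i)
    case 0
    then show ?case using cnt_0 b assms(2) by simp
  next
    case (Suc i)
    show ?case
    proof
      fix x assume x: "x \<in> S"
      obtain T t where T: "T \<subseteq> S" "finite T" "card T = q" "\<forall>t\<in>T. E i x t" and t: "t \<in> T"
        "E (Suc i) x t" and Tsum: "cnt b N i x = (\<Sum>t\<in>T. cnt b N (Suc i) t)"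
        by (rule cnt_split[where x=x and b=b and k=i and n=N, OF x b])
      have le: "cnt b N (Suc i) s \<le> m * q ^ (k - Suc i)" if "s \<in> T" for s
        using up[of "k - Suc i"] Suc.prems T(1) that by auto
      have "(\<Sum>t\<in>T. cnt b N (Suc i) t) = m * q ^ Suc (k - Suc i)"
        using Suc Tsum x by (simp add: Suc_diff_Suc)
      then have "(\<Sum>t\<in>T. cnt b N (Suc i) t) = (\<Sum>t\<in>T. m * q ^ (k - Suc i))"
        using T(3) by (simp add: mult_ac)
      then have "cnt b N (Suc i) t = m * q ^ (k - Suc i)"
        by (rule sum_mono_inv[where f="cnt b N (Suc i)", OF _ le t(1) T(2)])
      moreover have "cnt b N (Suc i) x = cnt b N (Suc i) t"
        using t T(1) by (intro cnt_cong x b) auto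
      ultimately show "cnt b N (Suc i) x = m * q ^ (k - Suc i)" by simp
    qed
  qed
  then show ?thesis using assms by simp
qed

text \<open>Every count at \<open>b n\<close> is at least its floor, while minimality caps their sum
  by that of the thin branch, which is the sum of the floors. Hence equality holds on each level
  separately.\<close>

lemma greedy_step:
  assumes b: "\<And>j. b j \<in> S" and bal: "balanced b n"
    and min: "\<And>x. x \<in> S \<Longrightarrow> (\<Sum>j<n. sep (b n) (b j)) \<le> (\<Sum>j<n. sep x (b j))"
  shows "(\<Sum>j<n. sep (b n) (b j)) = enat (legendre_sum q n)"
    and "cnt b n k (b n) = n div q ^ k"
proof -
  have zero: "n div q ^ i = 0" if "i \<ge> n" for i
  proof -
    have "n < 2 ^ n" by (rule less_exp)
    also have "\<dots> \<le> 2 ^ i" using that by (intro power_increasing) auto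
    also have "\<dots> \<le> q ^ i" using q_ge_2 by (intro power_mono) auto
    finally show ?thesis by simp
  qed
  \<comment> \<open>The value itself needs only \<open>L = n\<close>; the count on level
    \<open>k\<close> needs a range that contains \<open>k\<close>, so \<open>L\<close> is kept
    free.\<close>
  have val: "(\<Sum>j<n. sep (b n) (b j)) = enat (\<Sum>i=1..L. n div q ^ i) \<and>
             (\<forall>i\<in>{1..L}. cnt b n i (b n) = n div q ^ i)" if "L \<ge> n" for L
  proof -
    \<comment> \<open>The branch is followed one level further than the sum, to level
      \<open>Suc L\<close>, where its count is 0 and its depth sum is therefore exact.\<close>
    obtain x where x: "x \<in> S" "\<And>i. i \<le> Suc L \<Longrightarrow> cnt b n i x = n div q ^ i"
      using balanced_thin_branch[OF b bal] by blast
    have "(\<Sum>j<n. sep x (b j)) = enat (\<Sum>i=1..L. cnt b n i x)"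
      using x zero[of "Suc L"] that by (intro sum_sep_eq b) auto
    also have "\<dots> = enat (\<Sum>i=1..L. n div q ^ i)" using x by simp
    finally have up: "(\<Sum>j<n. sep (b n) (b j)) \<le> enat (\<Sum>i=1..L. n div q ^ i)"
      using min[OF x(1)] by simp
    have low: "enat (\<Sum>i=1..L. cnt b n i (b n)) \<le> (\<Sum>j<n. sep (b n) (b j))"
      by (intro sum_sep_ge b)
    have ge: "n div q ^ i \<le> cnt b n i (b n)" for i
      using bal b unfolding balanced_def by blast
    then have "(\<Sum>i=1..L. n div q ^ i) \<le> (\<Sum>i=1..L. cnt b n i (b n))"
      by (intro sum_mono)
    moreover have "(\<Sum>i=1..L. cnt b n i (b n)) \<le> (\<Sum>i=1..L. n div q ^ i)"
      using order_trans[OF low up] by simp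
    ultimately have eq: "(\<Sum>i=1..L. n div q ^ i) = (\<Sum>i=1..L. cnt b n i (b n))" by simp
    have "n div q ^ i = cnt b n i (b n)" if "i \<in> {1..L}" for i
      using sum_mono_inv[OF eq ge that] by simp
    moreover have "(\<Sum>j<n. sep (b n) (b j)) = enat (\<Sum>i=1..L. n div q ^ i)"
      using up low eq by simp
    ultimately show ?thesis by simp
  qed
  show "(\<Sum>j<n. sep (b n) (b j)) = enat (legendre_sum q n)"
    using val[of n] legendre_sum_eq[OF q_ge_2, of n n] by simp
  show "cnt b n k (b n) = n div q ^ k"
    using val[of "max n k"] cnt_0[of "b n" b n] b by (cases "k = 0") auto
qed

text \<open>Only the classes of \<open>b n\<close> grow, and they stood at the floor, so they reach
  at most the new ceiling. The floor moves only if \<open>q ^ k\<close> divides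
  \<open>Suc n\<close>; then floor and ceiling coincide and the upper bound alone forces every
  count.\<close>

lemma balanced_Suc:
  assumes b: "\<And>j. b j \<in> S" and bal: "balanced b n"
    and thin: "\<And>k. cnt b n k (b n) = n div q ^ k"
  shows "balanced b (Suc n)"
proof -
  have cnt_Suc: "cnt b (Suc n) k x = cnt b n k x + of_bool (E k x (b n))" for k x
    by (simp add: cnt_as_sum)
  have pos: "q ^ k > 0" for k using q_ge_2 by simp
  have up: "cnt b (Suc n) k x \<le> (Suc n + q ^ k - 1) div q ^ k" if "x \<in> S" for k x
  proof (cases "E k x (b n)")
    case True
    then have "cnt b n k x = n div q ^ k" using cnt_cong[OF that b b] thin by simp
    then show ?thesis using True div_ceiling_Suc[OF pos] cnt_Suc by simp
  next
    case False
    have "cnt b n k x \<le> (n + q ^ k - 1) div q ^ k" using bal that unfolding balanced_def by blast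
    also have "\<dots> \<le> (Suc n + q ^ k - 1) div q ^ k" by (intro div_le_mono) auto
    finally show ?thesis using False cnt_Suc by simp
  qed
  have low: "Suc n div q ^ k \<le> cnt b (Suc n) k x" if "x \<in> S" for k x
  proof (cases "q ^ k dvd Suc n")
    case True
    then obtain m where m: "Suc n = m * q ^ k" by (metis dvd_def mult.commute)
    have "(Suc n + q ^ k - 1) div q ^ k = m"
    proof -
      have "(Suc n + (q ^ k - 1)) div q ^ k = m"
        using pos[of k] unfolding m by simp
      then show ?thesis using pos[of k] by simp
    qed
    then have "cnt b (Suc n) k x = m"
      using up[of _ k] by (intro cnt_const_if_bounded[OF b m] that) auto
    then show ?thesis using m pos[of k] by simp
  next
    case False
    then have "Suc n div q ^ k = n div q ^ k" by (simp add: div_Suc dvd_eq_mod_eq_0)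
    also have "\<dots> \<le> cnt b n k x" using bal that unfolding balanced_def by blast
    also have "\<dots> \<le> cnt b (Suc n) k x" by (simp add: cnt_Suc)
    finally show ?thesis .
  qed
  show ?thesis unfolding balanced_def using up low by blast
qed

theorem greedy_value:
  assumes b: "\<And>j. b j \<in> S"
    and min: "\<And>n x. x \<in> S \<Longrightarrow> (\<Sum>j<n. sep (b n) (b j)) \<le> (\<Sum>j<n. sep x (b j))"
  shows "(\<Sum>j<n. sep (b n) (b j)) = enat (legendre_sum q n)"
proof -
  have "balanced b n" for n
  proof (induction n)
    case 0
    then show ?case by (simp add: balanced_def cnt_def)
  next
    case (Suc n)
    show ?case
      by (rule balanced_Suc[of b, OF b Suc]) (rule greedy_step(2)[of b, OF b Suc min])
  qed
  then show ?thesis by (rule greedy_step(1)[of b, OF b _ min])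
qed

end

subsection \<open>Prime ideals in domains with finite quotients\<close>

lemma (in ring) quot_carrier_eq: "carrier (R Quot I) = (\<lambda>x. I +> x) ` carrier R"
  by (auto simp: FactRing_def A_RCOSETS_def')

text \<open>The explicit range \<open>j \<le> n\<close> matters when one finite set of pairs has to
  serve all primes with at most \<open>n\<close> residue classes.\<close>

lemma (in ring) quot_pigeonhole_card:
  assumes "ideal I R" "finite (carrier (R Quot I))" "card (carrier (R Quot I)) \<le> n"
    and f: "\<And>i::nat. f i \<in> carrier R"
  shows "\<exists>i j. i < j \<and> j \<le> n \<and> f j \<ominus> f i \<in> I"
proof -
  have "\<not> inj_on (\<lambda>i. I +> f i) {..n}"
  proof
    assume "inj_on (\<lambda>i. I +> f i) {..n}"
    then have "card {..n} \<le> card (carrier (R Quot I))"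
      by (rule card_inj_on_le) (use assms in \<open>auto simp: quot_carrier_eq\<close>)
    with assms show False by simp
  qed
  then obtain i j where ij: "i \<le> n" "j \<le> n" "i \<noteq> j" "I +> f i = I +> f j"
    unfolding inj_on_def by auto
  show ?thesis
  proof (cases "i < j")
    case True
    then show ?thesis using ij quotient_eq_iff_same_a_r_cos[OF assms(1) f f] by metis
  next
    case False
    then have "j < i" using ij by simp
    then show ?thesis using ij quotient_eq_iff_same_a_r_cos[OF assms(1) f f] by metis
  qed
qed

lemma (in ring) quot_pigeonhole:
  assumes "ideal I R" "finite (carrier (R Quot I))" "\<And>i::nat. f i \<in> carrier R"
  shows "\<exists>i j. i < j \<and> f j \<ominus> f i \<in> I"
  using quot_pigeonhole_card[OF assms(1,2) order.refl, of f] assms(3) by blast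

lemma (in ring) finite_quot_mono:
  assumes "ideal I R" "ideal J R" "I \<subseteq> J" "finite (carrier (R Quot I))"
  shows "finite (carrier (R Quot J))"
proof (rule ccontr)
  assume "infinite (carrier (R Quot J))"
  then obtain F :: "nat \<Rightarrow> 'a set" where F: "inj F" "range F \<subseteq> carrier (R Quot J)"
    using infinite_countable_subset by blast
  then have "\<forall>i. \<exists>x. x \<in> carrier R \<and> F i = J +> x"
    unfolding quot_carrier_eq by blast
  then obtain f where f: "\<And>i. f i \<in> carrier R" "\<And>i. F i = J +> f i" by metis
  obtain i j where "i < j" "f j \<ominus> f i \<in> I"
    using quot_pigeonhole[OF assms(1,4), of f] f(1) by blast
  then have "F j = F i"
    using quotient_eq_iff_same_a_r_cos[OF assms(2) f(1) f(1)] f(2) assms(3) by blast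
  with F(1) \<open>i < j\<close> show False by (simp add: inj_eq)
qed

lemma (in ring) ideal_minus_closed:
  assumes "ideal I R" "x \<in> I" "y \<in> I"
  shows "x \<ominus> y \<in> I"
proof -
  interpret ideal I R by fact
  show ?thesis using assms by (simp add: a_minus_def)
qed

lemma (in cring) ideal_add_cancel:
  assumes "ideal I R" "x \<in> carrier R" "y \<in> I"
  shows "x \<oplus> y \<in> I \<longleftrightarrow> x \<in> I" "y \<oplus> x \<in> I \<longleftrightarrow> x \<in> I"
proof -
  interpret ideal I R by fact
  have y: "y \<in> carrier R" using assms Icarr by blast
  have "x \<oplus> y \<ominus> y = x" using y assms(2) by algebra
  then show iff: "x \<oplus> y \<in> I \<longleftrightarrow> x \<in> I"
    using ideal_minus_closed[OF assms(1) _ assms(3), of "x \<oplus> y"] assms(3) by auto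
  show "y \<oplus> x \<in> I \<longleftrightarrow> x \<in> I" using iff y assms(2) by (simp add: a_comm)
qed

lemma (in cring) pow_diff_factor:
  assumes "x \<in> carrier R" "i < (j::nat)"
  shows "x [^] j \<ominus> x [^] i = (x [^] (j - i) \<ominus> \<one>) \<otimes> x [^] i"
proof -
  have "x [^] j = x [^] (j - i) \<otimes> x [^] i"
    using assms by (simp add: nat_pow_mult)
  moreover have "x [^] (j - i) \<in> carrier R" "x [^] i \<in> carrier R" using assms by auto
  ultimately show ?thesis by algebra
qed

lemma (in ring) primeideal_one_notin:
  assumes "primeideal P R" shows "\<one> \<notin> P"
  using primeideal.I_notcarr[OF assms] ideal.one_imp_carrier primeideal.axioms(1)[OF assms] by blast

text \<open>The annihilators \<open>{x. x b \<in> I}\<close> contained in \<open>P\<close> form a finite family; a maximal one is \<open>P\<close>.\<close>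

lemma (in cring) prime_is_annihilator:
  assumes I: "ideal I R" "finite (carrier (R Quot I))" and P: "primeideal P R" "I \<subseteq> P"
  shows "\<exists>b\<in>carrier R. {x \<in> carrier R. x \<otimes> b \<in> I} = P"
proof -
  interpret I: ideal I R by fact
  interpret P: primeideal P R by fact
  define ann where "ann b = {x \<in> carrier R. x \<otimes> b \<in> I}" for b
  define F where "F = {J \<in> ann ` carrier R. J \<subseteq> P}"
  \<comment> \<open>An annihilator depends only on the coset of \<open>b\<close> modulo
    \<open>I\<close>; this is why there are finitely many of them.\<close>
  have ann_coset: "ann b = {x \<in> carrier R. \<exists>c \<in> I +> b. x \<otimes> c \<in> I}" if b: "b \<in> carrier R" for b
  proof -
    have "x \<otimes> b \<in> I" if x: "x \<in> carrier R" and c: "c \<in> I +> b" "x \<otimes> c \<in> I" for x c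
    proof -
      obtain i where i: "i \<in> I" "c = i \<oplus> b" using c unfolding a_r_coset_def' by blast
      have "x \<otimes> c = x \<otimes> i \<oplus> x \<otimes> b" using i x b I.Icarr by (simp add: r_distr)
      moreover have "x \<otimes> i \<in> I" using i x I.I_l_closed by blast
      ultimately show ?thesis using c ideal_add_cancel[OF I(1)] x b by simp
    qed
    moreover have "b \<in> I +> b" using I.a_rcos_self b by blast
    ultimately show ?thesis unfolding ann_def by blast
  qed
  have "finite (ann ` carrier R)"
  proof (rule finite_subset)
    show "ann ` carrier R \<subseteq> (\<lambda>C. {x \<in> carrier R. \<exists>c \<in> C. x \<otimes> c \<in> I}) ` carrier (R Quot I)"
      using ann_coset by (auto simp: quot_carrier_eq image_image)
  qed (use I in simp)
  then have "finite F" unfolding F_def by simp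
  moreover have "ann \<one> \<in> F"
    unfolding F_def using P(2) by (auto simp: ann_def)
  ultimately obtain J where J: "J \<in> F" "\<And>J'. J' \<in> F \<Longrightarrow> J \<subseteq> J' \<Longrightarrow> J' = J"
    using finite_has_maximal[of F] by blast
  then obtain b where b: "b \<in> carrier R" "J = ann b" "ann b \<subseteq> P" unfolding F_def by blast
  have max: "ann c = ann b" if "c \<in> carrier R" "ann c \<subseteq> P" "ann b \<subseteq> ann c" for c
    using J b that unfolding F_def by blast
  have grow: "ann b \<subseteq> ann (b \<otimes> s)" if s: "s \<in> carrier R" for s
  proof
    fix x assume x: "x \<in> ann b"
    then have "x \<otimes> (b \<otimes> s) = s \<otimes> (x \<otimes> b)" using s b unfolding ann_def by (simp add: m_ac)
    then show "x \<in> ann (b \<otimes> s)" using x s I.I_l_closed unfolding ann_def by auto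
  qed
  have "p \<in> ann b" if p: "p \<in> P" for p
  proof (rule ccontr)
    assume np: "p \<notin> ann b"
    have pc: "p \<in> carrier R" using p P.Icarr by blast
    show False
    proof (cases "ann (b \<otimes> p) \<subseteq> P")
      case True
      \<comment> \<open>By maximality \<open>p\<close> can be cancelled modulo \<open>ann b\<close>.
        Two powers of \<open>p\<close> agree modulo \<open>I\<close>, so a positive power of
        \<open>p\<close> is congruent to 1 modulo \<open>ann b\<close>, hence modulo P, which
        contains \<open>p\<close>.\<close>
      then have eq: "ann (b \<otimes> p) = ann b" using max grow pc b by simp
      have cancel: "x \<in> ann b" if "x \<in> carrier R" "x \<otimes> p [^] n \<in> ann b" for x and n :: nat
        using that(2)
      proof (induction n)
        case 0
        then show ?case using that by simp
      next
        case (Suc n)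
        have "x \<otimes> p [^] n \<in> ann (b \<otimes> p)"
          using Suc.prems that(1) b(1) pc by (simp add: ann_def m_ac)
        then show ?case using Suc.IH eq by simp
      qed
      obtain i j :: nat where ij: "i < j" "p [^] j \<ominus> p [^] i \<in> I"
        using quot_pigeonhole[OF I, of "\<lambda>i. p [^] i"] pc by auto
      have "p [^] j \<ominus> p [^] i \<in> ann b"
        unfolding ann_def using ij b pc I.I_r_closed by auto
      then have "p [^] (j - i) \<ominus> \<one> \<in> ann b"
        using cancel[of "p [^] (j - i) \<ominus> \<one>" i] pow_diff_factor[OF pc ij(1)] pc by simp
      then have "p [^] (j - i) \<ominus> \<one> \<in> P" using b by blast
      moreover obtain k where "j - i = Suc k" using ij(1) by (metis Suc_diff_Suc)
      then have "p [^] (j - i) \<in> P" using p pc P.I_l_closed by simp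
      ultimately have "p [^] (j - i) \<ominus> (p [^] (j - i) \<ominus> \<one>) \<in> P"
        using ideal_minus_closed[OF P.is_ideal] by blast
      moreover have "p [^] (j - i) \<ominus> (p [^] (j - i) \<ominus> \<one>) = \<one>"
      proof -
        have "p [^] (j - i) \<in> carrier R" using pc by simp
        then show ?thesis by algebra
      qed
      ultimately show False using primeideal_one_notin[OF P(1)] by simp
    next
      case False
      \<comment> \<open>Here some \<open>s\<close> outside P annihilates
        \<open>b \<otimes> p\<close>. Primality keeps \<open>ann (b \<otimes> s)\<close> inside P,
        so by maximality it equals \<open>ann b\<close>, yet it contains \<open>p\<close>.\<close>
      then obtain s where s: "s \<in> carrier R" "s \<notin> P" "s \<otimes> (b \<otimes> p) \<in> I"
        unfolding ann_def by blast
      have "ann (b \<otimes> s) \<subseteq> P"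
      proof
        fix x assume x: "x \<in> ann (b \<otimes> s)"
        then have "x \<otimes> (b \<otimes> s) = x \<otimes> s \<otimes> b" using s b(1) unfolding ann_def by (simp add: m_ac)
        then have "x \<otimes> s \<in> ann b" using s x unfolding ann_def by simp
        then show "x \<in> P" using b P.I_prime[of x s] s x unfolding ann_def by auto
      qed
      then have "ann (b \<otimes> s) = ann b" using max grow s b by simp
      moreover have "p \<otimes> (b \<otimes> s) = s \<otimes> (b \<otimes> p)" using s pc b(1) by (simp add: m_ac)
      then have "p \<in> ann (b \<otimes> s)" using s pc unfolding ann_def by simp
      ultimately show False using np by simp
    qed
  qed
  then have "ann b = P" using b(3) by blast
  then show ?thesis unfolding ann_def by (intro bexI[OF _ b(1)])
qed

text \<open>The last assumption is complete integral closedness: \<open>c (b / a)\<^sup>n \<in> R\<close> for all \<open>n\<close> implies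
  \<open>b / a \<in> R\<close>.\<close>

locale finite_quotient_domain = domain R for R (structure) +
  assumes finite_principal_quot:
      "\<lbrakk>x \<in> carrier R; x \<noteq> \<zero>\<rbrakk> \<Longrightarrow> finite (carrier (R Quot (PIdl x)))"
    and completely_integrally_closed:
      "\<lbrakk>a \<in> carrier R; b \<in> carrier R; c \<in> carrier R; a \<noteq> \<zero>; c \<noteq> \<zero>;
        \<And>n::nat. \<exists>r\<in>carrier R. b [^] n \<otimes> c = a [^] n \<otimes> r\<rbrakk> \<Longrightarrow> \<exists>r\<in>carrier R. b = a \<otimes> r"
begin

lemma PIdl_iff: "x \<in> PIdl a \<longleftrightarrow> (\<exists>r\<in>carrier R. x = r \<otimes> a)"
  unfolding cgenideal_def by blast

lemma finite_prime_quot: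
  assumes "P \<in> nonzero_primes R"
  shows "finite (carrier (R Quot P))"
proof -
  interpret P: primeideal P R using assms by (simp add: nonzero_primes_def)
  obtain a where a: "a \<in> P" "a \<noteq> \<zero>"
    using assms P.zero_closed unfolding nonzero_primes_def by blast
  show ?thesis
  proof (rule finite_quot_mono)
    show "ideal (PIdl a) R" using a P.Icarr by (intro cgenideal_ideal) blast
    show "PIdl a \<subseteq> P" using a by (intro cgenideal_minimal P.is_ideal)
    show "finite (carrier (R Quot PIdl a))" using a P.Icarr by (intro finite_principal_quot) blast+
  qed (rule P.is_ideal)
qed

text \<open>\<open>P\<close> becomes principal after inverting \<open>u\<close>, with generator \<open>\<pi>\<close>.\<close>

lemma local_uniformizer:
  assumes "P \<in> nonzero_primes R"
  obtains \<pi> u where "\<pi> \<in> P" "u \<in> carrier R" "u \<notin> P" "\<forall>x\<in>P. \<exists>r\<in>carrier R. u \<otimes> x = \<pi> \<otimes> r"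
proof -
  interpret P: primeideal P R using assms by (simp add: nonzero_primes_def)
  obtain a where a: "a \<in> P" "a \<noteq> \<zero>"
    using assms P.zero_closed unfolding nonzero_primes_def by blast
  have ac: "a \<in> carrier R" using a P.Icarr by blast
  have aI: "ideal (PIdl a) R" using ac by (rule cgenideal_ideal)
  \<comment> \<open>The fraction b/a lies outside R but multiplies P into R; it acts as an inverse
    of the uniformizer.\<close>
  obtain b where b: "b \<in> carrier R" "{x \<in> carrier R. x \<otimes> b \<in> PIdl a} = P"
    using prime_is_annihilator[OF aI finite_principal_quot[OF ac a(2)] P.primeideal]
      cgenideal_minimal[OF P.is_ideal a(1)] by blast
  have "b \<notin> PIdl a"
  proof
    assume "b \<in> PIdl a"
    then have "\<one> \<in> {x \<in> carrier R. x \<otimes> b \<in> PIdl a}" using b(1) by simp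
    then show False unfolding b(2) using primeideal_one_notin[OF P.primeideal] by blast
  qed
  have ex: "\<exists>w\<in>carrier R. b \<otimes> p = a \<otimes> w" if "p \<in> P" for p
  proof -
    have "p \<in> carrier R" "p \<otimes> b \<in> PIdl a" using that unfolding b(2)[symmetric] by blast+
    then show ?thesis using ac b(1) by (auto simp: PIdl_iff m_comm)
  qed
  \<comment> \<open>If b/a mapped P into itself, all (b/a)^n a would lie in P and complete integral
    closedness would put b/a into R. So some \<open>\<pi>\<close> in P is mapped to a
    \<open>u\<close> outside P.\<close>
  have "\<exists>p\<in>P. \<exists>w\<in>carrier R - P. b \<otimes> p = a \<otimes> w"
  proof (rule ccontr)
    assume "\<not> ?thesis"
    then have inP: "\<exists>w\<in>P. b \<otimes> p = a \<otimes> w" if "p \<in> P" for p using ex[OF that] that by blast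
    have "\<exists>r\<in>P. b [^] n \<otimes> a = a [^] n \<otimes> r" for n :: nat
    proof (induction n)
      case 0
      then show ?case using a ac by auto
    next
      case (Suc n)
      then obtain r where r: "r \<in> P" "b [^] n \<otimes> a = a [^] n \<otimes> r" by blast
      obtain w where w: "w \<in> P" "b \<otimes> r = a \<otimes> w" using inP[OF r(1)] by blast
      have rc: "r \<in> carrier R" "w \<in> carrier R" using r w P.Icarr by auto
      have "b [^] Suc n \<otimes> a = b \<otimes> (b [^] n \<otimes> a)" using b(1) ac by (simp add: m_ac)
      also have "\<dots> = a [^] n \<otimes> (b \<otimes> r)" using b(1) ac rc r(2) by (simp add: m_ac)
      also have "\<dots> = a [^] Suc n \<otimes> w" using b(1) ac rc w(2) by (simp add: m_ac)
      finally show ?case using w(1) by blast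
    qed
    then have "\<exists>r\<in>carrier R. b = a \<otimes> r"
      using P.Icarr by (intro completely_integrally_closed[OF ac b(1) ac a(2) a(2)]) blast
    then have "b \<in> PIdl a" using ac by (auto simp: PIdl_iff m_comm)
    then show False using \<open>b \<notin> PIdl a\<close> by blast
  qed
  then obtain \<pi> u where pu: "\<pi> \<in> P" "u \<in> carrier R" "u \<notin> P" "b \<otimes> \<pi> = a \<otimes> u" by blast
  \<comment> \<open>Since u = (b/a) \<open>\<pi>\<close>, the product u x is \<open>\<pi>\<close>
    times (b/a) x, and the latter is in R.\<close>
  have "\<exists>r\<in>carrier R. u \<otimes> x = \<pi> \<otimes> r" if x: "x \<in> P" for x
  proof -
    obtain w where w: "w \<in> carrier R" "b \<otimes> x = a \<otimes> w" using ex[OF x] by blast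
    have c: "x \<in> carrier R" "\<pi> \<in> carrier R" using x pu P.Icarr by auto
    have "a \<otimes> (u \<otimes> x) = (b \<otimes> \<pi>) \<otimes> x" using pu c ac by (simp add: m_assoc)
    also have "\<dots> = \<pi> \<otimes> (b \<otimes> x)" using c b(1) by (simp add: m_ac)
    also have "\<dots> = a \<otimes> (\<pi> \<otimes> w)" using w ac c by (simp add: m_ac)
    finally have "u \<otimes> x = \<pi> \<otimes> w" using a(2) ac pu c w by (simp add: m_lcancel)
    then show ?thesis using w by blast
  qed
  then show ?thesis by (intro that[OF pu(1-3)] ballI)
qed

end

section \<open>Powers of a prime ideal and its valuation\<close>

lemma (in domain) pow_nonzero: "\<lbrakk>x \<in> carrier R; x \<noteq> \<zero>\<rbrakk> \<Longrightarrow> x [^] (k::nat) \<noteq> \<zero>"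
  by (induction k) (auto simp: integral_iff)

text \<open>Stands in for the localization at P: once \<open>u\<close> is inverted,
  \<open>u_P\<close> says that \<open>\<pi>\<close> generates P.\<close>

locale finite_quotient_prime = finite_quotient_domain R + P: primeideal P R
  for P and R (structure) +
  fixes \<pi> u
  assumes P_nonzero: "P \<in> nonzero_primes R"
    and \<pi>: "\<pi> \<in> P" and u: "u \<in> carrier R" "u \<notin> P"
    and u_P: "x \<in> P \<Longrightarrow> \<exists>r\<in>carrier R. u \<otimes> x = \<pi> \<otimes> r"
begin

abbreviation Pk :: "nat \<Rightarrow> 'a set" where "Pk k \<equiv> P [^]\<^bsub>ideals_set R\<^esub> k"

lemma Pk_0: "Pk 0 = carrier R"
  by (simp add: ideals_set_def nat_pow_def)

lemma Pk_Suc: "Pk (Suc k) = ideal_prod R (Pk k) P"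
  by (simp add: ideals_set_def nat_pow_def)

lemma Pk_ideal: "ideal (Pk k) R"
  by (induction k) (simp_all only: Pk_0 Pk_Suc oneideal ideal_prod_is_ideal P.is_ideal)

lemma Pk_carrier: "x \<in> Pk k \<Longrightarrow> x \<in> carrier R"
  using ideal.Icarr[OF Pk_ideal] .

lemma \<pi>_carrier: "\<pi> \<in> carrier R" using \<pi> P.Icarr by blast

lemma one_notin_P: "\<one> \<notin> P" by (rule primeideal_one_notin[OF P.primeideal])

lemma pow_notin_P: "\<lbrakk>v \<in> carrier R; v \<notin> P\<rbrakk> \<Longrightarrow> v [^] (k::nat) \<notin> P"
proof (induction k)
  case 0
  then show ?case using one_notin_P by simp
next
  case (Suc k)
  then show ?case using P.I_prime[of "v [^] k" v] by auto
qed

lemma \<pi>_nonzero: "\<pi> \<noteq> \<zero>"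
proof
  assume "\<pi> = \<zero>"
  then have eq: "x = \<zero>" if "x \<in> P" for x
    using u_P[OF that] integral[of u x] u that P.Icarr P.zero_closed by auto
  then show False using P_nonzero P.zero_closed unfolding nonzero_primes_def by blast
qed

lemma \<pi>_pow: "\<pi> [^] k \<in> Pk k" for k :: nat
proof (induction k)
  case 0
  then show ?case unfolding Pk_0 by simp
next
  case (Suc k)
  then show ?case unfolding Pk_Suc using ideal_prod.prod[OF _ \<pi>] by simp
qed

text \<open>A finite domain is a field: some positive power of \<open>v\<close> is 1 modulo P, and
  the preceding power is the inverse.\<close>

lemma unit_mod_P:
  assumes v: "v \<in> carrier R" "v \<notin> P"
  shows "\<exists>t\<in>carrier R. \<one> \<ominus> v \<otimes> t \<in> P"
proof -
  obtain i j :: nat where ij: "i < j" "v [^] j \<ominus> v [^] i \<in> P"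
    using quot_pigeonhole[OF P.is_ideal finite_prime_quot[OF P_nonzero], of "\<lambda>i. v [^] i"] v by auto
  then have "v [^] (j - i) \<ominus> \<one> \<in> P"
    using pow_diff_factor[OF v(1) ij(1)] P.I_prime[of "v [^] (j - i) \<ominus> \<one>" "v [^] i"]
      pow_notin_P[OF v, of i] v by auto
  moreover obtain k where "j - i = Suc k" using ij(1) by (metis Suc_diff_Suc)
  moreover have "\<one> \<ominus> v \<otimes> v [^] k = \<ominus> (v [^] Suc k \<ominus> \<one>)" if "v [^] k \<in> carrier R"
    using v(1) that by (simp, algebra)
  ultimately show ?thesis using v(1) by (intro bexI[of _ "v [^] k"]) auto
qed

text \<open>Inverses lift because errors multiply: an error in \<open>Pk k\<close> times an error in
  P lies in \<open>Pk (Suc k)\<close> and is again of the form 1 - v t.\<close>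

lemma unit_mod_Pk:
  assumes v: "v \<in> carrier R" "v \<notin> P"
  shows "\<exists>t\<in>carrier R. \<one> \<ominus> v \<otimes> t \<in> Pk k"
proof (induction k)
  case 0
  then show ?case using v unfolding Pk_0 by (intro bexI[of _ \<one>]) auto
next
  case (Suc k)
  then obtain s where s: "s \<in> carrier R" "\<one> \<ominus> v \<otimes> s \<in> Pk k" by blast
  obtain t where t: "t \<in> carrier R" "\<one> \<ominus> v \<otimes> t \<in> P" using unit_mod_P[OF v] by blast
  have "(\<one> \<ominus> v \<otimes> s) \<otimes> (\<one> \<ominus> v \<otimes> t) \<in> Pk (Suc k)"
    unfolding Pk_Suc using s t by (intro ideal_prod.prod)
  moreover have "(\<one> \<ominus> v \<otimes> s) \<otimes> (\<one> \<ominus> v \<otimes> t) = \<one> \<ominus> v \<otimes> (s \<oplus> t \<ominus> v \<otimes> s \<otimes> t)"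
    using v(1) s(1) t(1) by algebra
  ultimately show ?case using v(1) s(1) t(1) by (intro bexI[of _ "s \<oplus> t \<ominus> v \<otimes> s \<otimes> t"]) auto
qed

lemma Pk_cancel:
  assumes v: "v \<in> carrier R" "v \<notin> P" and y: "y \<in> carrier R" "v \<otimes> y \<in> Pk k"
  shows "y \<in> Pk k"
proof -
  interpret Pk: ideal "Pk k" R by (rule Pk_ideal)
  obtain t where t: "t \<in> carrier R" "\<one> \<ominus> v \<otimes> t \<in> Pk k" using unit_mod_Pk[OF v] by blast
  have "y = y \<otimes> (\<one> \<ominus> v \<otimes> t) \<oplus> t \<otimes> (v \<otimes> y)" using v(1) y(1) t(1) by algebra
  moreover have "y \<otimes> (\<one> \<ominus> v \<otimes> t) \<in> Pk k" "t \<otimes> (v \<otimes> y) \<in> Pk k"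
    using y t Pk.I_l_closed by auto
  ultimately show ?thesis using Pk.a_closed by metis
qed

text \<open>Turns membership in an ideal power into divisibility by \<open>\<pi> [^] k\<close>. Each
  factor from P contributes one \<open>u\<close>, which gives the denominator
  \<open>u [^] k\<close>; conversely this power of \<open>u\<close> is outside P and can be
  cancelled.\<close>

lemma Pk_iff: "x \<in> Pk k \<longleftrightarrow> x \<in> carrier R \<and> (\<exists>r\<in>carrier R. u [^] k \<otimes> x = \<pi> [^] k \<otimes> r)"
proof
  have "\<exists>r\<in>carrier R. u [^] k \<otimes> x = \<pi> [^] k \<otimes> r" if "x \<in> Pk k"
    using that
  proof (induction k arbitrary: x)
    case 0
    then show ?case unfolding Pk_0 by auto
  next
    case (Suc k)
    from Suc.prems have "x \<in> ideal_prod R (Pk k) P" by (simp only: Pk_Suc)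
    then show ?case
    proof (induction rule: ideal_prod.induct)
      case (prod i j)
      obtain r where r: "r \<in> carrier R" "u [^] k \<otimes> i = \<pi> [^] k \<otimes> r" using Suc.IH[OF prod(1)] by blast
      obtain s where s: "s \<in> carrier R" "u \<otimes> j = \<pi> \<otimes> s" using u_P[OF prod(2)] by blast
      have c: "i \<in> carrier R" "j \<in> carrier R" using prod Pk_carrier P.Icarr by auto
      have "u [^] Suc k \<otimes> (i \<otimes> j) = (u [^] k \<otimes> i) \<otimes> (u \<otimes> j)" using c u by (simp add: m_ac)
      also have "\<dots> = \<pi> [^] Suc k \<otimes> (r \<otimes> s)" unfolding r(2) s(2) using r s \<pi>_carrier by (simp add: m_ac)
      finally show ?case using r s by blast
    next
      case (sum x y)
      then obtain r s where r: "r \<in> carrier R" "u [^] Suc k \<otimes> x = \<pi> [^] Suc k \<otimes> r"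
        and s: "s \<in> carrier R" "u [^] Suc k \<otimes> y = \<pi> [^] Suc k \<otimes> s" by blast
      have c: "x \<in> carrier R" "y \<in> carrier R"
        using sum(1,2) Pk_carrier[of _ "Suc k"] unfolding Pk_Suc by auto
      have "u [^] Suc k \<otimes> (x \<oplus> y) = \<pi> [^] Suc k \<otimes> (r \<oplus> s)"
        using r s c u \<pi>_carrier by (simp only: r_distr nat_pow_closed)
      then show ?case using r s by blast
    qed
  qed
  then show "x \<in> Pk k \<Longrightarrow> x \<in> carrier R \<and> (\<exists>r\<in>carrier R. u [^] k \<otimes> x = \<pi> [^] k \<otimes> r)"
    using Pk_carrier by blast
next
  assume x: "x \<in> carrier R \<and> (\<exists>r\<in>carrier R. u [^] k \<otimes> x = \<pi> [^] k \<otimes> r)"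
  then have "u [^] k \<otimes> x \<in> Pk k" using \<pi>_pow[of k] ideal.I_r_closed[OF Pk_ideal] by auto
  then show "x \<in> Pk k"
    using x u Pk_cancel[of "u [^] k" x k] pow_notin_P[OF u, of k] by auto
qed

lemma Pk_Suc_subset: "Pk (Suc k) \<subseteq> Pk k"
  unfolding Pk_Suc using ideal_prod_inter[OF Pk_ideal P.is_ideal] by blast

lemma Pk_antimono: "i \<le> j \<Longrightarrow> Pk j \<subseteq> Pk i"
  by (rule lift_Suc_antimono_le[of Pk, OF Pk_Suc_subset])

text \<open>The cofactor \<open>r\<close> is a leading coefficient: x equals
  (\<open>\<pi>\<close>/u)^k r, so the order of x is exactly \<open>k\<close> unless P divides
  \<open>r\<close>.\<close>

lemma not_Pk_Suc:
  assumes "x \<in> carrier R" "r \<in> carrier R" "u [^] k \<otimes> x = \<pi> [^] k \<otimes> r"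
  shows "x \<in> Pk (Suc k) \<longleftrightarrow> r \<in> P"
proof
  assume "x \<in> Pk (Suc k)"
  then obtain s where s: "s \<in> carrier R" "u [^] Suc k \<otimes> x = \<pi> [^] Suc k \<otimes> s"
    unfolding Pk_iff by blast
  have "\<pi> [^] k \<otimes> (u \<otimes> r) = u \<otimes> (\<pi> [^] k \<otimes> r)"
    using u(1) assms(2) \<pi>_carrier by (simp add: m_lcomm)
  also have "\<dots> = u \<otimes> (u [^] k \<otimes> x)" by (simp only: assms(3))
  also have "\<dots> = u [^] Suc k \<otimes> x" using u(1) assms(1) by (simp add: m_lcomm m_assoc)
  also have "\<dots> = \<pi> [^] k \<otimes> (\<pi> \<otimes> s)" unfolding s(2) using s(1) \<pi>_carrier by (simp add: m_assoc)
  finally have "\<pi> [^] k \<otimes> (u \<otimes> r) = \<pi> [^] k \<otimes> (\<pi> \<otimes> s)" .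
  then have "u \<otimes> r = \<pi> \<otimes> s"
    using m_lcancel[of "\<pi> [^] k" "u \<otimes> r" "\<pi> \<otimes> s"] \<pi>_carrier s(1) u(1) assms(2)
      pow_nonzero[OF \<pi>_carrier \<pi>_nonzero] by simp
  moreover have "\<pi> \<otimes> s \<in> P" using \<pi> s P.I_r_closed by blast
  ultimately show "r \<in> P" using P.I_prime[of u r] u assms by auto
next
  assume "r \<in> P"
  then obtain s where s: "s \<in> carrier R" "u \<otimes> r = \<pi> \<otimes> s" using u_P by blast
  have "u [^] Suc k \<otimes> x = u \<otimes> (u [^] k \<otimes> x)" using u(1) assms(1) by (simp add: m_lcomm m_assoc)
  also have "\<dots> = \<pi> [^] k \<otimes> (u \<otimes> r)"
    unfolding assms(3) using u(1) assms(2) \<pi>_carrier by (simp add: m_lcomm)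
  also have "\<dots> = \<pi> [^] Suc k \<otimes> s" unfolding s(2) using s(1) \<pi>_carrier by (simp add: m_assoc)
  finally show "x \<in> Pk (Suc k)" unfolding Pk_iff using assms s by blast
qed

text \<open>Cofactors multiply, and P is prime; the second part therefore makes orders add exactly,
  not merely at least.\<close>

lemma Pk_mult:
  assumes "x \<in> Pk i" "y \<in> Pk j"
  shows "x \<otimes> y \<in> Pk (i + j)"
    and "\<lbrakk>x \<notin> Pk (Suc i); y \<notin> Pk (Suc j)\<rbrakk> \<Longrightarrow> x \<otimes> y \<notin> Pk (Suc (i + j))"
proof -
  obtain r where r: "r \<in> carrier R" "u [^] i \<otimes> x = \<pi> [^] i \<otimes> r" using assms unfolding Pk_iff by blast
  obtain s where s: "s \<in> carrier R" "u [^] j \<otimes> y = \<pi> [^] j \<otimes> s" using assms unfolding Pk_iff by blast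
  have c: "x \<in> carrier R" "y \<in> carrier R" using assms Pk_carrier by auto
  have swap: "v [^] (i + j) \<otimes> (a \<otimes> b) = (v [^] i \<otimes> a) \<otimes> (v [^] j \<otimes> b)"
    if "v \<in> carrier R" "a \<in> carrier R" "b \<in> carrier R" for v a b
  proof -
    have "v [^] i \<in> carrier R" "v [^] j \<in> carrier R" using that by auto
    then have "v [^] i \<otimes> v [^] j \<otimes> (a \<otimes> b) = (v [^] i \<otimes> a) \<otimes> (v [^] j \<otimes> b)"
      using that by algebra
    then show ?thesis using that by (simp add: nat_pow_mult)
  qed
  have "u [^] (i + j) \<otimes> (x \<otimes> y) = \<pi> [^] (i + j) \<otimes> (r \<otimes> s)"
    unfolding swap[OF u(1) c] swap[OF \<pi>_carrier r(1) s(1)] r(2) s(2) ..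
  then have eq: "u [^] (i + j) \<otimes> (x \<otimes> y) = \<pi> [^] (i + j) \<otimes> (r \<otimes> s)" .
  show "x \<otimes> y \<in> Pk (i + j)"
    unfolding Pk_iff by (intro conjI bexI[of _ "r \<otimes> s"] eq m_closed c r(1) s(1))
  assume "x \<notin> Pk (Suc i)" "y \<notin> Pk (Suc j)"
  then have "r \<notin> P" "s \<notin> P"
    using not_Pk_Suc[OF c(1) r] not_Pk_Suc[OF c(2) s] by blast+
  then have "r \<otimes> s \<notin> P" using r(1) s(1) P.I_prime by blast
  then show "x \<otimes> y \<notin> Pk (Suc (i + j))"
    using not_Pk_Suc[OF m_closed m_closed eq, OF c r(1) s(1)] by blast
qed

lemma \<pi>_pow_notin: "\<pi> [^] k \<notin> Pk (Suc k)"
proof -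
  have "u [^] k \<otimes> \<pi> [^] k = \<pi> [^] k \<otimes> u [^] k" using u \<pi>_carrier by (simp add: m_comm)
  then show ?thesis using not_Pk_Suc[of "\<pi> [^] k" "u [^] k" k] u \<pi>_carrier pow_notin_P[OF u] by simp
qed

text \<open>If x lay in all powers, two powers i < j of \<open>\<pi>\<close> congruent modulo x
  would be congruent modulo \<open>Pk (Suc i)\<close>, which would put \<open>\<pi> [^] i\<close>
  there.\<close>

lemma Inter_Pk:
  assumes x: "x \<in> carrier R" "x \<noteq> \<zero>"
  shows "\<exists>k. x \<in> Pk k \<and> x \<notin> Pk (Suc k)"
proof (rule ccontr)
  assume neg: "\<not> ?thesis"
  have all: "x \<in> Pk k" for k
    by (induction k) (use neg x Pk_0 in auto)
  have I: "ideal (PIdl x) R" using x by (intro cgenideal_ideal)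
  obtain i j :: nat where ij: "i < j" "\<pi> [^] j \<ominus> \<pi> [^] i \<in> PIdl x"
    using quot_pigeonhole[OF I finite_principal_quot[OF x], of "\<lambda>i. \<pi> [^] i"] \<pi>_carrier by auto
  then have d: "\<pi> [^] j \<ominus> \<pi> [^] i \<in> Pk (Suc i)"
    using cgenideal_minimal[OF Pk_ideal all] by blast
  have "\<pi> [^] j \<in> Pk (Suc i)" using \<pi>_pow[of j] Pk_antimono[of "Suc i" j] ij by auto
  then have "\<pi> [^] j \<ominus> (\<pi> [^] j \<ominus> \<pi> [^] i) \<in> Pk (Suc i)"
    using ideal_minus_closed[OF Pk_ideal _ d] by blast
  moreover have "\<pi> [^] j \<ominus> (\<pi> [^] j \<ominus> \<pi> [^] i) = \<pi> [^] i"
  proof -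
    have "\<pi> [^] j \<in> carrier R" "\<pi> [^] i \<in> carrier R" using \<pi>_carrier by auto
    then show ?thesis by algebra
  qed
  ultimately show False using \<pi>_pow_notin by simp
qed

lemma ideal_val_eq:
  assumes "x \<in> Pk k" "x \<notin> Pk (Suc k)"
  shows "ideal_val R P x = enat k"
  unfolding ideal_val_def
proof (rule antisym)
  have "i \<le> k" if "x \<in> Pk i" for i
    using Pk_antimono[of "Suc k" i] assms that by (meson not_less_eq_eq subsetD)
  then show "Sup {enat k |k. x \<in> Pk k} \<le> enat k" by (auto intro!: Sup_least)
qed (use assms in \<open>auto intro!: Sup_upper\<close>)

lemma ideal_val_zero: "ideal_val R P \<zero> = \<infinity>"
proof -
  have "\<zero> \<in> Pk k" for k by (rule additive_subgroup.zero_closed[OF ideal.axioms(1)[OF Pk_ideal]])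
  then have "enat k \<le> ideal_val R P \<zero>" for k unfolding ideal_val_def by (auto intro!: Sup_upper)
  then show ?thesis by (metis enat_ord_simps(1) not_less_eq_eq order_refl not_enat_eq)
qed

lemma ideal_val_mult:
  assumes "x \<in> carrier R" "y \<in> carrier R"
  shows "ideal_val R P (x \<otimes> y) = ideal_val R P x + ideal_val R P y"
proof (cases "x = \<zero> \<or> y = \<zero>")
  case True
  then show ?thesis
  proof
    assume "x = \<zero>"
    then show ?thesis using assms(2) by (simp add: ideal_val_zero)
  next
    assume "y = \<zero>"
    then show ?thesis using assms(1) by (simp add: ideal_val_zero)
  qed
next
  case False
  then have "x \<noteq> \<zero>" "y \<noteq> \<zero>" by auto
  from Inter_Pk[OF assms(1) this(1)] obtain i where x: "x \<in> Pk i" "x \<notin> Pk (Suc i)" by blast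
  from Inter_Pk[OF assms(2) \<open>y \<noteq> \<zero>\<close>] obtain j where y: "y \<in> Pk j" "y \<notin> Pk (Suc j)" by blast
  show ?thesis
    unfolding ideal_val_eq[OF x] ideal_val_eq[OF y] ideal_val_eq[OF Pk_mult[OF x(1) y(1)], OF x(2) y(2)]
    by simp
qed

lemma ideal_val_one: "ideal_val R P \<one> = 0"
proof -
  have "\<one> \<notin> Pk (Suc 0)" using not_Pk_Suc[of \<one> \<one> 0] one_notin_P by simp
  moreover have "\<one> \<in> Pk 0" unfolding Pk_0 by simp
  ultimately show ?thesis unfolding zero_enat_def by (rule ideal_val_eq[rotated])
qed

lemma ideal_val_diff_prod:
  assumes "x \<in> carrier R" "\<And>j. a j \<in> carrier R"
  shows "ideal_val R P (diff_prod R a n x) = (\<Sum>j<n. ideal_val R P (x \<ominus> a j))"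
proof (induction n)
  case 0
  then show ?case by (simp add: diff_prod_def ideal_val_one)
next
  case (Suc n)
  have "diff_prod R a (Suc n) x = (x \<ominus> a n) \<otimes> diff_prod R a n x"
    using assms unfolding diff_prod_def lessThan_Suc by (subst finprod_insert) auto
  moreover have "diff_prod R a n x \<in> carrier R"
    using assms unfolding diff_prod_def by (intro finprod_closed) auto
  ultimately show ?case using Suc assms by (simp add: ideal_val_mult add.commute)
qed

end

subsection \<open>Orderings at a prime\<close>

lemma (in cring) diff_prod_cong:
  assumes "\<And>j. j < n \<Longrightarrow> a j = b j" "x \<in> carrier R" "\<And>j. j < n \<Longrightarrow> b j \<in> carrier R"
  shows "diff_prod R a n x = diff_prod R b n x"
  unfolding diff_prod_def using assms by (intro finprod_cong') auto

text \<open>Values in \<open>enat\<close> are well-ordered, so a minimizer exists at each stage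
  whatever was chosen before.\<close>

lemma (in cring) p_ordering_exists:
  assumes "S \<subseteq> carrier R" "S \<noteq> {}"
  shows "\<exists>a. p_ordering R S P a"
proof -
  \<comment> \<open>Values of \<open>f\<close> from \<open>n\<close> on are masked by
    \<open>undefined\<close>, so that the condition visibly depends on the earlier choices only, as
    the recursion principle requires.\<close>
  define Q where "Q f n r \<longleftrightarrow> r \<in> S \<and> (\<forall>x\<in>S.
      ideal_val R P (diff_prod R (\<lambda>j. if j < n then f j else undefined) n r) \<le>
      ideal_val R P (diff_prod R (\<lambda>j. if j < n then f j else undefined) n x))" for f n r
  have "\<exists>a. \<forall>n. Q a n (a n)"
  proof (rule dependent_wellorder_choice)
    fix r n and f g :: "nat \<Rightarrow> 'a"
    assume "\<And>m. m < n \<Longrightarrow> f m = g m"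
    then have "(\<lambda>j. if j < n then f j else undefined) = (\<lambda>j. if j < n then g j else undefined)"
      by auto
    then show "Q f n r = Q g n r" unfolding Q_def by simp
  next
    fix n f
    let ?v = "\<lambda>x. ideal_val R P (diff_prod R (\<lambda>j. if j < n then f j else undefined) n x)"
    have "(LEAST v. v \<in> ?v ` S) \<in> ?v ` S"
      by (rule LeastI_ex) (use assms in blast)
    then obtain r where r: "r \<in> S" "?v r = (LEAST v. v \<in> ?v ` S)" by auto
    have "?v r \<le> ?v x" if "x \<in> S" for x
      unfolding r(2) using that by (intro Least_le) simp
    then show "\<exists>r. Q f n r" unfolding Q_def using r(1) by blast
  qed
  then obtain a where a: "\<And>n. Q a n (a n)" by blast
  have aS: "a n \<in> S" for n using a[of n] unfolding Q_def by simp
  have cong: "diff_prod R (\<lambda>j. if j < n then a j else undefined) n x = diff_prod R a n x"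
    if "x \<in> S" for n x
    using that assms aS by (intro diff_prod_cong) auto
  have "p_ordering R S P a"
    unfolding p_ordering_def
  proof (intro allI conjI ballI aS)
    fix n x assume "x \<in> S"
    then show "ideal_val R P (diff_prod R a n (a n)) \<le> ideal_val R P (diff_prod R a n x)"
      using a[of n] unfolding Q_def by (simp add: cong aS)
  qed
  then show ?thesis by blast
qed

context finite_quotient_prime
begin

lemma residue_card_ge_2: "2 \<le> residue_card R P"
proof -
  have "P +> \<zero> \<noteq> P +> \<one>"
    using quotient_eq_iff_same_a_r_cos[OF P.is_ideal, of \<one> \<zero>] one_notin_P by (simp add: a_minus_def)
  then have "card {P +> \<zero>, P +> \<one>} = 2" by simp
  moreover have "card {P +> \<zero>, P +> \<one>} \<le> residue_card R P"
    unfolding residue_card_def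
    by (rule card_mono[OF finite_prime_quot[OF P_nonzero]]) (auto simp: quot_carrier_eq)
  ultimately show ?thesis by simp
qed

lemma minus_mem_Pk:
  assumes "x \<in> carrier R" "y \<in> carrier R" "z \<in> carrier R" "x \<ominus> y \<in> Pk k"
  shows "y \<ominus> x \<in> Pk k" "y \<ominus> z \<in> Pk k \<Longrightarrow> x \<ominus> z \<in> Pk k"
proof -
  interpret Pk: ideal "Pk k" R by (rule Pk_ideal)
  have "y \<ominus> x = \<ominus> (x \<ominus> y)" using assms(1,2) by algebra
  then show "y \<ominus> x \<in> Pk k" using assms(4) by simp
  have "x \<ominus> z = (x \<ominus> y) \<oplus> (y \<ominus> z)" using assms(1-3) by algebra
  then show "y \<ominus> z \<in> Pk k \<Longrightarrow> x \<ominus> z \<in> Pk k" using assms(4) by simp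
qed

text \<open>A child of the class of \<open>x\<close> corresponds to the next digit in a
  \<open>\<pi>\<close>-adic expansion, and the digits run through representatives of R/P.\<close>

lemma residue_class_split:
  assumes x: "x \<in> carrier R"
  shows "\<exists>T\<subseteq>carrier R. finite T \<and> card T = residue_card R P \<and> (\<forall>t\<in>T. x \<ominus> t \<in> Pk k) \<and>
          (\<forall>y\<in>carrier R. x \<ominus> y \<in> Pk k \<longrightarrow> (\<exists>!t. t \<in> T \<and> y \<ominus> t \<in> Pk (Suc k)))"
proof -
  interpret Pk: ideal "Pk k" R by (rule Pk_ideal)
  interpret PkS: ideal "Pk (Suc k)" R by (rule Pk_ideal)
  have "\<forall>C\<in>carrier (R Quot P). \<exists>c\<in>carrier R. C = P +> c" unfolding quot_carrier_eq by blast
  then obtain g where g: "\<And>C. C \<in> carrier (R Quot P) \<Longrightarrow> g C \<in> carrier R \<and> C = P +> g C" by metis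
  define h where "h C = x \<oplus> \<pi> [^] k \<otimes> g C" for C
  have pk: "\<pi> [^] k \<in> carrier R" using \<pi>_carrier by simp
  \<comment> \<open>The difference of two candidates is \<open>\<pi> [^] k \<otimes> d\<close>,
    whose cofactor is \<open>u [^] k \<otimes> d\<close>; it has order above \<open>k\<close> only
    if \<open>d\<close> is in P.\<close>
  have same: "C = D"
    if CD: "C \<in> carrier (R Quot P)" "D \<in> carrier (R Quot P)" "h C \<ominus> h D \<in> Pk (Suc k)" for C D
  proof -
    have gc: "g C \<in> carrier R" "g D \<in> carrier R" using g CD by auto
    define d where "d = g C \<ominus> g D"
    have d: "d \<in> carrier R" unfolding d_def using gc by simp
    have "h C \<ominus> h D = \<pi> [^] k \<otimes> d" unfolding h_def d_def using x gc pk by algebra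
    with CD(3) have "\<pi> [^] k \<otimes> d \<in> Pk (Suc k)" by (simp only:)
    moreover have "u [^] k \<otimes> (\<pi> [^] k \<otimes> d) = \<pi> [^] k \<otimes> (u [^] k \<otimes> d)"
      using u(1) \<pi>_carrier d by (intro m_lcomm nat_pow_closed)
    ultimately have "u [^] k \<otimes> d \<in> P"
      using not_Pk_Suc[OF m_closed m_closed] pk nat_pow_closed[OF u(1)] d by blast
    then have "g C \<ominus> g D \<in> P"
      unfolding d_def[symmetric] using P.I_prime[of "u [^] k" d] pow_notin_P[OF u] u(1) d by blast
    then have "P +> g C = P +> g D"
      using quotient_eq_iff_same_a_r_cos[OF P.is_ideal gc] by simp
    then show ?thesis using g CD by metis
  qed
  define T where "T = h ` carrier (R Quot P)"
  have hc: "h C \<in> carrier R" if "C \<in> carrier (R Quot P)" for C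
    unfolding h_def using g[OF that] x pk by simp
  have "inj_on h (carrier (R Quot P))"
  proof (rule inj_onI)
    fix C D assume CD: "C \<in> carrier (R Quot P)" "D \<in> carrier (R Quot P)" "h C = h D"
    then have "h C \<ominus> h D = \<zero>" using hc by (simp add: a_minus_def r_neg)
    then show "C = D" using same[OF CD(1,2)] PkS.zero_closed by simp
  qed
  then have card: "card T = residue_card R P" unfolding T_def residue_card_def by (rule card_image)
  have close: "x \<ominus> h C \<in> Pk k" if "C \<in> carrier (R Quot P)" for C
  proof -
    have "x \<ominus> h C = \<pi> [^] k \<otimes> (\<ominus> g C)" unfolding h_def using x g[OF that] pk by algebra
    then show ?thesis using \<pi>_pow[of k] g[OF that] Pk.I_r_closed by simp
  qed
  have "\<exists>!t. t \<in> T \<and> y \<ominus> t \<in> Pk (Suc k)" if y: "y \<in> carrier R" "x \<ominus> y \<in> Pk k" for y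
  proof (rule ex_ex1I)
    define z where "z = y \<ominus> x"
    have z: "z \<in> Pk k" unfolding z_def using minus_mem_Pk(1)[OF x y(1) x y(2)] .
    obtain r where r: "r \<in> carrier R" "u [^] k \<otimes> z = \<pi> [^] k \<otimes> r" using z unfolding Pk_iff by blast
    have zc: "z \<in> carrier R" using z Pk_carrier by blast
    obtain t where t: "t \<in> carrier R" "\<one> \<ominus> u [^] k \<otimes> t \<in> P"
      using unit_mod_P[of "u [^] k"] u pow_notin_P[OF u] by auto
    \<comment> \<open>The digit of \<open>y\<close> is the cofactor \<open>r\<close> divided by
      \<open>u [^] k\<close>; modulo P, division is multiplication by the inverse
      \<open>t\<close>.\<close>
    define C where "C = P +> (r \<otimes> t)"
    have C: "C \<in> carrier (R Quot P)" unfolding C_def quot_carrier_eq using r t by simp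
    have gC: "g C \<in> carrier R" "P +> g C = P +> (r \<otimes> t)" using g[OF C] C_def by auto
    have "g C \<ominus> r \<otimes> t \<in> P"
      using quotient_eq_iff_same_a_r_cos[OF P.is_ideal gC(1), of "r \<otimes> t"] gC(2) r t by simp
    then have 1: "\<pi> [^] k \<otimes> (g C \<ominus> r \<otimes> t) \<in> Pk (Suc k)"
      unfolding Pk_Suc by (intro ideal_prod.prod \<pi>_pow)
    have 2: "z \<otimes> (\<one> \<ominus> u [^] k \<otimes> t) \<in> Pk (Suc k)"
      unfolding Pk_Suc by (intro ideal_prod.prod z t)
    have "y \<ominus> h C = z \<ominus> \<pi> [^] k \<otimes> g C" unfolding h_def z_def using x y gC(1) pk by algebra
    also have "\<dots> = (z \<ominus> (\<pi> [^] k \<otimes> r) \<otimes> t) \<ominus> \<pi> [^] k \<otimes> (g C \<ominus> r \<otimes> t)"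
      using zc pk r(1) t(1) gC(1) by algebra
    also have "\<dots> = (z \<ominus> (u [^] k \<otimes> z) \<otimes> t) \<ominus> \<pi> [^] k \<otimes> (g C \<ominus> r \<otimes> t)" by (simp only: r(2))
    also have "\<dots> = z \<otimes> (\<one> \<ominus> u [^] k \<otimes> t) \<ominus> \<pi> [^] k \<otimes> (g C \<ominus> r \<otimes> t)"
    proof -
      have "u [^] k \<in> carrier R" using u by simp
      then show ?thesis using zc pk r(1) t(1) gC(1) by algebra
    qed
    finally have "y \<ominus> h C \<in> Pk (Suc k)" using ideal_minus_closed[OF Pk_ideal 2 1] by simp
    then show "\<exists>t. t \<in> T \<and> y \<ominus> t \<in> Pk (Suc k)" unfolding T_def using C by blast
  next
    fix s t assume st: "s \<in> T \<and> y \<ominus> s \<in> Pk (Suc k)" "t \<in> T \<and> y \<ominus> t \<in> Pk (Suc k)"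
    then obtain C D where CD: "C \<in> carrier (R Quot P)" "s = h C" "D \<in> carrier (R Quot P)" "t = h D"
      unfolding T_def by blast
    have "s \<in> carrier R" "t \<in> carrier R" using CD hc by auto
    then have "s \<ominus> t \<in> Pk (Suc k)" using minus_mem_Pk st y(1) by metis
    then show "s = t" using same[OF CD(1,3)] CD by simp
  qed
  moreover have "T \<subseteq> carrier R" "\<forall>t\<in>T. x \<ominus> t \<in> Pk k" unfolding T_def using hc close by auto
  moreover have "finite T" unfolding T_def using finite_prime_quot[OF P_nonzero] by simp
  ultimately show ?thesis using card by (intro exI[of _ T]) simp
qed

sublocale residue_tree: q_ary_tree "carrier R" "\<lambda>k x y. x \<ominus> y \<in> Pk k" "residue_card R P"
proof
  show "2 \<le> residue_card R P" by (rule residue_card_ge_2)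
  show "x \<ominus> y \<in> Pk 0" if "x \<in> carrier R" "y \<in> carrier R" for x y
    using that by (simp only: Pk_0 minus_closed)
  show "x \<ominus> x \<in> Pk k" if "x \<in> carrier R" for x k
    using that additive_subgroup.zero_closed[OF ideal.axioms(1)[OF Pk_ideal]]
    by (simp add: a_minus_def r_neg)
  show "y \<ominus> x \<in> Pk k" if "x \<in> carrier R" "y \<in> carrier R" "x \<ominus> y \<in> Pk k" for x y k
    using minus_mem_Pk(1) that by blast
  show "x \<ominus> z \<in> Pk k" if "x \<in> carrier R" "y \<in> carrier R" "z \<in> carrier R"
    "x \<ominus> y \<in> Pk k" "y \<ominus> z \<in> Pk k" for x y z k
    using minus_mem_Pk(2) that by blast
  show "x \<ominus> y \<in> Pk k" if "x \<ominus> y \<in> Pk (Suc k)" for x y k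
    using that Pk_Suc_subset by blast
qed (rule residue_class_split)

lemma p_ordering_value:
  assumes "p_ordering R (carrier R) P a"
  shows "ideal_val R P (diff_prod R a n (a n)) = enat (legendre_sum (residue_card R P) n)"
proof -
  have a: "a j \<in> carrier R" for j using assms unfolding p_ordering_def by blast
  have sep: "residue_tree.sep x y = ideal_val R P (x \<ominus> y)" for x y
    unfolding residue_tree.sep_def ideal_val_def ..
  have "(\<Sum>j<n. residue_tree.sep (a n) (a j)) = enat (legendre_sum (residue_card R P) n)"
  proof (rule residue_tree.greedy_value)
    fix m x assume "x \<in> carrier R"
    then show "(\<Sum>j<m. residue_tree.sep (a m) (a j)) \<le> (\<Sum>j<m. residue_tree.sep x (a j))"
      using assms a unfolding sep p_ordering_def by (simp flip: ideal_val_diff_prod)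
  qed (rule a)
  then show ?thesis unfolding sep using ideal_val_diff_prod a by simp
qed

end

section \<open>Exponents at all primes and finiteness of the support\<close>

context finite_quotient_domain
begin

lemma finite_quotient_prime_exists:
  assumes "P \<in> nonzero_primes R"
  obtains \<pi> u where "finite_quotient_prime P R \<pi> u"
proof -
  obtain \<pi> u where pu: "\<pi> \<in> P" "u \<in> carrier R" "u \<notin> P" "\<forall>x\<in>P. \<exists>r\<in>carrier R. u \<otimes> x = \<pi> \<otimes> r"
    by (rule local_uniformizer[OF assms])
  have "primeideal P R" using assms by (simp add: nonzero_primes_def)
  then have "finite_quotient_prime P R \<pi> u"
    using pu assms finite_quotient_domain_axioms
    by (simp add: finite_quotient_prime_def finite_quotient_prime_axioms_def)
  then show ?thesis by (rule that)
qed

lemma residue_card_ge_2: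
  assumes "P \<in> nonzero_primes R" shows "2 \<le> residue_card R P"
proof -
  obtain \<pi> u where "finite_quotient_prime P R \<pi> u"
    by (rule finite_quotient_prime_exists[OF assms])
  then show ?thesis by (rule finite_quotient_prime.residue_card_ge_2)
qed

text \<open>The definite description is justified by existence of one ordering together with
  \<open>p_ordering_value\<close>, which gives the same value for every ordering.\<close>

lemma bhargava_exp_eq:
  assumes "P \<in> nonzero_primes R"
  shows "bhargava_exp R (carrier R) P n = legendre_sum (residue_card R P) n"
proof -
  obtain \<pi> u where "finite_quotient_prime P R \<pi> u"
    by (rule finite_quotient_prime_exists[OF assms])
  note val = finite_quotient_prime.p_ordering_value[OF this]
  obtain a where a: "p_ordering R (carrier R) P a"
    using p_ordering_exists[of "carrier R" P] by auto
  show ?thesis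
    unfolding bhargava_exp_def
  proof (rule the_equality)
    show "\<exists>a. p_ordering R (carrier R) P a \<and>
        ideal_val R P (diff_prod R a n (a n)) = enat (legendre_sum (residue_card R P) n)"
      using a val[OF a] by blast
  next
    fix m assume "\<exists>a. p_ordering R (carrier R) P a \<and> ideal_val R P (diff_prod R a n (a n)) = enat m"
    then show "m = legendre_sum (residue_card R P) n" using val by (metis enat.inject)
  qed
qed

text \<open>A nonzero \<open>x\<close> in some prime has pairwise distinct powers. If \<open>P\<close> has at most \<open>n\<close> residue
  classes then two of the powers up to the \<open>n\<close>-th are congruent modulo \<open>P\<close>, so \<open>P\<close> contains the
  fixed nonzero product of all differences of these powers.\<close>

lemma finite_primes_bounded_residue_card:
  "finite {P \<in> nonzero_primes R. residue_card R P \<le> n}"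
proof (cases "nonzero_primes R = {}")
  case False
  then obtain P0 where P0: "P0 \<in> nonzero_primes R" by blast
  interpret P0: primeideal P0 R using P0 by (simp add: nonzero_primes_def)
  obtain x where x: "x \<in> P0" "x \<noteq> \<zero>"
    using P0 P0.zero_closed unfolding nonzero_primes_def by blast
  have xc: "x \<in> carrier R" using x P0.Icarr by blast
  define I where "I = {(i, j). i < j \<and> j \<le> n}"
  have "I \<subseteq> {..n} \<times> {..n}" unfolding I_def by auto
  then have finI: "finite I" by (rule finite_subset) simp
  define y where "y = (\<Otimes>p\<in>I. x [^] snd p \<ominus> x [^] fst p)"
  have nz: "x [^] j \<ominus> x [^] i \<noteq> \<zero>" if ij: "i < j" for i j :: nat
  proof
    assume "x [^] j \<ominus> x [^] i = \<zero>"
    then have "(x [^] (j - i) \<ominus> \<one>) \<otimes> x [^] i = \<zero>" using pow_diff_factor[OF xc ij] by simp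
    then have "x [^] (j - i) \<ominus> \<one> = \<zero>"
      using integral[of "x [^] (j - i) \<ominus> \<one>" "x [^] i"] pow_nonzero[OF xc x(2)] xc by auto
    then have "x [^] (j - i) = \<one>" using xc by simp
    moreover obtain k where "j - i = Suc k" using ij by (metis Suc_diff_Suc)
    moreover have "x [^] Suc k \<in> P0" using x xc P0.I_l_closed by simp
    ultimately show False using primeideal_one_notin[OF P0.primeideal] by simp
  qed
  have "finite A \<Longrightarrow> A \<subseteq> I \<Longrightarrow> (\<Otimes>p\<in>A. x [^] snd p \<ominus> x [^] fst p) \<noteq> \<zero>" for A
  proof (induction A rule: finite_induct)
    case (insert p A)
    then have "(\<Otimes>p\<in>insert p A. x [^] snd p \<ominus> x [^] fst p) =
        (x [^] snd p \<ominus> x [^] fst p) \<otimes> (\<Otimes>p\<in>A. x [^] snd p \<ominus> x [^] fst p)"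
      using xc by (intro finprod_insert) auto
    moreover have "x [^] snd p \<ominus> x [^] fst p \<noteq> \<zero>"
      using nz[of "fst p" "snd p"] insert.prems unfolding I_def by auto
    moreover have "(\<Otimes>p\<in>A. x [^] snd p \<ominus> x [^] fst p) \<in> carrier R"
      using xc by (intro finprod_closed) auto
    ultimately show ?case using insert xc integral_iff by simp
  qed simp
  then have y0: "y \<noteq> \<zero>" unfolding y_def using finI by blast
  have yc: "y \<in> carrier R" unfolding y_def using xc by (intro finprod_closed) auto
  have I: "ideal (PIdl y) R" using yc by (rule cgenideal_ideal)
  have yP: "y \<in> P" if P: "P \<in> nonzero_primes R" "residue_card R P \<le> n" for P
  proof -
    interpret P: primeideal P R using P by (simp add: nonzero_primes_def)
    obtain i j where ij: "i < j" "j \<le> n" "x [^] j \<ominus> x [^] i \<in> P"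
      using quot_pigeonhole_card[OF P.is_ideal finite_prime_quot[OF P(1)], of n "\<lambda>i. x [^] i"]
        P(2) xc unfolding residue_card_def by auto
    have "(i, j) \<in> I" using ij unfolding I_def by simp
    then have "y = (\<Otimes>p\<in>insert (i, j) (I - {(i, j)}). x [^] snd p \<ominus> x [^] fst p)"
      unfolding y_def by (simp add: insert_absorb)
    also have "\<dots> = (x [^] j \<ominus> x [^] i) \<otimes> (\<Otimes>p\<in>I - {(i, j)}. x [^] snd p \<ominus> x [^] fst p)"
      using xc finI by (subst finprod_insert) auto
    also have "\<dots> \<in> P" using ij(3) xc by (intro P.I_r_closed finprod_closed) auto
    finally show ?thesis .
  qed
  \<comment> \<open>All these primes contain \<open>y\<close>, hence correspond to subsets of the
    finite quotient by \<open>y\<close>: each is recovered as the union of its cosets.\<close>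
  have "inj_on (\<lambda>P. (+>) (PIdl y) ` P) {P \<in> nonzero_primes R. residue_card R P \<le> n}"
  proof (rule inj_on_inverseI[where g = "\<lambda>M. \<Union> M"])
    fix P assume "P \<in> {P \<in> nonzero_primes R. residue_card R P \<le> n}"
    then have P: "P \<in> nonzero_primes R" "y \<in> P" using yP by auto
    interpret P: primeideal P R using P by (simp add: nonzero_primes_def)
    have sub: "PIdl y \<subseteq> P" using P by (intro cgenideal_minimal P.is_ideal)
    show "\<Union> ((+>) (PIdl y) ` P) = P"
    proof
      show "\<Union> ((+>) (PIdl y) ` P) \<subseteq> P"
        using sub unfolding a_r_coset_def' by auto
      show "P \<subseteq> \<Union> ((+>) (PIdl y) ` P)"
        using abelian_subgroup.a_rcos_self[OF ideal.axioms(1)[OF I, THEN abelian_subgroupI3]]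
          P.Icarr is_abelian_group by blast
    qed
  qed
  moreover have "(\<lambda>P. (+>) (PIdl y) ` P) ` {P \<in> nonzero_primes R. residue_card R P \<le> n}
      \<subseteq> Pow (carrier (R Quot PIdl y))"
  proof -
    have "P \<subseteq> carrier R" if "P \<in> nonzero_primes R" for P
      using that additive_subgroup.a_subset[OF ideal.axioms(1)[OF primeideal.axioms(1)], of P R]
      by (simp add: nonzero_primes_def)
    then show ?thesis unfolding quot_carrier_eq by (auto intro!: imageI)
  qed
  ultimately show ?thesis
    using finite_principal_quot[OF yc y0] by (meson finite_Pow_iff inj_on_finite)
qed auto

lemma prime_ideal_product_cong:
  assumes "\<And>P. P \<in> nonzero_primes R \<Longrightarrow> e P = e' P"
  shows "prime_ideal_product R e = prime_ideal_product R e'"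
proof -
  interpret ids: comm_monoid "ideals_set R" by (rule ideals_set_is_comm_monoid)
  show ?thesis
    unfolding prime_ideal_product_def
  proof (rule ids.finprod_cong')
    show "(\<lambda>P. P [^]\<^bsub>ideals_set R\<^esub> e' P) \<in> {P \<in> nonzero_primes R. e' P \<noteq> 0} \<rightarrow> carrier (ideals_set R)"
      by (intro Pi_I ids.nat_pow_closed) (auto simp: ideals_set_def nonzero_primes_def primeideal_def)
  qed (use assms in auto)
qed

end

lemma (in ring) add_minus_cancel: "\<lbrakk>a \<in> carrier R; b \<in> carrier R\<rbrakk> \<Longrightarrow> (a \<oplus> b) \<ominus> b = a"
  by (simp add: a_minus_def a_assoc r_neg)

section \<open>Returns on cycles and differences of Legendre sums\<close>

lemma cycle_step_funpow: "i < L \<Longrightarrow> (cycle_step L ^^ n) i = (i + n) mod L"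
  by (induction n) (auto simp: cycle_step_def mod_Suc_eq)

lemma returns_to_start_iff: "0 < L \<Longrightarrow> returns_to_start L n \<longleftrightarrow> L dvd n"
proof
  assume "0 < L" "returns_to_start L n"
  then have "(cycle_step L ^^ n) 0 = 0" unfolding returns_to_start_def by blast
  then show "L dvd n" using \<open>0 < L\<close> by (simp add: cycle_step_funpow dvd_eq_mod_eq_0)
next
  assume "0 < L" "L dvd n"
  then show "returns_to_start L n"
    unfolding returns_to_start_def by (auto simp: cycle_step_funpow)
qed

lemma power_dvd_imp_le:
  assumes "2 \<le> q" "1 \<le> n" "q ^ k dvd n"
  shows "k \<le> (n::nat)"
proof -
  have "k < 2 ^ k" by (rule less_exp)
  also have "\<dots> \<le> q ^ k" using assms by (intro power_mono) auto
  also have "\<dots> \<le> n" using assms by (intro dvd_imp_le) auto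
  finally show ?thesis by simp
qed

text \<open>From \<open>n - 1\<close> to \<open>n\<close> the floor on level \<open>k\<close> rises
  by one exactly when \<open>q ^ k\<close> divides \<open>n\<close>; both sums are cut off at
  \<open>n\<close>.\<close>

lemma legendre_sum_diff:
  assumes "2 \<le> q" "1 \<le> n"
  shows "int (legendre_sum q n) - int (legendre_sum q (n - 1)) = (\<Sum>k=1..n. of_bool (q ^ k dvd n))"
proof -
  obtain m where m: "n = Suc m" using assms by (cases n) auto
  have "n div q ^ k = m div q ^ k + of_bool (q ^ k dvd n)" for k
    using assms unfolding m by (auto simp: div_Suc dvd_eq_mod_eq_0)
  then have "legendre_sum q n = (\<Sum>k=1..n. m div q ^ k) + (\<Sum>k=1..n. of_bool (q ^ k dvd n))"
    using legendre_sum_eq[OF assms(1) order.refl, of n] by (simp add: sum.distrib)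
  moreover have "legendre_sum q m = (\<Sum>k=1..n. m div q ^ k)"
    using legendre_sum_eq[OF assms(1), of m n] m by simp
  ultimately show ?thesis using m by simp
qed

text \<open>Reduces finiteness of the support to finiteness of the set of primes with bounded
  residue field.\<close>

lemma legendre_sum_nonzero_imp:
  assumes "2 \<le> q" "legendre_sum q n \<noteq> 0" shows "q \<le> n"
proof (rule ccontr)
  assume "\<not> q \<le> n"
  have "n div q ^ k = 0" if "k \<in> {1..n}" for k
  proof -
    have "n < q ^ 1" using \<open>\<not> q \<le> n\<close> by simp
    also have "\<dots> \<le> q ^ k" using that assms by (intro power_increasing) auto
    finally show ?thesis by simp
  qed
  then show False using legendre_sum_eq[OF assms(1) order.refl, of n] assms(2) by simp
qed

context finite_quotient_domain
begin

lemma bhargava_factorial_eq: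
  "bhargava_factorial R (carrier R) n = prime_ideal_product R (\<lambda>P. legendre_sum (residue_card R P) n)"
  unfolding bhargava_factorial_def by (rule prime_ideal_product_cong) (rule bhargava_exp_eq)

lemma finite_support_legendre_sum:
  "finite {P \<in> nonzero_primes R. legendre_sum (residue_card R P) n \<noteq> 0}"
  by (rule finite_subset[OF _ finite_primes_bounded_residue_card[of n]])
    (use legendre_sum_nonzero_imp residue_card_ge_2 in blast)

lemma recurrence_cocycle_eq_sum:
  assumes "P \<in> nonzero_primes R" "1 \<le> n"
  shows "recurrence_cocycle R (carrier R) P n = (\<Sum>k=1..n. of_bool (residue_card R P ^ k dvd n))"
  unfolding recurrence_cocycle_def bhargava_exp_eq[OF assms(1)]
  by (rule legendre_sum_diff[OF residue_card_ge_2[OF assms(1)] assms(2)])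

lemma recurrence_cocycle_eq_suminf:
  assumes "P \<in> nonzero_primes R" "1 \<le> n"
  shows "recurrence_cocycle R (carrier R) P n = suminf (\<lambda>j. of_bool (residue_card R P ^ Suc j dvd n))"
proof -
  have "suminf (\<lambda>j. of_bool (residue_card R P ^ Suc j dvd n)) = (\<Sum>j<n. of_bool (residue_card R P ^ Suc j dvd n) :: int)"
    using power_dvd_imp_le[OF residue_card_ge_2[OF assms(1)] assms(2), THEN Suc_le_lessD]
    by (intro suminf_finite) (auto simp del: power_Suc)
  also have "\<dots> = (\<Sum>k=1..n. of_bool (residue_card R P ^ k dvd n))"
    by (rule sum.reindex_bij_witness[of _ "\<lambda>k. k - 1" Suc]) auto
  finally show ?thesis using recurrence_cocycle_eq_sum[OF assms] by simp
qed

lemma recurrence_cocycle_eq_card: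
  assumes "P \<in> nonzero_primes R" "1 \<le> n"
  shows "finite {j. j \<ge> 1 \<and> returns_to_start (residue_card R P ^ j) n}"
    and "recurrence_cocycle R (carrier R) P n =
           int (card {j. j \<ge> 1 \<and> returns_to_start (residue_card R P ^ j) n})"
proof -
  have "0 < residue_card R P ^ j" for j
    using residue_card_ge_2[OF assms(1)] by simp
  then have eq: "{j. j \<ge> 1 \<and> returns_to_start (residue_card R P ^ j) n} =
      {1..n} \<inter> {j. residue_card R P ^ j dvd n}"
    using power_dvd_imp_le[OF residue_card_ge_2[OF assms(1)] assms(2)]
    by (auto simp: returns_to_start_iff)
  show "finite {j. j \<ge> 1 \<and> returns_to_start (residue_card R P ^ j) n}" unfolding eq by simp
  show "recurrence_cocycle R (carrier R) P n =
      int (card {j. j \<ge> 1 \<and> returns_to_start (residue_card R P ^ j) n})"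
    unfolding eq recurrence_cocycle_eq_sum[OF assms] by simp
qed

end

section \<open>Finiteness of quotients from growth of heights\<close>

text \<open>\<open>V n\<close> stands for the elements of logarithmic height at most \<open>n\<close> in a fixed lattice. Multiplication
  by \<open>x\<close>, up to the denominator \<open>s\<close>, increases the height by at most a constant.\<close>

locale growth_filtration = field K for K (structure) +
  fixes V :: "nat \<Rightarrow> 'a set" and C :: nat
  assumes V_carrier: "V n \<subseteq> carrier K"
    and V_finite: "finite (V n)"
    and V_card: "card (V n) \<le> C ^ Suc n"
    and V_zero: "\<zero> \<in> V n"
    and V_mono: "V n \<subseteq> V (Suc n)"
    and V_add: "\<lbrakk>x \<in> V n; y \<in> V n\<rbrakk> \<Longrightarrow> x \<oplus> y \<in> V (Suc n)"
    and V_one: "\<exists>s\<in>carrier K. s \<noteq> \<zero> \<and> (\<exists>m. s \<in> V m)"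
    and V_mult: "x \<in> carrier K \<Longrightarrow> \<exists>s\<in>carrier K. s \<noteq> \<zero> \<and>
                   (\<exists>c. \<forall>n. \<forall>v\<in>V n. s \<otimes> v \<in> V (n + c) \<and> (s \<otimes> x) \<otimes> v \<in> V (n + c))"
begin

lemma V_le: "m \<le> n \<Longrightarrow> V m \<subseteq> V n"
  by (rule lift_Suc_antimono_le[of "\<lambda>n. - V n", simplified]) (use V_mono in auto)

lemma C_pos: "0 < C"
  using V_card[of 0] V_zero[of 0] V_finite[of 0] by (metis card_gt_0_iff empty_iff gr0I le_zero_eq power_Suc0_right)

lemma V_multE:
  assumes "x \<in> carrier K"
  obtains s c where "s \<in> carrier K" "s \<noteq> \<zero>" "\<forall>n. \<forall>v\<in>V n. s \<otimes> v \<in> V (n + c)"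
    "\<forall>n. \<forall>v\<in>V n. (s \<otimes> x) \<otimes> v \<in> V (n + c)"
  using V_mult[OF assms] by blast

lemma common_denominator:
  assumes "finite A" "A \<subseteq> carrier K"
  shows "\<exists>s\<in>carrier K. s \<noteq> \<zero> \<and> (\<exists>m. \<forall>x\<in>A. s \<otimes> x \<in> V m)"
  using assms
proof (induction A rule: finite_induct)
  case (insert x A)
  then obtain s m where s: "s \<in> carrier K" "s \<noteq> \<zero>" "\<And>y. y \<in> A \<Longrightarrow> s \<otimes> y \<in> V m" by auto
  obtain t c where t: "t \<in> carrier K" "t \<noteq> \<zero>" "\<forall>n. \<forall>v\<in>V n. t \<otimes> v \<in> V (n + c)"
    "\<forall>n. \<forall>v\<in>V n. (t \<otimes> x) \<otimes> v \<in> V (n + c)"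
    by (rule V_multE[of x]) (use insert.prems in auto)
  obtain e k where e: "e \<in> carrier K" "e \<noteq> \<zero>" "e \<in> V k" using V_one by blast
  obtain f d where f: "f \<in> carrier K" "f \<noteq> \<zero>" "\<forall>n. \<forall>v\<in>V n. f \<otimes> v \<in> V (n + d)"
    "\<forall>n. \<forall>v\<in>V n. (f \<otimes> e) \<otimes> v \<in> V (n + d)"
    by (rule V_multE[OF e(1)])
  obtain g b where g: "g \<in> carrier K" "g \<noteq> \<zero>" "\<forall>n. \<forall>v\<in>V n. g \<otimes> v \<in> V (n + b)"
    "\<forall>n. \<forall>v\<in>V n. (g \<otimes> s) \<otimes> v \<in> V (n + b)"
    by (rule V_multE[OF s(1)])
  \<comment> \<open>Multiplication by \<open>s\<close> or \<open>e\<close> stays bounded on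
    \<open>V\<close> only after scaling, by \<open>g\<close> and \<open>f\<close> respectively. For
    \<open>x\<close> the vector acted on is \<open>e\<close>, since \<open>t \<otimes> x\<close>
    maps \<open>V\<close> into \<open>V\<close>; for \<open>y\<close> in \<open>A\<close> it is
    \<open>s \<otimes> y\<close>.\<close>
  define r where "r = (g \<otimes> s) \<otimes> ((f \<otimes> e) \<otimes> t)"
  have rc: "r \<in> carrier K" "r \<noteq> \<zero>"
    unfolding r_def using s t e f g by (auto simp: integral_iff)
  have xc: "x \<in> carrier K" using insert.prems by simp
  have "r \<otimes> x = (g \<otimes> s) \<otimes> (f \<otimes> ((t \<otimes> x) \<otimes> e))"
    unfolding r_def using s t e f g xc by algebra
  also have "\<dots> \<in> V (k + c + d + b)"
    using g(4) f(3) t(4) e(3) by blast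
  finally have x: "r \<otimes> x \<in> V (m + b + d + c + k + c + d + b)"
    using V_le[of "k + c + d + b" "m + b + d + c + k + c + d + b"] by auto
  have "r \<otimes> y \<in> V (m + b + d + c + k + c + d + b)" if y: "y \<in> A" for y
  proof -
    have yc: "y \<in> carrier K" using y insert.prems by blast
    have "r \<otimes> y = (f \<otimes> e) \<otimes> (t \<otimes> (g \<otimes> (s \<otimes> y)))"
      unfolding r_def using s t e f g yc by algebra
    also have "\<dots> \<in> V (m + b + c + d)"
      using g(3) s(3)[OF y] f(4) t(3) by blast
    finally show ?thesis
      using V_le[of "m + b + c + d" "m + b + d + c + k + c + d + b"] by auto
  qed
  then show ?case using rc x by (intro bexI[of _ r] conjI exI[of _ "m + b + d + c + k + c + d + b"]) auto
qed (use V_one in auto)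

text \<open>Horner form of a number in base \<open>x\<close>, lowest digit first.\<close>

primrec digit_sum :: "'a \<Rightarrow> 'a list \<Rightarrow> 'a" where
  "digit_sum x [] = \<zero>"
| "digit_sum x (d # ds) = d \<oplus> x \<otimes> digit_sum x ds"

lemma digit_sum_in_subring:
  assumes "subring T K" "x \<in> T" "set ds \<subseteq> T"
  shows "digit_sum x ds \<in> T"
  using assms(3) by (induction ds) (use subringE(2,6,7)[OF assms(1)] assms(2) in auto)

text \<open>Modulo \<open>x\<close> only the lowest digit survives, and digits congruent modulo
  \<open>x\<close> within \<open>T\<close> are equal; cancelling \<open>x\<close> exposes the next
  digit.\<close>

lemma digit_sum_inj:
  assumes T: "subring T K" "x \<in> T" "x \<noteq> \<zero>" and A: "A \<subseteq> T"
    and inc: "\<forall>y\<in>A. \<forall>z\<in>A. \<forall>r\<in>T. y = r \<otimes> x \<oplus> z \<longrightarrow> y = z"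
  shows "\<lbrakk>set ds \<subseteq> A; set ds' \<subseteq> A; length ds = length ds'; digit_sum x ds = digit_sum x ds'\<rbrakk>
         \<Longrightarrow> ds = ds'"
proof (induction ds arbitrary: ds')
  case (Cons d ds)
  then obtain d' es where ds': "ds' = d' # es" by (metis length_Suc_conv)
  have TK: "T \<subseteq> carrier K" using subringE(1)[OF T(1)] .
  have h: "digit_sum x ds \<in> T" "digit_sum x es \<in> T"
    using Cons.prems A ds' by (auto intro!: digit_sum_in_subring T(1,2))
  have c: "x \<in> carrier K" "d \<in> carrier K" "d' \<in> carrier K"
    "digit_sum x ds \<in> carrier K" "digit_sum x es \<in> carrier K"
    using Cons.prems A h T(2) TK ds' by auto
  have eq: "d \<oplus> x \<otimes> digit_sum x ds = d' \<oplus> x \<otimes> digit_sum x es" using Cons.prems ds' by simp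
  have "d = (d \<oplus> x \<otimes> digit_sum x ds) \<ominus> x \<otimes> digit_sum x ds" using c by algebra
  also have "\<dots> = (digit_sum x es \<ominus> digit_sum x ds) \<otimes> x \<oplus> d'" unfolding eq using c by algebra
  finally have "d = (digit_sum x es \<ominus> digit_sum x ds) \<otimes> x \<oplus> d'" .
  moreover have "digit_sum x es \<ominus> digit_sum x ds \<in> T"
    using subringE(5,7)[OF T(1)] h by (simp add: a_minus_def)
  ultimately have "d = d'" using inc[rule_format, of d d'] Cons.prems ds' by simp
  then have "x \<otimes> digit_sum x ds = x \<otimes> digit_sum x es" using eq c by simp
  then have "digit_sum x ds = digit_sum x es" using m_lcancel[OF T(3) c(1,4,5)] by simp
  then show ?case using Cons \<open>d = d'\<close> ds' by simp
qed simp

text \<open>Numbers with \<open>k\<close> digits from \<open>A\<close> in base \<open>x\<close> are pairwise distinct, while their number is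
  at most exponential in \<open>k\<close> with a base depending on \<open>x\<close> only.\<close>

lemma incongruent_set_bound:
  assumes x: "x \<in> carrier K"
  obtains M where "\<And>T A. \<lbrakk>subring T K; x \<in> T; x \<noteq> \<zero>; A \<subseteq> T; finite A;
     \<forall>y\<in>A. \<forall>z\<in>A. \<forall>r\<in>T. y = r \<otimes> x \<oplus> z \<longrightarrow> y = z\<rbrakk> \<Longrightarrow> card A \<le> M"
proof -
  obtain s c where s: "s \<in> carrier K" "s \<noteq> \<zero>" "\<forall>n. \<forall>v\<in>V n. s \<otimes> v \<in> V (n + c)"
    "\<forall>n. \<forall>v\<in>V n. (s \<otimes> x) \<otimes> v \<in> V (n + c)"
    by (rule V_multE[OF x])
  have spow: "s [^] j \<otimes> v \<in> V (n + j * c)" if "v \<in> V n" for v n and j :: nat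
  proof (induction j)
    case 0
    have "v \<in> carrier K" using that V_carrier by blast
    then show ?case using that by simp
  next
    case (Suc j)
    have "v \<in> carrier K" using that V_carrier by blast
    then have "s [^] Suc j \<otimes> v = s \<otimes> (s [^] j \<otimes> v)" using s(1) by (simp add: m_ac)
    moreover have "s \<otimes> (s [^] j \<otimes> v) \<in> V (n + j * c + c)" using s(3) Suc by blast
    ultimately show ?case by (simp add: add_ac)
  qed
  have "card A \<le> C ^ Suc c" if T: "subring T K" "x \<in> T" "x \<noteq> \<zero>" and A: "A \<subseteq> T" "finite A"
    and inc: "\<forall>y\<in>A. \<forall>z\<in>A. \<forall>r\<in>T. y = r \<otimes> x \<oplus> z \<longrightarrow> y = z" for T A
  proof -
    have TK: "T \<subseteq> carrier K" using subringE(1)[OF T(1)] .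
    \<comment> \<open>The denominator \<open>e\<close> depends on the digit set, but it affects only
      \<open>m\<close>, hence only the constant factor \<open>C ^ Suc m\<close> below; this keeps
      the final bound independent of \<open>T\<close> and \<open>A\<close>.\<close>
    obtain e m where e: "e \<in> carrier K" "e \<noteq> \<zero>" "\<And>d. d \<in> A \<Longrightarrow> e \<otimes> d \<in> V m"
      using common_denominator[OF A(2)] A(1) TK by blast
    \<comment> \<open>One further digit costs \<open>c\<close> for the multiplication by
      \<open>x\<close> and 1 for the addition, hence \<open>Suc c\<close> per digit.\<close>
    have scaled: "(e \<otimes> s [^] length ds) \<otimes> digit_sum x ds \<in> V (m + length ds * Suc c)"
      if "set ds \<subseteq> A" for ds
      using that
    proof (induction ds)
      case Nil
      then show ?case using e(1) V_zero by simp
    next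
      case (Cons d ds)
      let ?k = "length ds" and ?h = "digit_sum x ds"
      have c: "d \<in> carrier K" "?h \<in> carrier K" "s [^] ?k \<in> carrier K"
        using Cons.prems A(1) TK digit_sum_in_subring[OF T(1,2), of ds] s(1) by auto
      have "(e \<otimes> s [^] length (d # ds)) \<otimes> digit_sum x (d # ds) =
          s [^] Suc ?k \<otimes> (e \<otimes> d) \<oplus> (s \<otimes> x) \<otimes> ((e \<otimes> s [^] ?k) \<otimes> ?h)"
        using c s(1) e(1) x by (simp, algebra)
      moreover have "s [^] Suc ?k \<otimes> (e \<otimes> d) \<in> V (m + ?k * Suc c + c)"
      proof -
        have "s [^] Suc ?k \<otimes> (e \<otimes> d) \<in> V (m + Suc ?k * c)"
          using Cons.prems by (intro spow e) simp
        moreover have "m + Suc ?k * c \<le> m + ?k * Suc c + c" by simp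
        ultimately show ?thesis using V_le by blast
      qed
      moreover have "(s \<otimes> x) \<otimes> ((e \<otimes> s [^] ?k) \<otimes> ?h) \<in> V (m + ?k * Suc c + c)"
        using Cons s(4) by auto
      ultimately have "(e \<otimes> s [^] length (d # ds)) \<otimes> digit_sum x (d # ds) \<in> V (Suc (m + ?k * Suc c + c))"
        using V_add by simp
      then show ?case by (simp add: algebra_simps)
    qed
    have bound: "card A ^ k \<le> C ^ Suc m * (C ^ Suc c) ^ k" for k
    proof -
      let ?L = "{ds. set ds \<subseteq> A \<and> length ds = k}"
      let ?f = "\<lambda>ds. (e \<otimes> s [^] k) \<otimes> digit_sum x ds"
      have es: "e \<otimes> s [^] k \<in> carrier K" "e \<otimes> s [^] k \<noteq> \<zero>"
        using e s pow_nonzero[of s k] by (auto simp: integral_iff)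
      have "inj_on ?f ?L"
      proof (rule inj_onI)
        fix ds ds' assume *: "ds \<in> ?L" "ds' \<in> ?L" "?f ds = ?f ds'"
        have "digit_sum x ds \<in> carrier K" "digit_sum x ds' \<in> carrier K"
          using * A(1) TK digit_sum_in_subring[OF T(1,2)] by blast+
        then have "digit_sum x ds = digit_sum x ds'" using *(3) m_lcancel[OF es(2,1)] by blast
        then show "ds = ds'" by (intro digit_sum_inj[OF T A(1) inc]) (use * in auto)
      qed
      moreover have "?f ` ?L \<subseteq> V (m + k * Suc c)" using scaled by auto
      ultimately have "card ?L \<le> card (V (m + k * Suc c))"
        using V_finite by (rule card_inj_on_le)
      also have "\<dots> \<le> C ^ Suc (m + k * Suc c)" by (rule V_card)
      also have "\<dots> = C ^ Suc m * (C ^ Suc c) ^ k" by (simp only: power_mult[symmetric] power_add[symmetric]) (simp add: algebra_simps)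
      finally show ?thesis using card_lists_length_eq[OF A(2)] by simp
    qed
    show ?thesis
    proof (rule ccontr)
      assume large: "\<not> card A \<le> C ^ Suc c"
      \<comment> \<open>The ratio of the two exponential bases: if it exceeded 1, its powers would
        outgrow the constant \<open>C ^ Suc m\<close>.\<close>
      define q where "q = real (card A) / real (C ^ Suc c)"
      have pos: "real (C ^ Suc c) > 0" using C_pos by simp
      have "1 < q" unfolding q_def using large pos by (simp add: less_divide_eq_1 del: power_Suc of_nat_power)
      then obtain k where k: "real (C ^ Suc m) < q ^ k" using real_arch_pow by blast
      have "real (card A ^ k) \<le> real (C ^ Suc m * (C ^ Suc c) ^ k)" using bound[of k] of_nat_le_iff by blast
      then have "real (card A) ^ k \<le> real (C ^ Suc m) * real (C ^ Suc c) ^ k"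
        by (simp only: of_nat_power of_nat_mult)
      then have "q ^ k \<le> real (C ^ Suc m)"
        unfolding q_def power_divide using pos by (simp only: pos_divide_le_eq zero_less_power)
      with k show False by simp
    qed
  qed
  then show ?thesis by (rule that)
qed

lemma finite_quot_subring:
  assumes T: "subring T K" "x \<in> T" "x \<noteq> \<zero>"
  shows "finite (carrier (K\<lparr>carrier := T\<rparr> Quot (PIdl\<^bsub>K\<lparr>carrier := T\<rparr>\<^esub> x)))"
proof (rule ccontr)
  let ?R = "K\<lparr>carrier := T\<rparr>"
  let ?I = "PIdl\<^bsub>?R\<^esub> x"
  assume inf: "infinite (carrier (?R Quot ?I))"
  interpret R: domain ?R using subring_is_domain[OF T(1)] .
  have TK: "T \<subseteq> carrier K" using subringE(1)[OF T(1)] .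
  obtain M where M: "\<And>T A. \<lbrakk>subring T K; x \<in> T; x \<noteq> \<zero>; A \<subseteq> T; finite A;
     \<forall>y\<in>A. \<forall>z\<in>A. \<forall>r\<in>T. y = r \<otimes> x \<oplus> z \<longrightarrow> y = z\<rbrakk> \<Longrightarrow> card A \<le> M"
    using incongruent_set_bound[of x] T TK by blast
  obtain Y where Y: "finite Y" "card Y = Suc M" "Y \<subseteq> carrier (?R Quot ?I)"
    using infinite_arbitrarily_large[OF inf] by blast
  have "\<forall>D\<in>Y. \<exists>d\<in>T. D = ?I +>\<^bsub>?R\<^esub> d" using Y(3) unfolding R.quot_carrier_eq by auto
  then obtain g where g: "\<And>D. D \<in> Y \<Longrightarrow> g D \<in> T \<and> D = ?I +>\<^bsub>?R\<^esub> g D" by metis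
  have I: "ideal ?I ?R" using R.cgenideal_ideal[of x] T by simp
  have "inj_on g Y" using g by (metis inj_onI)
  then have "card (g ` Y) = Suc M" using Y card_image by fastforce
  moreover have "card (g ` Y) \<le> M"
  proof (rule M[OF T], goal_cases)
    case 3
    have "y = z" if yz: "y \<in> g ` Y" "z \<in> g ` Y" "r \<in> T" "y = r \<otimes> x \<oplus> z" for y z r
    proof -
      from yz obtain D E where DE: "D \<in> Y" "y = g D" "E \<in> Y" "z = g E" by blast
      have yc: "y \<in> carrier ?R" "z \<in> carrier ?R" using DE g by auto
      have "r \<otimes>\<^bsub>?R\<^esub> x \<in> carrier ?R" using yz T R.m_closed[of r x] by simp
      then have "(r \<otimes>\<^bsub>?R\<^esub> x \<oplus>\<^bsub>?R\<^esub> z) \<ominus>\<^bsub>?R\<^esub> z = r \<otimes>\<^bsub>?R\<^esub> x" using yc(2) by (rule R.add_minus_cancel)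
      then have "y \<ominus>\<^bsub>?R\<^esub> z = r \<otimes>\<^bsub>?R\<^esub> x" using yz(4) by simp
      also have "\<dots> \<in> ?I" unfolding cgenideal_def using yz(3) by auto
      finally show "y = z" using R.quotient_eq_iff_same_a_r_cos[OF I yc] DE g by metis
    qed
    then show ?case by blast
  qed (use Y g in auto)
  ultimately show False by simp
qed

end

subsection \<open>Filtrations of fields by finite sets\<close>

context ring
begin

declare Span.simps [simp del]

lemma Span_Nil_eq: "Span B [] = {\<zero>}"
  by (simp add: Span.simps)

lemma Span_Cons_iff: "x \<in> Span B (e # es) \<longleftrightarrow> (\<exists>a\<in>B. \<exists>v\<in>Span B es. x = a \<otimes> e \<oplus> v)"
  by (simp add: Span.simps line_extension_mem_iff)

lemma Span_carrier: "\<lbrakk>B \<subseteq> carrier R; set es \<subseteq> carrier R\<rbrakk> \<Longrightarrow> Span B es \<subseteq> carrier R"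
proof (induction es)
  case (Cons e es)
  show ?case
  proof
    fix x assume "x \<in> Span B (e # es)"
    then obtain a v where "a \<in> B" "v \<in> Span B es" "x = a \<otimes> e \<oplus> v"
      unfolding Span_Cons_iff by blast
    moreover have "v \<in> carrier R" using Cons calculation(2) by auto
    ultimately show "x \<in> carrier R" using Cons.prems by auto
  qed
qed (simp add: Span_Nil_eq)

lemma Span_mono: "B \<subseteq> B' \<Longrightarrow> Span B es \<subseteq> Span B' es"
proof (induction es)
  case (Cons e es)
  then show ?case unfolding subset_iff Span_Cons_iff by blast
qed (simp add: Span_Nil_eq)

lemma Span_zero: "\<lbrakk>\<zero> \<in> B; set es \<subseteq> carrier R\<rbrakk> \<Longrightarrow> \<zero> \<in> Span B es"
proof (induction es)
  case (Cons e es)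
  then have "\<zero> = \<zero> \<otimes> e \<oplus> \<zero>" "\<zero> \<in> Span B es" by auto
  then show ?case unfolding Span_Cons_iff using Cons.prems(1) by blast
qed (simp add: Span_Nil_eq)

lemma Span_finite_card:
  assumes "finite B" shows "finite (Span B es) \<and> card (Span B es) \<le> card B ^ length es"
proof (induction es)
  case (Cons e es)
  have eq: "Span B (e # es) = (\<lambda>(a, v). a \<otimes> e \<oplus> v) ` (B \<times> Span B es)"
    unfolding set_eq_iff Span_Cons_iff image_iff by auto
  have "card (Span B (e # es)) \<le> card (B \<times> Span B es)"
    unfolding eq using assms Cons by (intro card_image_le) auto
  also have "\<dots> \<le> card B ^ length (e # es)" using Cons by (simp add: card_cartesian_product)
  finally show ?case unfolding eq using assms Cons by auto
qed (simp add: Span_Nil_eq)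

text \<open>The coefficient sets used here are finite and not closed under addition, so the result
  is expressed over a further set \<open>D\<close>.\<close>

lemma Span_add:
  assumes "B \<subseteq> carrier R" "B' \<subseteq> carrier R" "set es \<subseteq> carrier R"
    and "\<And>a b. \<lbrakk>a \<in> B; b \<in> B'\<rbrakk> \<Longrightarrow> a \<oplus> b \<in> D"
  shows "\<lbrakk>x \<in> Span B es; y \<in> Span B' es\<rbrakk> \<Longrightarrow> x \<oplus> y \<in> Span D es"
  using assms(3)
proof (induction es arbitrary: x y)
  case (Cons e es)
  obtain a v where x: "a \<in> B" "v \<in> Span B es" "x = a \<otimes> e \<oplus> v"
    using Cons.prems unfolding Span_Cons_iff by blast
  obtain b w where y: "b \<in> B'" "w \<in> Span B' es" "y = b \<otimes> e \<oplus> w"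
    using Cons.prems unfolding Span_Cons_iff by blast
  have c: "a \<in> carrier R" "b \<in> carrier R" "v \<in> carrier R" "w \<in> carrier R" "e \<in> carrier R"
    using x y assms Cons.prems Span_carrier[of B es] Span_carrier[of B' es] by auto
  have "x \<oplus> y = (a \<oplus> b) \<otimes> e \<oplus> (v \<oplus> w)" unfolding x(3) y(3) using c by algebra
  moreover have "v \<oplus> w \<in> Span D es" using Cons x y by simp
  ultimately show ?case unfolding Span_Cons_iff using assms(4)[OF x(1) y(1)] by blast
qed (simp add: Span_Nil_eq)

lemma Span_smult:
  assumes "B \<subseteq> carrier R" "set es \<subseteq> carrier R" "c \<in> carrier R"
    and "\<And>a. a \<in> B \<Longrightarrow> c \<otimes> a \<in> D"
  shows "x \<in> Span B es \<Longrightarrow> c \<otimes> x \<in> Span D es"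
  using assms(2)
proof (induction es arbitrary: x)
  case (Cons e es)
  obtain a v where x: "a \<in> B" "v \<in> Span B es" "x = a \<otimes> e \<oplus> v"
    using Cons.prems unfolding Span_Cons_iff by blast
  have c: "a \<in> carrier R" "v \<in> carrier R" "e \<in> carrier R"
    using x assms Cons.prems Span_carrier[of B es] by auto
  have "c \<otimes> x = (c \<otimes> a) \<otimes> e \<oplus> c \<otimes> v" unfolding x(3) using c assms(3) by algebra
  moreover have "c \<otimes> v \<in> Span D es" using Cons x by simp
  ultimately show ?case unfolding Span_Cons_iff using assms(4)[OF x(1)] by blast
qed (simp add: Span_Nil_eq assms)

end

text \<open>The index is a logarithmic size. The instances are integers bounded by
  \<open>2 ^ n\<close> and values of polynomials of degree at most \<open>n\<close> over a finite
  field.\<close>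

locale coefficient_filtration = field K for K (structure) +
  fixes B :: "nat \<Rightarrow> 'a set" and q :: nat
  assumes B_carrier: "B n \<subseteq> carrier K"
    and B_finite: "finite (B n)"
    and B_card: "card (B n) \<le> q ^ Suc n"
    and B_zero: "\<zero> \<in> B n"
    and B_one: "\<one> \<in> B 0"
    and B_mono: "B n \<subseteq> B (Suc n)"
    and B_minus: "x \<in> B n \<Longrightarrow> \<ominus> x \<in> B n"
    and B_add: "\<lbrakk>x \<in> B n; y \<in> B n\<rbrakk> \<Longrightarrow> x \<oplus> y \<in> B (Suc n)"
    and B_mult: "\<lbrakk>x \<in> B m; y \<in> B n\<rbrakk> \<Longrightarrow> x \<otimes> y \<in> B (m + n)"
begin

lemma B_le: "m \<le> n \<Longrightarrow> B m \<subseteq> B n"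
  by (rule lift_Suc_antimono_le[of "\<lambda>n. - B n", simplified]) (use B_mono in auto)

definition is_quotient :: "'a \<Rightarrow> bool" where
  "is_quotient x \<longleftrightarrow> (\<exists>n. \<exists>a\<in>B n. \<exists>b\<in>B n. b \<noteq> \<zero> \<and> b \<otimes> x = a)"

lemma is_quotientI: "\<lbrakk>a \<in> B m; b \<in> B n; b \<noteq> \<zero>; b \<otimes> x = a\<rbrakk> \<Longrightarrow> is_quotient x"
  unfolding is_quotient_def using B_le[of m "max m n"] B_le[of n "max m n"]
  by (intro exI[of _ "max m n"]) auto

text \<open>Fractions of coefficients are closed under the field operations, by the usual
  common-denominator formulas, so it suffices to check generators.\<close>

lemma is_quotient_generate_field:
  assumes H: "H \<subseteq> carrier K" "\<And>h. h \<in> H \<Longrightarrow> is_quotient h"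
  shows "x \<in> generate_field K H \<Longrightarrow> is_quotient x"
proof (induction rule: generate_field.induct)
  case one
  show ?case using B_one B_one one_not_zero by (rule is_quotientI) simp
next
  case (incl h)
  then show ?case by (rule H(2))
next
  case (a_inv h)
  then obtain n a b where ab: "a \<in> B n" "b \<in> B n" "b \<noteq> \<zero>" "b \<otimes> h = a" unfolding is_quotient_def by blast
  have "b \<in> carrier K" "h \<in> carrier K" using ab B_carrier generate_field_in_carrier[OF H(1)] a_inv by auto
  then have "b \<otimes> \<ominus> h = \<ominus> a" unfolding ab(4)[symmetric] by (rule r_minus)
  then show ?case using B_minus[OF ab(1)] ab(2,3) by (intro is_quotientI)
next
  case (m_inv h)
  then obtain n a b where ab: "a \<in> B n" "b \<in> B n" "b \<noteq> \<zero>" "b \<otimes> h = a" unfolding is_quotient_def by blast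
  have c: "b \<in> carrier K" "h \<in> carrier K" using ab B_carrier generate_field_in_carrier[OF H(1)] m_inv by auto
  have h: "h \<in> Units K" using c m_inv field_Units by simp
  have "a \<otimes> inv h = b" unfolding ab(4)[symmetric] using c h by (simp add: m_assoc)
  moreover have "a \<noteq> \<zero>" unfolding ab(4)[symmetric] using integral[OF _ c] ab(3) m_inv by blast
  ultimately show ?case using ab(1,2) by (intro is_quotientI)
next
  case (eng_add h h')
  obtain n a b where ab: "a \<in> B n" "b \<in> B n" "b \<noteq> \<zero>" "b \<otimes> h = a"
    using eng_add unfolding is_quotient_def by blast
  obtain m c d where cd: "c \<in> B m" "d \<in> B m" "d \<noteq> \<zero>" "d \<otimes> h' = c"
    using eng_add unfolding is_quotient_def by blast
  have car: "b \<in> carrier K" "d \<in> carrier K" "h \<in> carrier K" "h' \<in> carrier K"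
    using ab cd B_carrier generate_field_in_carrier[OF H(1)] eng_add by auto
  have "(b \<otimes> d) \<otimes> (h \<oplus> h') = (b \<otimes> h) \<otimes> d \<oplus> b \<otimes> (d \<otimes> h')" using car by algebra
  moreover have "(b \<otimes> h) \<otimes> d \<oplus> b \<otimes> (d \<otimes> h') \<in> B (Suc (n + m))"
    unfolding ab(4) cd(4) using ab cd by (intro B_add B_mult)
  moreover have "b \<otimes> d \<in> B (n + m)" "b \<otimes> d \<noteq> \<zero>" using ab cd B_mult car integral_iff by auto
  ultimately show ?case by (intro is_quotientI)
next
  case (eng_mult h h')
  obtain n a b where ab: "a \<in> B n" "b \<in> B n" "b \<noteq> \<zero>" "b \<otimes> h = a"
    using eng_mult unfolding is_quotient_def by blast
  obtain m c d where cd: "c \<in> B m" "d \<in> B m" "d \<noteq> \<zero>" "d \<otimes> h' = c"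
    using eng_mult unfolding is_quotient_def by blast
  have car: "b \<in> carrier K" "d \<in> carrier K" "h \<in> carrier K" "h' \<in> carrier K"
    using ab cd B_carrier generate_field_in_carrier[OF H(1)] eng_mult by auto
  have "(b \<otimes> d) \<otimes> (h \<otimes> h') = (b \<otimes> h) \<otimes> (d \<otimes> h')" using car by algebra
  moreover have "(b \<otimes> h) \<otimes> (d \<otimes> h') \<in> B (n + m)"
    unfolding ab(4) cd(4) using ab cd by (intro B_mult)
  moreover have "b \<otimes> d \<in> B (n + m)" "b \<otimes> d \<noteq> \<zero>" using ab cd B_mult car integral_iff by auto
  ultimately show ?case by (intro is_quotientI)
qed

text \<open>The list grows along the chain of line extensions defining \<open>dimension\<close>. The
  coordinate at a new vector is a fraction, and its denominator is multiplied into the scaling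
  factor \<open>s\<close>.\<close>

lemma dimension_spanning:
  assumes "dimension n F E" "F \<subseteq> carrier K" "\<And>f. f \<in> F \<Longrightarrow> is_quotient f"
  shows "\<exists>es. set es \<subseteq> carrier K \<and>
    (\<forall>x\<in>E. x \<in> carrier K \<and> (\<exists>m. \<exists>s\<in>B m. s \<noteq> \<zero> \<and> s \<otimes> x \<in> Span (B m) es))"
  using assms
proof (induction rule: dimension.induct)
  case (zero_dim F)
  have "\<exists>m. \<exists>s\<in>B m. s \<noteq> \<zero> \<and> s \<otimes> \<zero> \<in> Span (B m) []"
    using B_one one_not_zero by (intro exI[of _ 0] bexI[of _ \<one>]) (auto simp: Span_Nil_eq)
  then show ?case by (intro exI[of _ "[]"]) simp
next
  case (Suc_dim v E n F)
  then obtain es where es: "set es \<subseteq> carrier K"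
    "\<And>x. x \<in> E \<Longrightarrow> x \<in> carrier K"
    "\<And>x. x \<in> E \<Longrightarrow> \<exists>m. \<exists>s\<in>B m. s \<noteq> \<zero> \<and> s \<otimes> x \<in> Span (B m) es" by blast
  have "x \<in> carrier K \<and> (\<exists>m. \<exists>s\<in>B m. s \<noteq> \<zero> \<and> s \<otimes> x \<in> Span (B m) (v # es))"
    if "x \<in> line_extension F v E" for x
  proof -
    obtain k e where x: "k \<in> F" "e \<in> E" "x = k \<otimes> v \<oplus> e"
      using \<open>x \<in> line_extension F v E\<close> unfolding line_extension_mem_iff by blast
    obtain m s where s: "s \<in> B m" "s \<noteq> \<zero>" "s \<otimes> e \<in> Span (B m) es" using es(3)[OF x(2)] by blast
    obtain n a b where ab: "a \<in> B n" "b \<in> B n" "b \<noteq> \<zero>" "b \<otimes> k = a"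
      using Suc_dim.prems(2)[OF x(1)] unfolding is_quotient_def by blast
    have c: "k \<in> carrier K" "e \<in> carrier K" "s \<in> carrier K" "b \<in> carrier K" "a \<in> carrier K" "v \<in> carrier K"
      using x es(2) s ab B_carrier Suc_dim.prems(1) Suc_dim.hyps(1) by auto
    have "(b \<otimes> s) \<otimes> x = (s \<otimes> (b \<otimes> k)) \<otimes> v \<oplus> b \<otimes> (s \<otimes> e)"
      unfolding x(3) using c by algebra
    moreover have "s \<otimes> (b \<otimes> k) \<in> B (n + m)"
      unfolding ab(4) using B_mult[OF s(1) ab(1)] by (simp add: add.commute)
    moreover have "b \<otimes> (s \<otimes> e) \<in> Span (B (n + m)) es"
      by (rule Span_smult[OF B_carrier es(1) c(4) B_mult[OF ab(2)] s(3)])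
    ultimately have "(b \<otimes> s) \<otimes> x \<in> Span (B (n + m)) (v # es)"
      unfolding Span_Cons_iff by blast
    moreover have "b \<otimes> s \<in> B (n + m)" "b \<otimes> s \<noteq> \<zero>" using B_mult ab s c integral_iff by auto
    moreover have "x \<in> carrier K" unfolding x(3) using c by simp
    ultimately show ?thesis by blast
  qed
  then show ?case using es(1) Suc_dim.hyps(1) by (intro exI[of _ "v # es"]) auto
qed

lemma finite_dimension_spanning:
  assumes "finite_dimension (generate_field K H) (carrier K)" "H \<subseteq> carrier K"
    and "\<And>h. h \<in> H \<Longrightarrow> is_quotient h"
  obtains es where "set es \<subseteq> carrier K"
    "\<forall>x\<in>carrier K. \<exists>m. \<exists>s\<in>B m. s \<noteq> \<zero> \<and> s \<otimes> x \<in> Span (B m) es"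
proof -
  obtain n where "dimension n (generate_field K H) (carrier K)"
    using assms(1) unfolding finite_dimension_def by blast
  then have "\<exists>es. set es \<subseteq> carrier K \<and>
    (\<forall>x\<in>carrier K. x \<in> carrier K \<and> (\<exists>m. \<exists>s\<in>B m. s \<noteq> \<zero> \<and> s \<otimes> x \<in> Span (B m) es))"
    by (rule dimension_spanning) (use generate_field_incl[OF assms(2)]
      is_quotient_generate_field[OF assms(2,3)] in auto)
  then show ?thesis using that by blast
qed

end

section \<open>Heights on the whole field from heights of coefficients\<close>

locale spanned_filtration = coefficient_filtration +
  fixes es :: "'a list"
  assumes es_carrier: "set es \<subseteq> carrier K"
    and spanning: "x \<in> carrier K \<Longrightarrow> \<exists>m. \<exists>s\<in>B m. s \<noteq> \<zero> \<and> s \<otimes> x \<in> Span (B m) es"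
begin

lemma Span_le: "m \<le> n \<Longrightarrow> Span (B m) us \<subseteq> Span (B n) us"
  by (intro Span_mono B_le)

lemma Span_B_mult:
  "\<lbrakk>b \<in> B m; v \<in> Span (B n) es\<rbrakk> \<Longrightarrow> b \<otimes> v \<in> Span (B (m + n)) es"
  by (rule Span_smult[OF B_carrier es_carrier subsetD[OF B_carrier] B_mult])

lemma common_denominator_B:
  "set us \<subseteq> carrier K \<Longrightarrow> \<exists>m. \<exists>s\<in>B m. s \<noteq> \<zero> \<and> (\<forall>u\<in>set us. s \<otimes> u \<in> Span (B m) es)"
proof (induction us)
  case Nil
  show ?case using B_one one_not_zero by (intro exI[of _ 0] bexI[of _ \<one>]) auto
next
  case (Cons u us)
  then obtain m s where s: "s \<in> B m" "s \<noteq> \<zero>" "\<And>v. v \<in> set us \<Longrightarrow> s \<otimes> v \<in> Span (B m) es" by auto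
  obtain n t where t: "t \<in> B n" "t \<noteq> \<zero>" "t \<otimes> u \<in> Span (B n) es" using spanning[of u] Cons.prems by auto
  have c: "s \<in> carrier K" "t \<in> carrier K" using s t B_carrier by auto
  have "(s \<otimes> t) \<otimes> v \<in> Span (B (m + n)) es" if "v \<in> set (u # us)" for v
  proof (cases "v = u")
    case True
    have "(s \<otimes> t) \<otimes> u = s \<otimes> (t \<otimes> u)" using c Cons.prems by (simp add: m_assoc)
    then show ?thesis using True Span_B_mult[OF s(1) t(3)] by simp
  next
    case False
    then have v: "v \<in> set us" "v \<in> carrier K" using that Cons.prems by auto
    then have "(s \<otimes> t) \<otimes> v = t \<otimes> (s \<otimes> v)" using c by (simp add: m_ac)
    then show ?thesis using Span_B_mult[OF t(1) s(3)[OF v(1)]] by (simp add: add.commute)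
  qed
  moreover have "s \<otimes> t \<in> B (m + n)" "s \<otimes> t \<noteq> \<zero>" using B_mult s t c integral_iff by auto
  ultimately show ?case by blast
qed

text \<open>Each of the additions in the combination costs one index, which accounts for
  \<open>length us\<close>.\<close>

lemma Span_image:
  assumes y: "y \<in> carrier K" and us: "set us \<subseteq> carrier K" "\<And>u. u \<in> set us \<Longrightarrow> y \<otimes> u \<in> Span (B m) es"
  shows "v \<in> Span (B n) us \<Longrightarrow> y \<otimes> v \<in> Span (B (n + m + length us)) es"
  using us
proof (induction us arbitrary: v)
  case Nil
  then show ?case using y Span_zero[OF B_zero es_carrier] by (simp add: Span_Nil_eq)
next
  case (Cons u us)
  obtain a w where v: "a \<in> B n" "w \<in> Span (B n) us" "v = a \<otimes> u \<oplus> w"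
    using Cons.prems(1) unfolding Span_Cons_iff by blast
  have c: "a \<in> carrier K" "w \<in> carrier K" "u \<in> carrier K"
    using v B_carrier Span_carrier[OF B_carrier, of us n] Cons.prems(2) by auto
  have "y \<otimes> v = a \<otimes> (y \<otimes> u) \<oplus> y \<otimes> w" unfolding v(3) using c y by algebra
  moreover have "a \<otimes> (y \<otimes> u) \<in> Span (B (n + m + length us)) es"
    using Span_B_mult[OF v(1) Cons.prems(3)[of u]] Span_le[of "n + m" "n + m + length us" es] by auto
  moreover have "y \<otimes> w \<in> Span (B (n + m + length us)) es"
    using Cons.IH[OF v(2)] Cons.prems by auto
  ultimately show ?case
    using Span_add[OF B_carrier B_carrier es_carrier B_add] by simp
qed

sublocale growth_filtration K "\<lambda>n. Span (B n) es" "q ^ length es"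
proof
  fix n
  show "Span (B n) es \<subseteq> carrier K" by (intro Span_carrier B_carrier es_carrier)
  show "finite (Span (B n) es)" using Span_finite_card B_finite by blast
  have "card (Span (B n) es) \<le> card (B n) ^ length es" using Span_finite_card B_finite by blast
  also have "\<dots> \<le> (q ^ Suc n) ^ length es" by (intro power_mono B_card) simp
  also have "\<dots> = (q ^ length es) ^ Suc n" by (simp only: power_mult[symmetric] mult.commute)
  finally show "card (Span (B n) es) \<le> (q ^ length es) ^ Suc n" .
  show "\<zero> \<in> Span (B n) es" by (intro Span_zero B_zero es_carrier)
  show "Span (B n) es \<subseteq> Span (B (Suc n)) es" by (intro Span_mono B_mono)
  show "x \<oplus> y \<in> Span (B (Suc n)) es" if "x \<in> Span (B n) es" "y \<in> Span (B n) es" for x y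
    using that by (intro Span_add[OF B_carrier B_carrier es_carrier B_add])
next
  obtain m s where "s \<in> B m" "s \<noteq> \<zero>" "s \<otimes> \<one> \<in> Span (B m) es" using spanning[of \<one>] by auto
  moreover have "s \<in> carrier K" using \<open>s \<in> B m\<close> B_carrier by blast
  ultimately show "\<exists>s\<in>carrier K. s \<noteq> \<zero> \<and> (\<exists>m. s \<in> Span (B m) es)" by auto
next
  fix x assume x: "x \<in> carrier K"
  \<comment> \<open>The products of \<open>x\<close> with the spanning vectors form the matrix of
    multiplication by \<open>x\<close>; \<open>s\<close> is a common denominator of its
    entries.\<close>
  have "set (map (\<lambda>e. x \<otimes> e) es) \<subseteq> carrier K" using x es_carrier by auto
  from common_denominator_B[OF this] obtain m s where s: "s \<in> B m" "s \<noteq> \<zero>"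
    "\<And>e. e \<in> set es \<Longrightarrow> s \<otimes> (x \<otimes> e) \<in> Span (B m) es" by auto
  have sc: "s \<in> carrier K" using s(1) B_carrier by blast
  have "s \<otimes> v \<in> Span (B (n + (m + length es))) es \<and> (s \<otimes> x) \<otimes> v \<in> Span (B (n + (m + length es))) es"
    if "v \<in> Span (B n) es" for n v
  proof
    show "s \<otimes> v \<in> Span (B (n + (m + length es))) es"
      using Span_B_mult[OF s(1) that] Span_le[of "m + n" "n + (m + length es)" es] by auto
    have "(s \<otimes> x) \<otimes> v \<in> Span (B (n + m + length es)) es"
    proof (rule Span_image[OF _ es_carrier _ that])
      show "s \<otimes> x \<otimes> e \<in> Span (B m) es" if "e \<in> set es" for e
        using s(3)[OF that] that es_carrier sc x by (simp add: m_assoc subset_iff)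
    qed (use sc x in simp)
    then show "(s \<otimes> x) \<otimes> v \<in> Span (B (n + (m + length es))) es" by (simp add: add.assoc)
  qed
  then show "\<exists>s\<in>carrier K. s \<noteq> \<zero> \<and> (\<exists>c. \<forall>n. \<forall>v\<in>Span (B n) es.
      s \<otimes> v \<in> Span (B (n + c)) es \<and> (s \<otimes> x) \<otimes> v \<in> Span (B (n + c)) es)"
    using sc s(2) by blast
qed

end

text \<open>Inside a field the division-free closedness condition can be restated for the actual
  quotient \<open>w\<close> of \<open>b\<close> by \<open>a\<close>.\<close>

lemma (in field) finite_quotient_domain_subring:
  assumes T: "subring T R"
    and fin: "\<And>x. \<lbrakk>x \<in> T; x \<noteq> \<zero>\<rbrakk> \<Longrightarrow>
      finite (carrier (R\<lparr>carrier := T\<rparr> Quot (PIdl\<^bsub>R\<lparr>carrier := T\<rparr>\<^esub> x)))"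
    and cic: "\<And>w c. \<lbrakk>w \<in> carrier R; c \<in> T; c \<noteq> \<zero>; \<forall>n::nat. w [^] n \<otimes> c \<in> T\<rbrakk> \<Longrightarrow> w \<in> T"
  shows "finite_quotient_domain (R\<lparr>carrier := T\<rparr>)"
proof -
  interpret R: domain "R\<lparr>carrier := T\<rparr>" using subring_is_domain[OF T] .
  have TK: "T \<subseteq> carrier R" using subringE(1)[OF T] .
  show ?thesis
  proof
    show "finite (carrier (R\<lparr>carrier := T\<rparr> Quot (PIdl\<^bsub>R\<lparr>carrier := T\<rparr>\<^esub> x)))"
      if "x \<in> carrier (R\<lparr>carrier := T\<rparr>)" "x \<noteq> \<zero>\<^bsub>R\<lparr>carrier := T\<rparr>\<^esub>" for x
      using that fin by simp
  next
    fix a b c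
    assume "a \<in> carrier (R\<lparr>carrier := T\<rparr>)" "b \<in> carrier (R\<lparr>carrier := T\<rparr>)"
      "c \<in> carrier (R\<lparr>carrier := T\<rparr>)" "a \<noteq> \<zero>\<^bsub>R\<lparr>carrier := T\<rparr>\<^esub>" "c \<noteq> \<zero>\<^bsub>R\<lparr>carrier := T\<rparr>\<^esub>"
      and div: "\<And>n::nat. \<exists>r\<in>carrier (R\<lparr>carrier := T\<rparr>). b [^]\<^bsub>R\<lparr>carrier := T\<rparr>\<^esub> n \<otimes>\<^bsub>R\<lparr>carrier := T\<rparr>\<^esub> c =
        a [^]\<^bsub>R\<lparr>carrier := T\<rparr>\<^esub> n \<otimes>\<^bsub>R\<lparr>carrier := T\<rparr>\<^esub> r"
    then have abc: "a \<in> T" "b \<in> T" "c \<in> T" "a \<noteq> \<zero>" "c \<noteq> \<zero>" by auto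
    then have car: "a \<in> carrier R" "b \<in> carrier R" "c \<in> carrier R" using TK by auto
    have ai: "inv a \<in> carrier R" "a \<otimes> inv a = \<one>" "inv a \<otimes> a = \<one>" using car abc field_Units by auto
    define w where "w = b \<otimes> inv a"
    have w: "w \<in> carrier R" unfolding w_def using car ai by simp
    have "w [^] n \<otimes> c \<in> T" for n :: nat
    proof -
      obtain r where r: "r \<in> T" "b [^] n \<otimes> c = a [^] n \<otimes> r"
        using div[of n] by (auto simp: nat_pow_consistent[symmetric])
      have rc: "r \<in> carrier R" using r TK by blast
      have inv: "inv a [^] n \<otimes> a [^] n = \<one>"
        using pow_mult_distrib[of "inv a" a n] car ai by (simp add: m_comm)
      have "w [^] n \<otimes> c = inv a [^] n \<otimes> (b [^] n \<otimes> c)"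
        unfolding w_def using car ai by (simp add: pow_mult_distrib m_comm m_lcomm m_assoc)
      also have "\<dots> = (inv a [^] n \<otimes> a [^] n) \<otimes> r" unfolding r(2) using car ai rc by (simp add: m_assoc)
      also have "\<dots> = r" using inv rc by simp
      finally show ?thesis using r(1) by simp
    qed
    then have "w \<in> T" using cic[OF w abc(3,5)] by blast
    moreover have "b = a \<otimes> w"
    proof -
      have "a \<otimes> w = b \<otimes> (a \<otimes> inv a)" unfolding w_def using car ai(1) by (simp add: m_lcomm)
      then show ?thesis using car ai by simp
    qed
    ultimately show "\<exists>r\<in>carrier (R\<lparr>carrier := T\<rparr>). b = a \<otimes>\<^bsub>R\<lparr>carrier := T\<rparr>\<^esub> r" by auto
  qed
qed

subsection \<open>Function fields\<close>

text \<open>Values at \<open>t\<close> of the polynomials over \<open>F\<close> of degree at most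
  \<open>n\<close>, in Horner form.\<close>

primrec (in ring) bounded_polys :: "'a set \<Rightarrow> 'a \<Rightarrow> nat \<Rightarrow> 'a set" where
  "bounded_polys F t 0 = F"
| "bounded_polys F t (Suc n) = (\<lambda>(f, b). f \<oplus> t \<otimes> b) ` (F \<times> bounded_polys F t n)"

context field
begin

lemma bounded_polys_Suc_iff:
  "x \<in> bounded_polys F t (Suc n) \<longleftrightarrow> (\<exists>f\<in>F. \<exists>b\<in>bounded_polys F t n. x = f \<oplus> t \<otimes> b)"
  unfolding bounded_polys.simps image_iff by auto

declare bounded_polys.simps(2) [simp del]

lemma coefficient_filtration_polys:
  assumes F: "subring F R" "finite F" and t: "t \<in> carrier R"
  shows "coefficient_filtration R (bounded_polys F t) (card F)"
proof -
  note F' = subringE[OF F(1)]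
  have car: "bounded_polys F t n \<subseteq> carrier R" for n
  proof (induction n)
    case (Suc n)
    show ?case
      using t subsetD[OF F'(1)] subsetD[OF Suc] by (auto simp: bounded_polys_Suc_iff)
  qed (simp add: F')
  have zero: "\<zero> \<in> bounded_polys F t n" for n
  proof (induction n)
    case (Suc n)
    have "\<zero> = \<zero> \<oplus> t \<otimes> \<zero>" using t by simp
    then show ?case unfolding bounded_polys_Suc_iff using Suc F'(2) by blast
  qed (simp add: F')
  have mono: "bounded_polys F t n \<subseteq> bounded_polys F t (Suc n)" for n
  proof (induction n)
    case 0
    have "f \<in> bounded_polys F t (Suc 0)" if "f \<in> F" for f
    proof -
      have "f = f \<oplus> t \<otimes> \<zero>" using that t F'(1) by auto
      then show ?thesis unfolding bounded_polys_Suc_iff using zero[of 0] that by blast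
    qed
    then show ?case by auto
  next
    case (Suc n)
    show ?case
    proof
      fix x assume "x \<in> bounded_polys F t (Suc n)"
      then obtain f b where "f \<in> F" "b \<in> bounded_polys F t n" "x = f \<oplus> t \<otimes> b"
        unfolding bounded_polys_Suc_iff by blast
      moreover from this Suc have "b \<in> bounded_polys F t (Suc n)" by blast
      ultimately show "x \<in> bounded_polys F t (Suc (Suc n))"
        using bounded_polys_Suc_iff[of x F t "Suc n"] by blast
    qed
  qed
  have add: "x \<oplus> y \<in> bounded_polys F t n" if "x \<in> bounded_polys F t n" "y \<in> bounded_polys F t n" for x y n
    using that
  proof (induction n arbitrary: x y)
    case (Suc n)
    then obtain f b g c where fb: "f \<in> F" "b \<in> bounded_polys F t n" "x = f \<oplus> t \<otimes> b"
      and gc: "g \<in> F" "c \<in> bounded_polys F t n" "y = g \<oplus> t \<otimes> c"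
      unfolding bounded_polys_Suc_iff by blast
    have "f \<in> carrier R" "g \<in> carrier R" "b \<in> carrier R" "c \<in> carrier R"
      using fb gc car F'(1) by auto
    then have "x \<oplus> y = (f \<oplus> g) \<oplus> t \<otimes> (b \<oplus> c)" unfolding fb(3) gc(3) using t by algebra
    then show ?case unfolding bounded_polys_Suc_iff using Suc.IH fb gc F'(7) by blast
  qed (simp add: F')
  have smult: "f \<otimes> x \<in> bounded_polys F t n" if "f \<in> F" "x \<in> bounded_polys F t n" for f x n
    using that(2)
  proof (induction n arbitrary: x)
    case 0
    then show ?case using that(1) F'(6) by simp
  next
    case (Suc n)
    then obtain g c where gc: "g \<in> F" "c \<in> bounded_polys F t n" "x = g \<oplus> t \<otimes> c"
      unfolding bounded_polys_Suc_iff by blast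
    have "f \<in> carrier R" "g \<in> carrier R" "c \<in> carrier R" using gc that car F'(1) by auto
    then have "f \<otimes> x = f \<otimes> g \<oplus> t \<otimes> (f \<otimes> c)" unfolding gc(3) using t by algebra
    then show ?case unfolding bounded_polys_Suc_iff using Suc.IH gc F'(6)[OF that(1)] by blast
  qed
  have mult: "x \<otimes> y \<in> bounded_polys F t (m + n)"
    if "x \<in> bounded_polys F t m" and y: "y \<in> bounded_polys F t n" for x y m n
    using that(1)
  proof (induction m arbitrary: x)
    case 0
    then show ?case using smult y by simp
  next
    case (Suc m)
    then obtain g c where gc: "g \<in> F" "c \<in> bounded_polys F t m" "x = g \<oplus> t \<otimes> c"
      unfolding bounded_polys_Suc_iff by blast
    have c: "g \<in> carrier R" "c \<in> carrier R" "y \<in> carrier R" using gc y car F'(1) by auto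
    have "t \<otimes> (c \<otimes> y) = \<zero> \<oplus> t \<otimes> (c \<otimes> y)" using c t by simp
    then have "t \<otimes> (c \<otimes> y) \<in> bounded_polys F t (Suc (m + n))"
      unfolding bounded_polys_Suc_iff using Suc.IH[OF gc(2)] F'(2) by blast
    moreover have "bounded_polys F t n \<subseteq> bounded_polys F t (Suc (m + n))"
      by (rule lift_Suc_antimono_le[of "\<lambda>n. - bounded_polys F t n", simplified]) (use mono in auto)
    then have "g \<otimes> y \<in> bounded_polys F t (Suc (m + n))" using smult[OF gc(1) y] by blast
    moreover have "x \<otimes> y = g \<otimes> y \<oplus> t \<otimes> (c \<otimes> y)" unfolding gc(3) using c t by algebra
    ultimately show ?case using add by simp
  qed
  have fin: "finite (bounded_polys F t n)" for n
    by (induction n) (auto simp: F bounded_polys.simps(2))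
  have card: "card (bounded_polys F t n) \<le> card F ^ Suc n" for n
  proof (induction n)
    case (Suc n)
    have "card (bounded_polys F t (Suc n)) \<le> card (F \<times> bounded_polys F t n)"
      unfolding bounded_polys.simps(2) using F fin by (intro card_image_le) auto
    also have "\<dots> \<le> card F ^ Suc (Suc n)" using Suc by (simp add: card_cartesian_product)
    finally show ?case .
  qed simp
  have minus: "\<ominus> x \<in> bounded_polys F t n" if "x \<in> bounded_polys F t n" for x n
  proof -
    have "x \<in> carrier R" using that car by blast
    then have "\<ominus> x = (\<ominus> \<one>) \<otimes> x" by (simp add: l_minus)
    then show ?thesis using smult[OF F'(5)[OF F'(3)] that] by simp
  qed
  show ?thesis
    by unfold_locales (use car fin card zero mono minus mult F'(3) subsetD[OF mono add] in auto)
qed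

text \<open>Common interface for both kinds of global field: only the coefficient sets and the
  generators of the base field differ.\<close>

lemma finite_dimension_finite_quot:
  assumes "coefficient_filtration R B q" "finite_dimension (generate_field R H) (carrier R)"
    and H: "H \<subseteq> carrier R" "\<And>h. h \<in> H \<Longrightarrow> coefficient_filtration.is_quotient R B h"
    and T: "subring T R" "x \<in> T" "x \<noteq> \<zero>"
  shows "finite (carrier (R\<lparr>carrier := T\<rparr> Quot (PIdl\<^bsub>R\<lparr>carrier := T\<rparr>\<^esub> x)))"
proof -
  interpret coefficient_filtration R B q by fact
  obtain es where es: "set es \<subseteq> carrier R"
    "\<forall>x\<in>carrier R. \<exists>m. \<exists>s\<in>B m. s \<noteq> \<zero> \<and> s \<otimes> x \<in> Span (B m) es"
    by (rule finite_dimension_spanning[OF assms(2) H])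
  interpret spanned_filtration R B q es
    by unfold_locales (use es in auto)
  show ?thesis by (rule finite_quot_subring[OF T])
qed

lemma places_facts:
  assumes "v \<in> places R" "x \<in> carrier R" "x \<noteq> \<zero>" "y \<in> carrier R" "y \<noteq> \<zero>"
  shows "v (x \<otimes> y) = v x + v y" "x \<oplus> y \<noteq> \<zero> \<Longrightarrow> min (v x) (v y) \<le> v (x \<oplus> y)"
  using assms unfolding places_def by auto

lemma places_one: "v \<in> places R \<Longrightarrow> v \<one> = 0"
  using places_facts(1)[of v \<one> \<one>] by simp

text \<open>The two elements have the same square, and doubling is injective on integers.\<close>

lemma places_minus:
  assumes "v \<in> places R" "x \<in> carrier R" "x \<noteq> \<zero>"
  shows "v (\<ominus> x) = v x"
proof -
  have "\<ominus> x \<noteq> \<zero>" using assms by (metis minus_minus minus_zero)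
  moreover have "\<ominus> x \<otimes> \<ominus> x = x \<otimes> x" using assms by algebra
  ultimately show ?thesis
    using places_facts(1)[OF assms assms(2,3)] places_facts(1)[OF assms(1), of "\<ominus> x" "\<ominus> x"] assms by simp
qed

lemma places_pow:
  assumes "v \<in> places R" "x \<in> carrier R" "x \<noteq> \<zero>"
  shows "v (x [^] n) = int n * v x"
proof (induction n)
  case 0
  then show ?case using places_one[OF assms(1)] by simp
next
  case (Suc n)
  then show ?case
    using places_facts(1)[OF assms(1), of "x [^] n" x] assms pow_nonzero[of x n] by (simp add: algebra_simps)
qed

lemma finite_quotient_domain_regular_away:
  assumes fin: "\<And>T x. \<lbrakk>subring T R; x \<in> T; x \<noteq> \<zero>\<rbrakk> \<Longrightarrow>
      finite (carrier (R\<lparr>carrier := T\<rparr> Quot (PIdl\<^bsub>R\<lparr>carrier := T\<rparr>\<^esub> x)))"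
  shows "finite_quotient_domain (ring_regular_away R \<Sigma>)"
proof -
  define T where "T = {x \<in> carrier R. x = \<zero> \<or> (\<forall>v \<in> places R - \<Sigma>. 0 \<le> v x)}"
  have sub: "subring T R"
  proof (rule subringI)
    show "T \<subseteq> carrier R" unfolding T_def by blast
    show "\<one> \<in> T" unfolding T_def using places_one by auto
    show "\<ominus> x \<in> T" if "x \<in> T" for x
      using that unfolding T_def by (cases "x = \<zero>") (auto simp: places_minus)
    show "x \<otimes> y \<in> T" if xy: "x \<in> T" "y \<in> T" for x y
    proof (cases "x = \<zero> \<or> y = \<zero>")
      case True
      then show ?thesis using xy unfolding T_def by auto
    next
      case False
      then have "0 \<le> v (x \<otimes> y)" if "v \<in> places R - \<Sigma>" for v
        using that xy places_facts(1)[of v x y] unfolding T_def by fastforce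
      then show ?thesis using xy unfolding T_def by auto
    qed
    show "x \<oplus> y \<in> T" if xy: "x \<in> T" "y \<in> T" for x y
    proof (cases "x = \<zero> \<or> y = \<zero> \<or> x \<oplus> y = \<zero>")
      case True
      then show ?thesis using xy unfolding T_def by auto
    next
      case False
      then have nz: "x \<noteq> \<zero>" "y \<noteq> \<zero>" "x \<oplus> y \<noteq> \<zero>" by auto
      have "0 \<le> v (x \<oplus> y)" if v: "v \<in> places R - \<Sigma>" for v
      proof -
        have "0 \<le> v x" "0 \<le> v y" "x \<in> carrier R" "y \<in> carrier R"
          using v xy nz(1,2) unfolding T_def by blast+
        moreover have "min (v x) (v y) \<le> v (x \<oplus> y)"
          using v calculation(3,4) nz by (intro places_facts(2)) auto
        ultimately show ?thesis by simp
      qed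
      then show ?thesis using xy unfolding T_def by auto
    qed
  qed
  have "w \<in> T" if w: "w \<in> carrier R" and c: "c \<in> T" "c \<noteq> \<zero>" "\<forall>n::nat. w [^] n \<otimes> c \<in> T" for w c
  proof (cases "w = \<zero>")
    case False
    have "0 \<le> v w" if v: "v \<in> places R - \<Sigma>" for v
    proof (rule ccontr)
      assume neg: "\<not> 0 \<le> v w"
      have cc: "c \<in> carrier R" using c unfolding T_def by blast
      have bound: "0 \<le> int n * v w + v c" for n
      proof -
        have "w [^] n \<noteq> \<zero>" "w [^] n \<in> carrier R" using pow_nonzero[OF w False] w by auto
        then have "w [^] n \<otimes> c \<noteq> \<zero>" using cc c integral_iff by simp
        then have "0 \<le> v (w [^] n \<otimes> c)" using c(3) v unfolding T_def by blast
        then show ?thesis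
          using places_facts(1)[of v "w [^] n" c] places_pow[of v w n] v w cc c False
            \<open>w [^] n \<noteq> \<zero>\<close> by simp
      qed
      \<comment> \<open>With \<open>v w \<le> - 1\<close>, the exponent \<open>v c + 1\<close>
        already makes the bound negative; exponent 0 gives \<open>0 \<le> v c\<close>, so that this
        exponent is a natural number.\<close>
      have "int (nat (v c + 1)) * v w \<le> - int (nat (v c + 1))"
        using neg mult_left_mono[of "v w" "- 1" "int (nat (v c + 1))"] by simp
      then show False using bound[of "nat (v c + 1)"] bound[of 0] by simp
    qed
    then show ?thesis unfolding T_def using w by blast
  qed (simp add: T_def)
  then have "finite_quotient_domain (R\<lparr>carrier := T\<rparr>)"
    using fin[OF sub] by (intro finite_quotient_domain_subring[OF sub]) blast+
  then show ?thesis unfolding ring_regular_away_def T_def .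
qed

end

lemma finite_quotient_domain_function_field:
  fixes K (structure)
  assumes "global_function_field K"
  shows "finite_quotient_domain (ring_regular_away K \<Sigma>)"
proof -
  interpret field K using assms unfolding global_function_field_def by blast
  obtain F t where F: "subfield F K" "finite F" and t: "t \<in> carrier K"
    and fd: "finite_dimension (generate_field K (insert t F)) (carrier K)"
    using assms unfolding global_function_field_def by blast
  note F' = subringE[OF subfieldE(1)[OF F(1)]]
  interpret coefficient_filtration K "bounded_polys F t" "card F"
    by (rule coefficient_filtration_polys[OF subfieldE(1)[OF F(1)] F(2) t])
  have "is_quotient h" if "h \<in> insert t F" for h
  proof (cases "h = t")
    case True
    have "t = \<zero> \<oplus> t \<otimes> \<one>" using t by simp
    then have "t \<in> bounded_polys F t (Suc 0)"
      unfolding bounded_polys_Suc_iff bounded_polys.simps(1) using F'(2,3) by blast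
    then show ?thesis using True t B_one one_not_zero by (intro is_quotientI[of t "Suc 0" \<one> 0]) auto
  next
    case False
    then have "h \<in> bounded_polys F t 0" "h \<in> carrier K" using that F'(1) by auto
    then show ?thesis using B_one one_not_zero by (intro is_quotientI[of h 0 \<one> 0]) auto
  qed
  then show ?thesis
    using t F'(1) finite_dimension_finite_quot[OF coefficient_filtration_axioms fd]
    by (intro finite_quotient_domain_regular_away) blast
qed

subsection \<open>Number fields\<close>

lemma int_ideal_principal:
  fixes I :: "int set"
  assumes "I \<noteq> {}" "\<And>k l. \<lbrakk>k \<in> I; l \<in> I\<rbrakk> \<Longrightarrow> k + l \<in> I" "\<And>k c. k \<in> I \<Longrightarrow> c * k \<in> I"
  shows "\<exists>g\<in>I. \<forall>k\<in>I. g dvd k"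
proof (cases "\<exists>k\<in>I. k \<noteq> 0")
  case False
  then show ?thesis using assms(1) by auto
next
  case True
  define P where "P n \<longleftrightarrow> 0 < n \<and> int n \<in> I" for n
  obtain k where "k \<in> I" "k \<noteq> 0" using True by blast
  moreover have "\<bar>k\<bar> \<in> I"
    using assms(3)[OF \<open>k \<in> I\<close>, of "sgn k"] by (simp add: abs_sgn[of k] mult.commute)
  ultimately have "P (nat \<bar>k\<bar>)" unfolding P_def by simp
  define g where "g = (LEAST n. P n)"
  have g: "P g" unfolding g_def by (rule LeastI) fact
  have "int g dvd k" if k: "k \<in> I" for k
  proof (rule ccontr)
    assume "\<not> int g dvd k"
    then have "k mod int g \<noteq> 0" by (simp only: dvd_eq_mod_eq_0 not_False_eq_True)
    moreover have "0 \<le> k mod int g" "k mod int g < int g" using g unfolding P_def by auto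
    ultimately have r: "0 < k mod int g" "k mod int g < int g" by auto
    have "k + - (k div int g) * int g \<in> I"
      using g unfolding P_def by (intro assms(2)[OF k] assms(3)) simp
    moreover have "k + - (k div int g) * int g = k mod int g"
      using div_mult_mod_eq[of k "int g"] by linarith
    ultimately have "P (nat (k mod int g))" using r unfolding P_def by simp
    then have "g \<le> nat (k mod int g)" unfolding g_def by (rule Least_le)
    then show False using r by linarith
  qed
  then show ?thesis using g unfolding P_def by blast
qed

context field
begin

definition of_int_ring :: "int \<Rightarrow> 'a" where "of_int_ring k = add_pow R k \<one>"

lemma of_int_ring_closed [simp]: "of_int_ring k \<in> carrier R"
  unfolding of_int_ring_def by simp

lemma of_int_ring_add: "of_int_ring (k + l) = of_int_ring k \<oplus> of_int_ring l"
  unfolding of_int_ring_def by (simp add: add.int_pow_mult)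

lemma of_int_ring_minus: "of_int_ring (- k) = \<ominus> of_int_ring k"
  unfolding of_int_ring_def by (simp add: add.int_pow_neg)

lemma of_int_ring_mult: "of_int_ring (k * l) = of_int_ring k \<otimes> of_int_ring l"
proof -
  have "add_pow R k \<one> \<otimes> add_pow R l \<one> = add_pow R k (add_pow R l \<one>)"
    using add_pow_ldistr_int[of \<one> "add_pow R l \<one>" k] by simp
  also have "\<dots> = add_pow R (l * k) \<one>" by (rule add.int_pow_pow) simp
  finally show ?thesis unfolding of_int_ring_def by (simp add: mult.commute)
qed

lemma of_int_ring_0 [simp]: "of_int_ring 0 = \<zero>"
  unfolding of_int_ring_def by (simp add: add_pow_def)

lemma of_int_ring_1 [simp]: "of_int_ring 1 = \<one>"
  unfolding of_int_ring_def by simp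

lemma prime_subring_eq: "prime_subring R = range of_int_ring"
  unfolding prime_subring_def of_int_ring_def ..

lemma prime_subring_is_subring: "subring (prime_subring R) R"
  unfolding prime_subring_eq
proof (rule subringI)
  show "\<one> \<in> range of_int_ring" by (rule range_eqI[of _ _ 1]) simp
  show "\<ominus> h \<in> range of_int_ring" if "h \<in> range of_int_ring" for h
    using that by (auto simp flip: of_int_ring_minus)
  show "h \<otimes> h' \<in> range of_int_ring" if "h \<in> range of_int_ring" "h' \<in> range of_int_ring" for h h'
    using that by (auto simp flip: of_int_ring_mult)
  show "h \<oplus> h' \<in> range of_int_ring" if "h \<in> range of_int_ring" "h' \<in> range of_int_ring" for h h'
    using that by (auto simp flip: of_int_ring_add)
qed auto

text \<open>With bound \<open>2 ^ n\<close> a sum raises the index by one and a product adds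
  indices. The base 4 comes from \<open>2 * 2 ^ n + 1 \<le> 4 ^ Suc n\<close>.\<close>

lemma coefficient_filtration_ints:
  "coefficient_filtration R (\<lambda>n. of_int_ring ` {k. \<bar>k\<bar> \<le> 2 ^ n}) 4"
proof
  fix n m :: nat and x y
  have eq: "{k::int. \<bar>k\<bar> \<le> 2 ^ n} = {-(2 ^ n)..2 ^ n}" by auto
  show "of_int_ring ` {k. \<bar>k\<bar> \<le> 2 ^ n} \<subseteq> carrier R" by auto
  show "finite (of_int_ring ` {k. \<bar>k\<bar> \<le> 2 ^ n})" unfolding eq by simp
  have "card (of_int_ring ` {k. \<bar>k\<bar> \<le> 2 ^ n}) \<le> card {-(2 ^ n)..(2 ^ n) :: int}"
    unfolding eq by (intro card_image_le) simp
  also have "\<dots> = 2 * 2 ^ n + 1" by (simp add: nat_add_distrib nat_mult_distrib nat_power_eq)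
  also have "\<dots> \<le> 4 * 4 ^ n"
  proof -
    have "(2::nat) ^ n \<le> 4 ^ n" "(1::nat) \<le> 4 ^ n" by (auto intro: power_mono)
    then show ?thesis by linarith
  qed
  finally show "card (of_int_ring ` {k. \<bar>k\<bar> \<le> 2 ^ n}) \<le> 4 ^ Suc n" by simp
  show "\<zero> \<in> of_int_ring ` {k. \<bar>k\<bar> \<le> 2 ^ n}" by (rule image_eqI[of _ _ 0]) auto
  show "\<one> \<in> of_int_ring ` {k. \<bar>k\<bar> \<le> 2 ^ 0}" by (rule image_eqI[of _ _ 1]) auto
  show "of_int_ring ` {k. \<bar>k\<bar> \<le> 2 ^ n} \<subseteq> of_int_ring ` {k. \<bar>k\<bar> \<le> 2 ^ Suc n}" by auto
  {
    assume "x \<in> of_int_ring ` {k. \<bar>k\<bar> \<le> 2 ^ n}"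
    then show "\<ominus> x \<in> of_int_ring ` {k. \<bar>k\<bar> \<le> 2 ^ n}" by (auto simp flip: of_int_ring_minus)
  }
  {
    assume "x \<in> of_int_ring ` {k. \<bar>k\<bar> \<le> 2 ^ n}" "y \<in> of_int_ring ` {k. \<bar>k\<bar> \<le> 2 ^ n}"
    then show "x \<oplus> y \<in> of_int_ring ` {k. \<bar>k\<bar> \<le> 2 ^ Suc n}" by (auto simp flip: of_int_ring_add)
  }
  {
    assume "x \<in> of_int_ring ` {k. \<bar>k\<bar> \<le> 2 ^ m}" "y \<in> of_int_ring ` {k. \<bar>k\<bar> \<le> 2 ^ n}"
    then show "x \<otimes> y \<in> of_int_ring ` {k. \<bar>k\<bar> \<le> 2 ^ (m + n)}"
      by (auto simp: abs_mult power_add mult_mono simp flip: of_int_ring_mult)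
  }
qed

section \<open>Finitely generated modules over the prime subring\<close>

lemma Span_subring_closed:
  assumes T: "subring T R" and us: "set us \<subseteq> carrier R"
  shows "\<zero> \<in> Span T us" "\<lbrakk>x \<in> Span T us; y \<in> Span T us\<rbrakk> \<Longrightarrow> x \<oplus> y \<in> Span T us"
    "\<lbrakk>a \<in> T; x \<in> Span T us\<rbrakk> \<Longrightarrow> a \<otimes> x \<in> Span T us" "x \<in> Span T us \<Longrightarrow> \<ominus> x \<in> Span T us"
proof -
  note T' = subringE[OF T]
  show "\<zero> \<in> Span T us" by (intro Span_zero T' us)
  show "\<lbrakk>x \<in> Span T us; y \<in> Span T us\<rbrakk> \<Longrightarrow> x \<oplus> y \<in> Span T us"
    by (rule Span_add[OF T'(1) T'(1) us T'(7)])
  have smult: "a \<otimes> x \<in> Span T us" if "a \<in> T" "x \<in> Span T us" for a x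
    using that(1) by (intro Span_smult[OF T'(1) us _ T'(6)[OF that(1)] that(2)] subsetD[OF T'(1)])
  then show "\<lbrakk>a \<in> T; x \<in> Span T us\<rbrakk> \<Longrightarrow> a \<otimes> x \<in> Span T us" .
  assume x: "x \<in> Span T us"
  then have "x \<in> carrier R" using Span_carrier[OF T'(1) us] by blast
  then have "\<ominus> x = (\<ominus> \<one>) \<otimes> x" by (simp add: l_minus)
  then show "\<ominus> x \<in> Span T us" using smult[OF T'(5)[OF T'(3)] x] by simp
qed

lemma Span_least:
  assumes "\<zero> \<in> M" "\<And>x y. \<lbrakk>x \<in> M; y \<in> M\<rbrakk> \<Longrightarrow> x \<oplus> y \<in> M" "\<And>a x. \<lbrakk>a \<in> T; x \<in> M\<rbrakk> \<Longrightarrow> a \<otimes> x \<in> M"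
    and "set us \<subseteq> M"
  shows "Span T us \<subseteq> M"
  using assms(4)
proof (induction us)
  case (Cons u us)
  show ?case
  proof
    fix x assume "x \<in> Span T (u # us)"
    then obtain a v where "a \<in> T" "v \<in> Span T us" "x = a \<otimes> u \<oplus> v"
      unfolding Span_Cons_iff by blast
    then show "x \<in> M" using Cons assms(2,3) by auto
  qed
qed (simp add: Span_Nil_eq assms(1))

text \<open>Induction on the generators: the coefficients at \<open>u\<close> form an ideal of the
  integers. An element of \<open>H\<close> realizing a generator of this ideal, together with
  generators of the part of \<open>H\<close> spanned by \<open>us\<close>, is enough.\<close>

lemma submodule_finitely_generated:
  assumes "set us \<subseteq> carrier R" "H \<subseteq> Span (prime_subring R) us" "H \<noteq> {}"
    and "\<And>x y. \<lbrakk>x \<in> H; y \<in> H\<rbrakk> \<Longrightarrow> x \<oplus> y \<in> H" "\<And>k x. x \<in> H \<Longrightarrow> of_int_ring k \<otimes> x \<in> H"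
  shows "\<exists>hs. set hs \<subseteq> H \<and> H \<subseteq> Span (prime_subring R) hs"
  using assms
proof (induction us arbitrary: H)
  case Nil
  then show ?case by (intro exI[of _ "[]"]) auto
next
  case (Cons u us)
  let ?S = "Span (prime_subring R) us"
  note Z = prime_subring_is_subring
  have us: "set us \<subseteq> carrier R" and u: "u \<in> carrier R" using Cons.prems(1) by auto
  note S = Span_subring_closed[OF Z us]
  have Sc: "?S \<subseteq> carrier R" using Span_carrier[OF subringE(1)[OF Z] us] .
  have Hc: "H \<subseteq> carrier R"
    using Cons.prems(2) Span_carrier[OF subringE(1)[OF Z] Cons.prems(1)] by blast
  have zS: "of_int_ring k \<otimes> w \<in> ?S" if "w \<in> ?S" for k w
    using that by (intro S(3)) (simp_all add: prime_subring_eq)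
  \<comment> \<open>An element need not determine its coefficient at \<open>u\<close>, so
    \<open>I\<close> collects every coefficient that occurs in some representation.\<close>
  define I where "I = {k. \<exists>w\<in>?S. of_int_ring k \<otimes> u \<oplus> w \<in> H}"
  have split: "\<exists>k\<in>I. \<exists>w\<in>?S. h = of_int_ring k \<otimes> u \<oplus> w" if "h \<in> H" for h
  proof -
    obtain a w where "a \<in> prime_subring R" "w \<in> ?S" "h = a \<otimes> u \<oplus> w"
      using Cons.prems(2) \<open>h \<in> H\<close> unfolding subset_iff Span_Cons_iff by blast
    then show ?thesis using \<open>h \<in> H\<close> unfolding I_def prime_subring_eq by blast
  qed
  have "\<exists>g\<in>I. \<forall>k\<in>I. g dvd k"
  proof (rule int_ideal_principal)
    show "I \<noteq> {}" using split Cons.prems(3) by blast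
    show "k + l \<in> I" if kl: "k \<in> I" "l \<in> I" for k l
    proof -
      obtain v w where vw: "v \<in> ?S" "of_int_ring k \<otimes> u \<oplus> v \<in> H" "w \<in> ?S" "of_int_ring l \<otimes> u \<oplus> w \<in> H"
        using kl unfolding I_def by blast
      have c: "v \<in> carrier R" "w \<in> carrier R" using vw Sc by auto
      have "of_int_ring (k + l) \<otimes> u \<oplus> (v \<oplus> w) = (of_int_ring k \<otimes> u \<oplus> v) \<oplus> (of_int_ring l \<otimes> u \<oplus> w)"
        unfolding of_int_ring_add using c u of_int_ring_closed[of k] of_int_ring_closed[of l] by algebra
      then have "of_int_ring (k + l) \<otimes> u \<oplus> (v \<oplus> w) \<in> H" using Cons.prems(4)[OF vw(2,4)] by simp
      then show ?thesis unfolding I_def using S(2)[OF vw(1,3)] by blast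
    qed
    show "c * k \<in> I" if k: "k \<in> I" for k c
    proof -
      obtain w where w: "w \<in> ?S" "of_int_ring k \<otimes> u \<oplus> w \<in> H" using k unfolding I_def by blast
      have wc: "w \<in> carrier R" using w Sc by auto
      have "of_int_ring (c * k) \<otimes> u \<oplus> of_int_ring c \<otimes> w = of_int_ring c \<otimes> (of_int_ring k \<otimes> u \<oplus> w)"
        unfolding of_int_ring_mult using wc u of_int_ring_closed[of k] of_int_ring_closed[of c] by algebra
      then have "of_int_ring (c * k) \<otimes> u \<oplus> of_int_ring c \<otimes> w \<in> H"
        using Cons.prems(5)[OF w(2), of c] by simp
      then show ?thesis unfolding I_def using zS[OF w(1), of c] by blast
    qed
  qed
  then obtain g where g: "g \<in> I" "\<And>k. k \<in> I \<Longrightarrow> g dvd k" by blast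
  obtain w0 where w0: "w0 \<in> ?S" "of_int_ring g \<otimes> u \<oplus> w0 \<in> H" using g(1) unfolding I_def by blast
  define h0 where "h0 = of_int_ring g \<otimes> u \<oplus> w0"
  have h0: "h0 \<in> H" unfolding h0_def by (rule w0)
  have w0c: "w0 \<in> carrier R" using w0 Sc by blast
  have "\<exists>hs. set hs \<subseteq> H \<inter> ?S \<and> H \<inter> ?S \<subseteq> Span (prime_subring R) hs"
  proof (rule Cons.IH[OF us])
    have "of_int_ring 0 \<otimes> h0 \<in> H" using h0 by (rule Cons.prems(5))
    then have "\<zero> \<in> H" using h0 Hc by auto
    then show "H \<inter> ?S \<noteq> {}" using S(1) by blast
    show "of_int_ring k \<otimes> x \<in> H \<inter> ?S" if "x \<in> H \<inter> ?S" for k x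
      using that Cons.prems(5) zS by blast
    show "x \<oplus> y \<in> H \<inter> ?S" if "x \<in> H \<inter> ?S" "y \<in> H \<inter> ?S" for x y
      using that Cons.prems(4) S(2) by blast
  qed simp
  then obtain hs where hs: "set hs \<subseteq> H \<inter> ?S" "H \<inter> ?S \<subseteq> Span (prime_subring R) hs" by blast
  have "h \<in> Span (prime_subring R) (h0 # hs)" if h: "h \<in> H" for h
  proof -
    obtain k w where k: "k \<in> I" and w: "w \<in> ?S" "h = of_int_ring k \<otimes> u \<oplus> w" using split[OF h] by blast
    obtain c where c: "k = g * c" using g(2)[OF k] by (rule dvdE)
    have wc: "w \<in> carrier R" using w Sc by blast
    define h' where "h' = h \<oplus> of_int_ring (- c) \<otimes> h0"
    have oc: "of_int_ring g \<in> carrier R" "of_int_ring c \<in> carrier R" by auto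
    have "h' = w \<oplus> of_int_ring (- c) \<otimes> w0"
      unfolding h'_def h0_def w(2) c of_int_ring_mult of_int_ring_minus using oc wc w0c u by algebra
    then have "h' \<in> ?S" using S(2)[OF w(1) zS[OF w0(1)]] by simp
    moreover have "h' \<in> H" unfolding h'_def using Cons.prems(4)[OF h Cons.prems(5)[OF h0]] .
    ultimately have "h' \<in> Span (prime_subring R) hs" using hs(2) by blast
    moreover have "h = of_int_ring c \<otimes> h0 \<oplus> h'"
    proof -
      have "h \<in> carrier R" "h0 \<in> carrier R" using h h0 Hc by auto
      then show ?thesis unfolding h'_def of_int_ring_minus using oc by algebra
    qed
    ultimately show ?thesis unfolding Span_Cons_iff prime_subring_eq by blast
  qed
  then show ?case using hs(1) h0 by (intro exI[of _ "h0 # hs"]) auto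
qed

text \<open>Highest power first, matching the order in which \<open>eval\<close> reads coefficient
  lists.\<close>

primrec powers_below :: "'a \<Rightarrow> nat \<Rightarrow> 'a list" where
  "powers_below x 0 = []"
| "powers_below x (Suc n) = x [^] n # powers_below x n"

lemma powers_below_carrier: "x \<in> carrier R \<Longrightarrow> set (powers_below x n) \<subseteq> carrier R"
  by (induction n) auto

lemma Span_powers_eval: "y \<in> Span T (powers_below x n) \<longleftrightarrow> (\<exists>p. set p \<subseteq> T \<and> length p = n \<and> y = eval p x)"
proof (induction n arbitrary: y)
  case 0
  then show ?case by (auto simp: Span_Nil_eq)
next
  case (Suc n)
  show ?case
  proof
    assume "y \<in> Span T (powers_below x (Suc n))"
    then obtain a v where a: "a \<in> T" "v \<in> Span T (powers_below x n)" "y = a \<otimes> x [^] n \<oplus> v"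
      unfolding powers_below.simps Span_Cons_iff by blast
    then obtain p where "set p \<subseteq> T" "length p = n" "v = eval p x" using Suc[of v] by blast
    with a show "\<exists>p. set p \<subseteq> T \<and> length p = Suc n \<and> y = eval p x"
      by (intro exI[of _ "a # p"]) simp
  next
    assume "\<exists>p. set p \<subseteq> T \<and> length p = Suc n \<and> y = eval p x"
    then obtain a p where p: "a \<in> T" "set p \<subseteq> T" "length p = n" "y = a \<otimes> x [^] n \<oplus> eval p x"
      by (auto simp: length_Suc_conv)
    then have "eval p x \<in> Span T (powers_below x n)" using Suc[of "eval p x"] by blast
    with p show "y \<in> Span T (powers_below x (Suc n))"
      unfolding powers_below.simps Span_Cons_iff by blast
  qed
qed

lemma Span_powers_mono:
  assumes "subring T R" "x \<in> carrier R" "m \<le> n"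
  shows "Span T (powers_below x m) \<subseteq> Span T (powers_below x n)"
proof -
  have "Span T (powers_below x k) \<subseteq> Span T (powers_below x (Suc k))" for k
  proof
    fix y assume y: "y \<in> Span T (powers_below x k)"
    then have "y \<in> carrier R"
      using Span_carrier[OF subringE(1)[OF assms(1)] powers_below_carrier[OF assms(2)]] by blast
    then have "y = \<zero> \<otimes> x [^] k \<oplus> y" using assms(2) by simp
    then show "y \<in> Span T (powers_below x (Suc k))"
      unfolding powers_below.simps Span_Cons_iff using y subringE(2)[OF assms(1)] by blast
  qed
  then show ?thesis
    using lift_Suc_mono_le[of "\<lambda>k. Span T (powers_below x k)", OF _ assms(3)] by blast
qed

lemma power_mem_Span_powers:
  assumes "subring T R" "x \<in> carrier R" "m < n"
  shows "x [^] m \<in> Span T (powers_below x n)"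
proof -
  have "x [^] m = \<one> \<otimes> x [^] m \<oplus> \<zero>" using assms(2) by simp
  then have "x [^] m \<in> Span T (powers_below x (Suc m))"
    unfolding powers_below.simps Span_Cons_iff
    using subringE(3)[OF assms(1)] Span_subring_closed(1)[OF assms(1) powers_below_carrier[OF assms(2)]]
    by blast
  then show ?thesis using Span_powers_mono[OF assms(1,2), of "Suc m" n] assms(3) by auto
qed

text \<open>A monic equation is solved for its top power. In this form integrality also makes sense
  over a larger coefficient ring, which the adjunction of elements needs.\<close>

lemma mem_ring_of_integers_iff:
  "x \<in> carrier (ring_of_integers R) \<longleftrightarrow>
     x \<in> carrier R \<and> (\<exists>n. x [^] n \<in> Span (prime_subring R) (powers_below x n))"
proof
  assume "x \<in> carrier (ring_of_integers R)"
  then obtain f where x: "x \<in> carrier R" and f: "f \<in> carrier (univ_poly R (prime_subring R))"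
    "f \<noteq> []" "lead_coeff f = \<one>" "eval f x = \<zero>"
    unfolding ring_of_integers_def by auto
  note Z = prime_subring_is_subring
  obtain p where p: "f = \<one> # p" using f(2,3) by (cases f) auto
  have "set p \<subseteq> prime_subring R"
    using f(1) p unfolding univ_poly_carrier[symmetric] polynomial_def by auto
  then have ev: "eval p x \<in> Span (prime_subring R) (powers_below x (length p))"
    unfolding Span_powers_eval by blast
  have ec: "eval p x \<in> carrier R"
    using ev Span_carrier[OF subringE(1)[OF Z] powers_below_carrier[OF x]] by blast
  have "x [^] length p \<oplus> eval p x = \<zero>" using f(4) p x by simp
  then have "x [^] length p = \<ominus> eval p x" using ec x by (intro minus_equality[symmetric]) (auto simp: a_comm)
  then show "x \<in> carrier R \<and> (\<exists>n. x [^] n \<in> Span (prime_subring R) (powers_below x n))"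
    using x Span_subring_closed(4)[OF Z powers_below_carrier[OF x] ev]
    by (intro conjI exI[of _ "length p"]) simp_all
next
  assume "x \<in> carrier R \<and> (\<exists>n. x [^] n \<in> Span (prime_subring R) (powers_below x n))"
  then obtain n where x: "x \<in> carrier R" and "x [^] n \<in> Span (prime_subring R) (powers_below x n)" by blast
  note Z = prime_subring_is_subring
  from Span_subring_closed(4)[OF Z powers_below_carrier[OF x]] \<open>x [^] n \<in> _\<close>
  obtain p where p: "set p \<subseteq> prime_subring R" "length p = n" "\<ominus> (x [^] n) = eval p x"
    unfolding Span_powers_eval by blast
  have "eval (\<one> # p) x = x [^] n \<oplus> \<ominus> (x [^] n)" using p x by simp
  then have "eval (\<one> # p) x = \<zero>" using x by (simp add: r_neg)
  moreover have "\<one> # p \<in> carrier (univ_poly R (prime_subring R))"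
    using p subringE(3)[OF Z] unfolding univ_poly_carrier[symmetric] polynomial_def by simp
  ultimately show "x \<in> carrier (ring_of_integers R)"
    unfolding ring_of_integers_def using x by (auto intro!: bexI[of _ "\<one> # p"])
qed

end

section \<open>Bounded subrings and the ring of integers\<close>

lemma (in ring) minus_add_cancel: "\<lbrakk>a \<in> carrier R; b \<in> carrier R\<rbrakk> \<Longrightarrow> (a \<ominus> b) \<oplus> b = a"
  by (simp add: a_minus_def a_assoc l_neg)

text \<open>\<open>es\<close> generates a full \<open>\<int>\<close>-lattice; a subring is bounded if a common denominator maps it into
  that lattice. An element is integral iff it lies in a bounded subring.\<close>

locale full_lattice = field R for R (structure) +
  fixes es :: "'a list"
  assumes es_carrier: "set es \<subseteq> carrier R"
    and es_full: "x \<in> carrier R \<Longrightarrow> \<exists>s\<in>prime_subring R. s \<noteq> \<zero> \<and> s \<otimes> x \<in> Span (prime_subring R) es"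
begin

abbreviation "Z \<equiv> prime_subring R"
abbreviation "\<Lambda> \<equiv> Span Z es"

definition bounded_subring :: "'a set \<Rightarrow> bool" where
  "bounded_subring T \<longleftrightarrow> subring T R \<and> (\<exists>s\<in>carrier R. s \<noteq> \<zero> \<and> (\<forall>t\<in>T. s \<otimes> t \<in> \<Lambda>))"

lemmas Z_subring = prime_subring_is_subring
lemmas Z_E = subringE[OF prime_subring_is_subring]
lemmas \<Lambda>_closed = Span_subring_closed[OF prime_subring_is_subring es_carrier]

lemma lattice_denominator:
  "set us \<subseteq> carrier R \<Longrightarrow> \<exists>s\<in>Z. s \<noteq> \<zero> \<and> (\<forall>u\<in>set us. s \<otimes> u \<in> \<Lambda>)"
proof (induction us)
  case Nil
  show ?case using Z_E(3) one_not_zero by (intro bexI[of _ \<one>]) auto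
next
  case (Cons u us)
  then obtain s where s: "s \<in> Z" "s \<noteq> \<zero>" "\<And>v. v \<in> set us \<Longrightarrow> s \<otimes> v \<in> \<Lambda>" by auto
  obtain t where t: "t \<in> Z" "t \<noteq> \<zero>" "t \<otimes> u \<in> \<Lambda>" using es_full[of u] Cons.prems by auto
  have c: "s \<in> carrier R" "t \<in> carrier R" "u \<in> carrier R" using s t Z_E(1) Cons.prems by auto
  have "(s \<otimes> t) \<otimes> v \<in> \<Lambda>" if "v \<in> set (u # us)" for v
  proof (cases "v = u")
    case True
    have "(s \<otimes> t) \<otimes> u = s \<otimes> (t \<otimes> u)" using c by (simp add: m_assoc)
    then show ?thesis using True \<Lambda>_closed(3)[OF s(1) t(3)] by simp
  next
    case False
    then have v: "v \<in> set us" "v \<in> carrier R" using that Cons.prems by auto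
    then have "(s \<otimes> t) \<otimes> v = t \<otimes> (s \<otimes> v)" using c by (simp add: m_ac)
    then show ?thesis using \<Lambda>_closed(3)[OF t(1) s(3)[OF v(1)]] by simp
  qed
  moreover have "s \<otimes> t \<in> Z" "s \<otimes> t \<noteq> \<zero>" using Z_E(6) s t c integral_iff by auto
  ultimately show ?case by blast
qed

lemma bounded_subring_Z: "bounded_subring Z"
proof -
  obtain s where s: "s \<in> Z" "s \<noteq> \<zero>" "s \<otimes> \<one> \<in> \<Lambda>" using es_full[of \<one>] by auto
  have sc: "s \<in> carrier R" using s Z_E(1) by blast
  have "s \<otimes> z \<in> \<Lambda>" if "z \<in> Z" for z
  proof -
    have "z \<in> carrier R" using that Z_E(1) by blast
    then have "s \<otimes> z = z \<otimes> (s \<otimes> \<one>)" using sc by (simp add: m_comm)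
    then show ?thesis using \<Lambda>_closed(3)[OF that s(3)] by simp
  qed
  then show ?thesis unfolding bounded_subring_def using Z_subring sc s(2) by blast
qed

text \<open>The module \<open>s \<int>[x] \<subseteq> \<Lambda>\<close> is finitely generated, so a high power of \<open>x\<close> is a combination of
  lower ones.\<close>

lemma bounded_imp_integral:
  assumes "bounded_subring T" "x \<in> T"
  shows "x \<in> carrier (ring_of_integers R)"
proof -
  have T: "subring T R" using assms unfolding bounded_subring_def by blast
  obtain s where s: "s \<in> carrier R" "s \<noteq> \<zero>" "\<And>t. t \<in> T \<Longrightarrow> s \<otimes> t \<in> \<Lambda>"
    using assms unfolding bounded_subring_def by blast
  have x: "x \<in> carrier R" using assms(2) subringE(1)[OF T] by blast
  let ?D = "\<lambda>n. Span Z (powers_below x n)"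
  note D = Span_subring_closed[OF Z_subring powers_below_carrier[OF x]]
  have Dc: "?D n \<subseteq> carrier R" for n by (rule Span_carrier[OF Z_E(1) powers_below_carrier[OF x]])
  have ZT: "Z \<subseteq> T"
  proof
    fix z assume "z \<in> Z"
    then obtain k :: int where z: "z = add_pow R k \<one>" unfolding prime_subring_def by blast
    have "subgroup T (add_monoid R)" using T subring.axioms(1) by blast
    then show "z \<in> T" unfolding z
      using add.subgroup_int_pow_closed[of T \<one> k] subringE(3)[OF T] by simp
  qed
  have xT: "x [^] (n::nat) \<in> T" for n
    by (induction n) (use subringE(3,6)[OF T] assms(2) in auto)
  have "set (powers_below x n) \<subseteq> T" for n by (induction n) (use xT in auto)
  then have DT: "?D n \<subseteq> T" for n
    using subringE(2,6,7)[OF T] ZT by (intro Span_least) auto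
  define H where "H = (\<Union>n. (\<lambda>y. s \<otimes> y) ` ?D n)"
  have HI: "s \<otimes> y \<in> H" if "y \<in> ?D n" for y n unfolding H_def using that by blast
  have "\<exists>hs. set hs \<subseteq> H \<and> H \<subseteq> Span Z hs"
  proof (rule submodule_finitely_generated[OF es_carrier])
    show "H \<subseteq> \<Lambda>" unfolding H_def using s(3) DT by blast
    show "H \<noteq> {}" using HI[OF D(1)] by blast
    show "h \<oplus> h' \<in> H" if hh: "h \<in> H" "h' \<in> H" for h h'
    proof -
      obtain m n y y' where y: "y \<in> ?D m" "h = s \<otimes> y" "y' \<in> ?D n" "h' = s \<otimes> y'"
        using hh unfolding H_def by blast
      have "y \<in> ?D (max m n)" "y' \<in> ?D (max m n)"
        using y Span_powers_mono[OF Z_subring x, of m "max m n"]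
          Span_powers_mono[OF Z_subring x, of n "max m n"] by auto
      moreover have "h \<oplus> h' = s \<otimes> (y \<oplus> y')"
        unfolding y(2,4) using y(1,3) Dc s(1) by (simp add: r_distr subset_iff)
      ultimately show ?thesis using HI[OF D(2)] by simp
    qed
    show "of_int_ring k \<otimes> h \<in> H" if h: "h \<in> H" for k h
    proof -
      obtain n y where y: "y \<in> ?D n" "h = s \<otimes> y" using h unfolding H_def by blast
      have "y \<in> carrier R" using y Dc by blast
      then have "of_int_ring k \<otimes> h = s \<otimes> (of_int_ring k \<otimes> y)"
        unfolding y(2) using s(1) by (intro m_lcomm) auto
      moreover have "of_int_ring k \<in> Z" unfolding prime_subring_eq by blast
      ultimately show ?thesis using HI[OF D(3)[OF _ y(1)]] by simp
    qed
  qed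
  then obtain hs where hs: "set hs \<subseteq> H" "H \<subseteq> Span Z hs" by blast
  \<comment> \<open>Finitely many generators involve only powers of \<open>x\<close> below a common
    \<open>N\<close>; since \<open>s \<otimes> x [^] N\<close> is itself in \<open>H\<close>,
    cancelling \<open>s\<close> expresses \<open>x [^] N\<close> by lower powers.\<close>
  have "\<exists>N. set gs \<subseteq> (\<lambda>y. s \<otimes> y) ` ?D N" if "set gs \<subseteq> H" for gs
    using that
  proof (induction gs)
    case (Cons g gs)
    then obtain N where N: "set gs \<subseteq> (\<lambda>y. s \<otimes> y) ` ?D N" by auto
    obtain n y where y: "y \<in> ?D n" "g = s \<otimes> y" using Cons.prems unfolding H_def by auto
    have "?D N \<subseteq> ?D (max N n)" "?D n \<subseteq> ?D (max N n)"
      by (intro Span_powers_mono Z_subring x max.cobounded1 max.cobounded2)+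
    then have "set gs \<subseteq> (\<lambda>y. s \<otimes> y) ` ?D (max N n)" "g \<in> (\<lambda>y. s \<otimes> y) ` ?D (max N n)"
      using N y by blast+
    then have "set (g # gs) \<subseteq> (\<lambda>y. s \<otimes> y) ` ?D (max N n)" by simp
    then show ?case by blast
  qed auto
  then obtain N where N: "set hs \<subseteq> (\<lambda>y. s \<otimes> y) ` ?D N" using hs(1) by blast
  have "Span Z hs \<subseteq> (\<lambda>y. s \<otimes> y) ` ?D N"
  proof (rule Span_least[OF _ _ _ N])
    show "\<zero> \<in> (\<lambda>y. s \<otimes> y) ` ?D N" using D(1) s(1) by (intro image_eqI[of _ _ \<zero>]) auto
    show "h \<oplus> h' \<in> (\<lambda>y. s \<otimes> y) ` ?D N"
      if hh: "h \<in> (\<lambda>y. s \<otimes> y) ` ?D N" "h' \<in> (\<lambda>y. s \<otimes> y) ` ?D N" for h h'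
    proof -
      obtain y y' where y: "y \<in> ?D N" "h = s \<otimes> y" "y' \<in> ?D N" "h' = s \<otimes> y'" using hh by blast
      have "h \<oplus> h' = s \<otimes> (y \<oplus> y')"
        unfolding y(2,4) using y(1,3) Dc s(1) by (simp add: r_distr subset_iff)
      then show ?thesis using D(2)[OF y(1,3)] by blast
    qed
    show "a \<otimes> h \<in> (\<lambda>y. s \<otimes> y) ` ?D N" if a: "a \<in> Z" "h \<in> (\<lambda>y. s \<otimes> y) ` ?D N" for a h
    proof -
      obtain y where y: "y \<in> ?D N" "h = s \<otimes> y" using a by blast
      have "a \<otimes> h = s \<otimes> (a \<otimes> y)"
        unfolding y(2) using s(1) a(1) y(1) Dc Z_E(1) by (intro m_lcomm) auto
      then show ?thesis using D(3)[OF a(1) y(1)] by blast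
    qed
  qed
  moreover have "s \<otimes> x [^] N \<in> H"
    by (rule HI[OF power_mem_Span_powers[OF Z_subring x lessI]])
  ultimately obtain y where y: "y \<in> ?D N" "s \<otimes> x [^] N = s \<otimes> y" using hs(2) by blast
  then have "x [^] N = y" using m_lcancel[OF s(2,1)] x Dc by blast
  then show ?thesis unfolding mem_ring_of_integers_iff using x y(1) by blast
qed

text \<open>The relation for \<open>x [^] N\<close> makes the powers below \<open>N\<close> span the
  ring generated by \<open>x\<close> over \<open>T\<close>, so finitely many denominators suffice
  for the whole ring.\<close>

lemma bounded_subring_extension:
  assumes "bounded_subring T" "x \<in> carrier R" "x [^] N \<in> Span T (powers_below x N)"
  obtains T' where "bounded_subring T'" "T \<subseteq> T'" "x \<in> T'"
proof -
  have T: "subring T R" using assms unfolding bounded_subring_def by blast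
  note x = assms(2)
  note T' = subringE[OF T]
  obtain s where s: "s \<in> carrier R" "s \<noteq> \<zero>" "\<And>t. t \<in> T \<Longrightarrow> s \<otimes> t \<in> \<Lambda>"
    using assms unfolding bounded_subring_def by blast
  let ?M = "Span T (powers_below x N)"
  note M = Span_subring_closed[OF T powers_below_carrier[OF x]]
  have Mc: "Span T (powers_below x j) \<subseteq> carrier R" for j
    by (rule Span_carrier[OF T'(1) powers_below_carrier[OF x]])
  have N: "0 < N"
  proof (rule ccontr)
    assume "\<not> 0 < N"
    then show False using assms(3) one_not_zero by (simp add: Span_Nil_eq)
  qed
  have pow: "x [^] j \<in> ?M" if "j \<le> N" for j
    using that assms(3) power_mem_Span_powers[OF T x, of j N] by (cases "j = N") auto
  have step: "y \<otimes> x \<in> ?M" if "j \<le> N" "y \<in> Span T (powers_below x j)" for j y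
    using that
  proof (induction j arbitrary: y)
    case 0
    then show ?case using M(1) x by (simp add: Span_Nil_eq)
  next
    case (Suc j)
    obtain a v where y: "a \<in> T" "v \<in> Span T (powers_below x j)" "y = a \<otimes> x [^] j \<oplus> v"
      using Suc.prems(2) unfolding powers_below.simps Span_Cons_iff by blast
    have c: "a \<in> carrier R" "v \<in> carrier R" "x [^] j \<in> carrier R" using y T'(1) Mc x by auto
    have "y \<otimes> x = a \<otimes> (x [^] j \<otimes> x) \<oplus> v \<otimes> x" unfolding y(3) using c x by algebra
    moreover have "a \<otimes> (x [^] j \<otimes> x) \<in> ?M" using M(3)[OF y(1) pow[OF Suc.prems(1)]] by simp
    moreover have "v \<otimes> x \<in> ?M" using Suc.IH[OF _ y(2)] Suc.prems by simp
    ultimately show ?case using M(2) by simp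
  qed
  \<comment> \<open>\<open>simple_extension\<close> is generated by Horner steps, so closure of the
    span under multiplication by \<open>x\<close> and addition of constants is enough.\<close>
  have sub: "simple_extension T x \<subseteq> ?M"
  proof
    fix y assume "y \<in> simple_extension T x"
    then show "y \<in> ?M"
    proof (induction rule: simple_extension.induct)
      case zero
      show ?case by (rule M(1))
    next
      case (lin k1 k2)
      have "k2 \<in> carrier R" using lin T'(1) by blast
      then have "k2 = k2 \<otimes> x [^] (0::nat)" by simp
      then have "k2 \<in> ?M" using M(3)[OF lin(2) pow[of 0]] by simp
      then show ?case using M(2) step[OF order.refl lin(3)] by blast
    qed
  qed
  \<comment> \<open>The factor \<open>d\<close> makes multiplication by each \<open>x [^] i\<close>,
    i < N, map the lattice into itself; as \<open>s\<close> maps \<open>T\<close> into the lattice,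
    \<open>d \<otimes> s\<close> handles all terms with coefficients in \<open>T\<close>.\<close>
  have "set (map (\<lambda>(i, e). x [^] i \<otimes> e) (List.product [0..<N] es)) \<subseteq> carrier R"
    using x es_carrier by auto
  from lattice_denominator[OF this] obtain d where d: "d \<in> Z" "d \<noteq> \<zero>"
    "\<And>i e. \<lbrakk>i < N; e \<in> set es\<rbrakk> \<Longrightarrow> d \<otimes> (x [^] i \<otimes> e) \<in> \<Lambda>" by auto
  have dc: "d \<in> carrier R" using d(1) Z_E(1) by blast
  have mult: "(d \<otimes> x [^] i) \<otimes> v \<in> \<Lambda>" if i: "i < N" and "v \<in> \<Lambda>" for i v
  proof -
    define M' where "M' = {v \<in> carrier R. (d \<otimes> x [^] i) \<otimes> v \<in> \<Lambda>}"
    have dx: "d \<otimes> x [^] i \<in> carrier R" using dc x by simp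
    have "\<Lambda> \<subseteq> M'"
    proof (rule Span_least)
      show "\<zero> \<in> M'" unfolding M'_def using dx \<Lambda>_closed(1) by simp
      show "v \<oplus> w \<in> M'" if "v \<in> M'" "w \<in> M'" for v w
        using that \<Lambda>_closed(2) dx unfolding M'_def by (simp add: r_distr)
      show "a \<otimes> v \<in> M'" if a: "a \<in> Z" "v \<in> M'" for a v
      proof -
        have ac: "a \<in> carrier R" "v \<in> carrier R" using a Z_E(1) unfolding M'_def by auto
        have "(d \<otimes> x [^] i) \<otimes> (a \<otimes> v) = a \<otimes> ((d \<otimes> x [^] i) \<otimes> v)"
          using ac dx by (intro m_lcomm)
        then show ?thesis using a \<Lambda>_closed(3) ac unfolding M'_def by simp
      qed
      show "set es \<subseteq> M'"
      proof
        fix e assume e: "e \<in> set es"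
        then have "e \<in> carrier R" using es_carrier by blast
        then show "e \<in> M'" unfolding M'_def using d(3)[OF i e] dc x by (simp add: m_assoc)
      qed
    qed
    then show ?thesis using \<open>v \<in> \<Lambda>\<close> unfolding M'_def by blast
  qed
  have dsM: "(d \<otimes> s) \<otimes> y \<in> \<Lambda>" if "j \<le> N" "y \<in> Span T (powers_below x j)" for j y
    using that
  proof (induction j arbitrary: y)
    case 0
    then show ?case using \<Lambda>_closed(1) dc s(1) by (simp add: Span_Nil_eq)
  next
    case (Suc j)
    obtain a v where y: "a \<in> T" "v \<in> Span T (powers_below x j)" "y = a \<otimes> x [^] j \<oplus> v"
      using Suc.prems(2) unfolding powers_below.simps Span_Cons_iff by blast
    have c: "a \<in> carrier R" "v \<in> carrier R" "x [^] j \<in> carrier R" using y T'(1) Mc x by auto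
    have "(d \<otimes> s) \<otimes> y = (d \<otimes> x [^] j) \<otimes> (s \<otimes> a) \<oplus> (d \<otimes> s) \<otimes> v"
      unfolding y(3) using c dc s(1) by algebra
    moreover have "(d \<otimes> x [^] j) \<otimes> (s \<otimes> a) \<in> \<Lambda>" using mult[OF _ s(3)[OF y(1)]] Suc.prems(1) by simp
    moreover have "(d \<otimes> s) \<otimes> v \<in> \<Lambda>" using Suc.IH[OF _ y(2)] Suc.prems(1) by simp
    ultimately show ?case using \<Lambda>_closed(2) by simp
  qed
  have "bounded_subring (simple_extension T x)"
    unfolding bounded_subring_def
  proof (intro conjI bexI[of _ "d \<otimes> s"] ballI)
    show "subring (simple_extension T x) R" by (rule simple_extension_is_subring[OF T x])
    show "d \<otimes> s \<noteq> \<zero>" using d(2) s(2) dc s(1) integral_iff by simp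
    show "d \<otimes> s \<otimes> t \<in> \<Lambda>" if "t \<in> simple_extension T x" for t
      using dsM[OF order.refl] sub that by blast
  qed (use dc s in simp)
  then show ?thesis
    using that simple_extension_incl[OF T'(1) x] simple_extension_mem[OF T x] by blast
qed

lemma bounded_subring_insert_integral:
  assumes "bounded_subring T" "Z \<subseteq> T" "x \<in> carrier (ring_of_integers R)"
  obtains T' where "bounded_subring T'" "T \<subseteq> T'" "x \<in> T'"
proof -
  obtain n where n: "x \<in> carrier R" "x [^] n \<in> Span Z (powers_below x n)"
    using assms(3) unfolding mem_ring_of_integers_iff by blast
  then have "x [^] n \<in> Span T (powers_below x n)" using Span_mono[OF assms(2)] by blast
  then show ?thesis using bounded_subring_extension[OF assms(1) n(1)] that by blast
qed

text \<open>Adjoining both elements to the prime subring keeps it bounded. Sums and products stay in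
  this one ring, and everything in a bounded subring is integral.\<close>

lemma integral_pair:
  assumes "x \<in> carrier (ring_of_integers R)" "y \<in> carrier (ring_of_integers R)"
  obtains T where "bounded_subring T" "x \<in> T" "y \<in> T"
proof -
  obtain T where T: "bounded_subring T" "Z \<subseteq> T" "x \<in> T"
    by (rule bounded_subring_insert_integral[OF bounded_subring_Z order.refl assms(1)])
  obtain T' where "bounded_subring T'" "T \<subseteq> T'" "y \<in> T'"
    by (rule bounded_subring_insert_integral[OF T(1,2) assms(2)])
  then show ?thesis using that T(3) by blast
qed

lemma ring_of_integers_subring: "subring (carrier (ring_of_integers R)) R"
proof (rule subringI)
  show "carrier (ring_of_integers R) \<subseteq> carrier R" unfolding mem_ring_of_integers_iff subset_iff by blast
  show "\<one> \<in> carrier (ring_of_integers R)" by (rule bounded_imp_integral[OF bounded_subring_Z Z_E(3)])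
  fix x y assume x: "x \<in> carrier (ring_of_integers R)"
  {
    obtain T where T: "bounded_subring T" "x \<in> T" by (rule integral_pair[OF x x])
    then have "subring T R" unfolding bounded_subring_def by blast
    then show "\<ominus> x \<in> carrier (ring_of_integers R)"
      by (rule bounded_imp_integral[OF T(1) subringE(5)]) (rule T(2))
  }
  assume y: "y \<in> carrier (ring_of_integers R)"
  obtain T where T: "bounded_subring T" "x \<in> T" "y \<in> T" by (rule integral_pair[OF x y])
  then have sT: "subring T R" unfolding bounded_subring_def by blast
  show "x \<otimes> y \<in> carrier (ring_of_integers R)" "x \<oplus> y \<in> carrier (ring_of_integers R)"
    by (rule bounded_imp_integral[OF T(1) subringE(6)[OF sT T(2,3)]])
      (rule bounded_imp_integral[OF T(1) subringE(7)[OF sT T(2,3)]])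
qed

text \<open>If all \<open>w\<^sup>n c\<close> are integral, two of them are congruent modulo \<open>c\<close>, so \<open>w\<close> is a root of
  \<open>X\<^sup>j - X\<^sup>i - r\<close> with \<open>r\<close> integral.\<close>

lemma finite_quotient_domain_integers:
  assumes fin: "\<And>T x. \<lbrakk>subring T R; x \<in> T; x \<noteq> \<zero>\<rbrakk> \<Longrightarrow>
      finite (carrier (R\<lparr>carrier := T\<rparr> Quot (PIdl\<^bsub>R\<lparr>carrier := T\<rparr>\<^esub> x)))"
  shows "finite_quotient_domain (ring_of_integers R)"
proof -
  define T where "T = carrier (ring_of_integers R)"
  have eq: "ring_of_integers R = R\<lparr>carrier := T\<rparr>" unfolding T_def ring_of_integers_def by simp
  have sub: "subring T R" unfolding T_def by (rule ring_of_integers_subring)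
  interpret S: domain "R\<lparr>carrier := T\<rparr>" using subring_is_domain[OF sub] .
  have Tc: "T \<subseteq> carrier R" using subringE(1)[OF sub] .
  have "w \<in> T" if w: "w \<in> carrier R" and c: "c \<in> T" "c \<noteq> \<zero>" "\<forall>n::nat. w [^] n \<otimes> c \<in> T" for w c
  proof -
    let ?S = "R\<lparr>carrier := T\<rparr>"
    have I: "ideal (PIdl\<^bsub>?S\<^esub> c) ?S" using S.cgenideal_ideal[of c] c by simp
    obtain i j :: nat where ij: "i < j" "(w [^] j \<otimes> c) \<ominus>\<^bsub>?S\<^esub> (w [^] i \<otimes> c) \<in> PIdl\<^bsub>?S\<^esub> c"
      using S.quot_pigeonhole[OF I fin[OF sub c(1,2)], of "\<lambda>i. w [^] i \<otimes> c"] c(3) by auto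
    then obtain r where r: "r \<in> T" "(w [^] j \<otimes> c) \<ominus>\<^bsub>?S\<^esub> (w [^] i \<otimes> c) = r \<otimes> c"
      unfolding cgenideal_def by auto
    have "((w [^] j \<otimes> c) \<ominus>\<^bsub>?S\<^esub> (w [^] i \<otimes> c)) \<oplus>\<^bsub>?S\<^esub> (w [^] i \<otimes> c) = w [^] j \<otimes> c"
      by (rule S.minus_add_cancel) (use c(3) in auto)
    then have "r \<otimes> c \<oplus> w [^] i \<otimes> c = w [^] j \<otimes> c" unfolding r(2) by simp
    moreover have rc: "r \<in> carrier R" "c \<in> carrier R" "w [^] i \<in> carrier R" "w [^] j \<in> carrier R"
      using r(1) c(1) Tc w by auto
    ultimately have "(r \<oplus> w [^] i) \<otimes> c = w [^] j \<otimes> c" by (simp add: l_distr)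
    then have wj: "w [^] j = r \<oplus> w [^] i" using m_rcancel[OF c(2) rc(2)] rc by simp
    \<comment> \<open>Transitivity of integrality: \<open>r\<close> lies in a bounded subring
      \<open>A\<close>, over which the equation for \<open>w\<close> is monic, so adjoining
      \<open>w\<close> to \<open>A\<close> gives a bounded subring again.\<close>
    obtain A where A: "bounded_subring A" "r \<in> A"
      by (rule integral_pair[of r r]) (use r T_def in auto)
    have sA: "subring A R" using A unfolding bounded_subring_def by blast
    note M = Span_subring_closed[OF sA powers_below_carrier[OF w]]
    have "r \<otimes> w [^] (0::nat) \<in> Span A (powers_below w j)"
      using ij(1) by (intro M(3) A power_mem_Span_powers[OF sA w]) simp
    then have "w [^] j \<in> Span A (powers_below w j)"
      unfolding wj using M(2) power_mem_Span_powers[OF sA w ij(1)] rc by simp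
    then obtain A' where "bounded_subring A'" "w \<in> A'"
      by (rule bounded_subring_extension[OF A(1) w])
    then show ?thesis unfolding T_def by (rule bounded_imp_integral)
  qed
  then have "finite_quotient_domain (R\<lparr>carrier := T\<rparr>)"
    using fin[OF sub] by (intro finite_quotient_domain_subring[OF sub]) blast+
  then show ?thesis unfolding eq .
qed

end

lemma finite_quotient_domain_number_field:
  fixes K (structure)
  assumes "number_field K"
  shows "finite_quotient_domain (ring_of_integers K)"
proof -
  interpret field K using assms unfolding number_field_def by blast
  have fd: "finite_dimension (generate_field K {}) (carrier K)"
    using assms unfolding number_field_def by blast
  interpret B: coefficient_filtration K "\<lambda>n. of_int_ring ` {k. \<bar>k\<bar> \<le> 2 ^ n}" 4
    by (rule coefficient_filtration_ints)
  obtain es where es: "set es \<subseteq> carrier K"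
    "\<forall>x\<in>carrier K. \<exists>m. \<exists>s\<in>of_int_ring ` {k. \<bar>k\<bar> \<le> 2 ^ m}. s \<noteq> \<zero> \<and>
      s \<otimes> x \<in> Span (of_int_ring ` {k. \<bar>k\<bar> \<le> 2 ^ m}) es"
    by (rule B.finite_dimension_spanning[OF fd]) auto
  have incl: "of_int_ring ` A \<subseteq> prime_subring K" for A unfolding prime_subring_eq by blast
  interpret full_lattice K es
  proof
    fix x assume "x \<in> carrier K"
    then obtain m s where "s \<in> of_int_ring ` {k. \<bar>k\<bar> \<le> 2 ^ m}" "s \<noteq> \<zero>"
      "s \<otimes> x \<in> Span (of_int_ring ` {k. \<bar>k\<bar> \<le> 2 ^ m}) es" using es(2) by blast
    then show "\<exists>s\<in>prime_subring K. s \<noteq> \<zero> \<and> s \<otimes> x \<in> Span (prime_subring K) es"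
      using incl Span_mono[OF incl] by blast
  qed (rule es(1))
  show ?thesis
    using finite_dimension_finite_quot[OF B.coefficient_filtration_axioms fd]
    by (intro finite_quotient_domain_integers) auto
qed

theorem proposition6p2:
  fixes K R :: "('a, 'b) ring_scheme"
  assumes "number_field K \<and> R = ring_of_integers K \<or>
           global_function_field K \<and>
             (\<exists>\<Sigma>. \<Sigma> \<subseteq> places K \<and> finite \<Sigma> \<and> \<Sigma> \<noteq> {} \<and> R = ring_regular_away K \<Sigma>)"
  shows "(\<forall>P \<in> nonzero_primes R. finite (carrier (R Quot P))) \<and>
    (\<forall>n. finite {P \<in> nonzero_primes R. legendre_sum (residue_card R P) n \<noteq> 0} \<and>
         bhargava_factorial R (carrier R) n =
           prime_ideal_product R (\<lambda>P. legendre_sum (residue_card R P) n)) \<and>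
    (\<forall>P \<in> nonzero_primes R. \<forall>n \<ge> 1.
         recurrence_cocycle R (carrier R) P n =
           suminf (\<lambda>j. of_bool (residue_card R P ^ Suc j dvd n))) \<and>
    (\<forall>P \<in> nonzero_primes R. \<forall>n \<ge> 1.
         finite {j. j \<ge> 1 \<and> returns_to_start (residue_card R P ^ j) n} \<and>
         recurrence_cocycle R (carrier R) P n =
           int (card {j. j \<ge> 1 \<and> returns_to_start (residue_card R P ^ j) n}))"
proof -
  interpret finite_quotient_domain R
    using assms finite_quotient_domain_number_field finite_quotient_domain_function_field by blast
  show ?thesis
    using finite_prime_quot finite_support_legendre_sum bhargava_factorial_eq
      recurrence_cocycle_eq_suminf recurrence_cocycle_eq_card by blast
qed

end
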